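(* Let $k$ be a field of characteristic 2, let $X$ be an anisotropic quasilinear quadric over $k$, and let $r=i_1(X)$ be its first Witt index. Let $Y$ be a subquadric of $X$ of codimension $r-1$. Then $Y$ has first Witt index 1, and $X$ is birational to $Y\times \mathbf{P}^{r-1}$ over $k$.
   Context: A quadratic form $q$ over a field $k$ is a homogeneous polynomial of degree 2 on a finite-dimensional $k$-vector space $V$. It is isotropic if $q(x)=0$ for some nonzero $x\in V$, and anisotropic otherwise. Its projective quadric is $X=\{q=0\}\subset \mathbf{P}(V)$, of dimension $\dim V-2$; $X$ is called anisotropic (isotropic) if $q$ is. Quadrics are taken nonempty, so anisotropic quadrics come from forms of dimension at least 2; these are integral, and $k(X)=k(q)$ is the function field. In characteristic 2, $q$ (and $X$) is quasilinear if the bilinear form $q(x+y)-q(x)-q(y)$ is identically zero, equivalently $q=a_1x_1^2+\cdots+a_nx_n^2$ in coordinates. A subform of $q$ is any linear subspace of $V$ with the restricted form; a subquadric of $X$ is the quadric of a subform (of codimension equal to that of the subspace). The total index $i_t(q)$ is the maximum dimension of a linear subspace on which $q$ is identically zero. For $q$ anisotropic of dimension at least 2, the first Witt index $i_1(q)=i_1(X)$ is the total index of $q$ over $k(q)$. *)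

theory Defs
  imports
    "HOL-Library.Poly_Mapping"
    "HOL-Library.FuncSet"
    "HOL-Computational_Algebra.Fraction_Field"
    "HOL-Algebra.QuotRing"
    "HOL-Algebra.Algebraic_Closure_Type"
    "Jordan_Normal_Form.Missing_VectorSpace"
begin

section \<open>Multivariate polynomials\<close>

text \<open>Polynomials over \<open>'k\<close> in the variables \<open>x\<^sub>0, x\<^sub>1, x\<^sub>2, \<dots>\<close>: finitely supported functions
  from exponent vectors to coefficients.\<close>

type_synonym 'k mpoly = "(nat \<Rightarrow>\<^sub>0 nat) \<Rightarrow>\<^sub>0 'k"

definition mconst :: "'k::zero \<Rightarrow> 'k mpoly"
  where "mconst c = Poly_Mapping.single 0 c"

definition mvar :: "nat \<Rightarrow> 'k::zero_neq_one mpoly"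
  where "mvar i = Poly_Mapping.single (Poly_Mapping.single i 1) 1"

definition meval :: "('k::zero \<Rightarrow> 'b::comm_semiring_1) \<Rightarrow> (nat \<Rightarrow> 'b) \<Rightarrow> 'k mpoly \<Rightarrow> 'b"
  where "meval \<phi> x p = (\<Sum>e\<in>Poly_Mapping.keys p. \<phi> (Poly_Mapping.lookup p e) *
           (\<Prod>i\<in>Poly_Mapping.keys e. x i ^ Poly_Mapping.lookup e i))"

definition msubst :: "(nat \<Rightarrow> 'k::field mpoly) \<Rightarrow> 'k mpoly \<Rightarrow> 'k mpoly"
  where "msubst F p = meval mconst F p"

definition ring_meval ::
    "('b, 'z) ring_scheme \<Rightarrow> ('k::zero \<Rightarrow> 'b) \<Rightarrow> (nat \<Rightarrow> 'b) \<Rightarrow> 'k mpoly \<Rightarrow> 'b"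
  where "ring_meval K \<phi> x p =
           (\<Oplus>\<^bsub>K\<^esub>e\<in>Poly_Mapping.keys p. \<phi> (Poly_Mapping.lookup p e) \<otimes>\<^bsub>K\<^esub>
             (\<Otimes>\<^bsub>K\<^esub>i\<in>Poly_Mapping.keys e. x i [^]\<^bsub>K\<^esub> Poly_Mapping.lookup e i))"


section \<open>Integral hypersurfaces in products of projective spaces\<close>

text \<open>A family \<open>Bs\<close> of disjoint finite nonempty sets of variable indices stands for the product over
  \<open>B \<in> Bs\<close> of the projective spaces with homogeneous coordinates \<open>(x\<^sub>i)\<close>, \<open>i \<in> B\<close>. A multihomogeneous
  prime element \<open>h\<close> of the polynomial ring in these variables defines the integral closed subscheme
  \<open>{h = 0}\<close>; a polynomial in these variables vanishes on it iff \<open>h\<close> divides it.\<close>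

definition multihomogeneous :: "nat set set \<Rightarrow> (nat set \<Rightarrow> nat) \<Rightarrow> 'k::zero mpoly \<Rightarrow> bool"
  where "multihomogeneous Bs d p \<longleftrightarrow>
           (\<forall>e\<in>Poly_Mapping.keys p. Poly_Mapping.keys e \<subseteq> \<Union>Bs \<and>
              (\<forall>B\<in>Bs. (\<Sum>i\<in>B. Poly_Mapping.lookup e i) = d B))"

text \<open>The function field of \<open>{h = 0}\<close> is the residue field of the ambient space at the generic point
  of \<open>{h = 0}\<close>. The local ring at that point consists of the fractions \<open>f / g\<close> of multidegree \<open>0\<close>
  with \<open>g\<close> not divisible by \<open>h\<close>, and its maximal ideal of those with \<open>f\<close> divisible by \<open>h\<close>.\<close>

definition generic_local_ring :: "nat set set \<Rightarrow> 'k::field mpoly \<Rightarrow> 'k mpoly fract ring"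
  where "generic_local_ring Bs h = ring_of_type_algebra
           \<lparr>carrier := {Fract f g | f g d. multihomogeneous Bs d f \<and> multihomogeneous Bs d g \<and>
                          \<not> h dvd g}\<rparr>"

definition generic_max_ideal :: "nat set set \<Rightarrow> 'k::field mpoly \<Rightarrow> 'k mpoly fract set"
  where "generic_max_ideal Bs h =
           {Fract f g | f g d. multihomogeneous Bs d f \<and> multihomogeneous Bs d g \<and>
              \<not> h dvd g \<and> h dvd f}"

definition function_field :: "nat set set \<Rightarrow> 'k::field mpoly \<Rightarrow> 'k mpoly fract set ring"
  where "function_field Bs h = generic_local_ring Bs h Quot generic_max_ideal Bs h"

definition to_function_field ::
    "nat set set \<Rightarrow> 'k::field mpoly \<Rightarrow> 'k \<Rightarrow> 'k mpoly fract set"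
  where "to_function_field Bs h c =
           generic_max_ideal Bs h +>\<^bsub>generic_local_ring Bs h\<^esub> Fract (mconst c) 1"

text \<open>A family \<open>F\<close> represents a rational map over \<open>'k\<close> from \<open>{h = 0}\<close> to \<open>{h' = 0}\<close>: for each target
  factor \<open>C\<close> the coordinates \<open>F j\<close>, \<open>j \<in> C\<close>, are forms of one common multidegree that do not all
  vanish on \<open>{h = 0}\<close>. Every rational map between such schemes is represented in this way.\<close>

definition rational_map :: "nat set set \<Rightarrow> 'k::field mpoly \<Rightarrow> nat set set \<Rightarrow> 'k mpoly \<Rightarrow>
    (nat \<Rightarrow> 'k mpoly) \<Rightarrow> bool"
  where "rational_map Bs h Cs h' F \<longleftrightarrow>
           (\<forall>C\<in>Cs. (\<exists>d. \<forall>j\<in>C. multihomogeneous Bs d (F j)) \<and> (\<exists>j\<in>C. \<not> h dvd F j)) \<and>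
           h dvd msubst F h'"

text \<open>A self-map \<open>F\<close> of \<open>{h = 0}\<close> is the identity iff in each factor the coordinates \<open>F i\<close> are,
  on \<open>{h = 0}\<close>, not all zero and proportional to the coordinates \<open>x\<^sub>i\<close>.\<close>

definition represents_identity :: "nat set set \<Rightarrow> 'k::field mpoly \<Rightarrow> (nat \<Rightarrow> 'k mpoly) \<Rightarrow> bool"
  where "represents_identity Bs h F \<longleftrightarrow>
           (\<forall>B\<in>Bs. (\<exists>i\<in>B. \<not> h dvd F i) \<and>
              (\<forall>i\<in>B. \<forall>j\<in>B. h dvd F i * mvar j - F j * mvar i))"

text \<open>The composite ``first \<open>F\<close>, then \<open>G\<close>'' has the coordinates \<open>msubst F (G i)\<close>.\<close>

definition birational ::
    "nat set set \<Rightarrow> 'k::field mpoly \<Rightarrow> nat set set \<Rightarrow> 'k mpoly \<Rightarrow> bool"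
  where "birational Bs h Cs h' \<longleftrightarrow>
           (\<exists>F G. rational_map Bs h Cs h' F \<and> rational_map Cs h' Bs h G \<and>
              represents_identity Bs h (\<lambda>i. msubst F (G i)) \<and>
              represents_identity Cs h' (\<lambda>j. msubst G (F j)))"


section \<open>Quadratic forms\<close>

text \<open>The vector space is \<open>V = k\<^sup>n\<close>, and the quadric of \<open>q\<close> is \<open>{q = 0}\<close> in the projective space
  with coordinates \<open>x\<^sub>0, \<dots>, x\<^sub>n\<^sub>-\<^sub>1\<close>.\<close>

definition quadratic_form :: "nat \<Rightarrow> 'k::field mpoly \<Rightarrow> bool"
  where "quadratic_form n q \<longleftrightarrow> multihomogeneous {{..<n}} (\<lambda>_. 2) q"

definition anisotropic :: "nat \<Rightarrow> 'k::field mpoly \<Rightarrow> bool"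
  where "anisotropic n q \<longleftrightarrow> (\<forall>x. (\<exists>i<n. x i \<noteq> 0) \<longrightarrow> meval id x q \<noteq> 0)"

definition quasilinear :: "'k::field mpoly \<Rightarrow> bool"
  where "quasilinear q \<longleftrightarrow>
           (\<forall>x y. meval id (\<lambda>i. x i + y i) q - meval id x q - meval id y q = 0)"

text \<open>\<open>q'\<close> is the restriction of \<open>q\<close> to an \<open>m\<close>-dimensional subspace of \<open>k\<^sup>n\<close>, written in the
  coordinates of a basis \<open>u\<^sub>0, \<dots>, u\<^sub>m\<^sub>-\<^sub>1\<close> of that subspace.\<close>

definition subform :: "nat \<Rightarrow> 'k::field mpoly \<Rightarrow> nat \<Rightarrow> 'k mpoly \<Rightarrow> bool"
  where "subform m q' n q \<longleftrightarrow>
           (\<exists>u :: nat \<Rightarrow> nat \<Rightarrow> 'k.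
              (\<forall>c. (\<forall>i<n. (\<Sum>j<m. c j * u j i) = 0) \<longrightarrow> (\<forall>j<m. c j = 0)) \<and>
              q' = msubst (\<lambda>i. \<Sum>j<m. mconst (u j i) * mvar j) q)"

definition coord_space :: "('b, 'z) ring_scheme \<Rightarrow> nat \<Rightarrow> ('b, nat \<Rightarrow> 'b) module"
  where "coord_space K n =
           \<lparr>carrier = {..<n} \<rightarrow>\<^sub>E carrier K,
            monoid.mult = undefined,
            one = undefined,
            zero = (\<lambda>i\<in>{..<n}. \<zero>\<^bsub>K\<^esub>),
            add = (\<lambda>v w. \<lambda>i\<in>{..<n}. v i \<oplus>\<^bsub>K\<^esub> w i),
            module.smult = (\<lambda>a v. \<lambda>i\<in>{..<n}. a \<otimes>\<^bsub>K\<^esub> v i)\<rparr>"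

text \<open>The total index of \<open>q\<close> after extending scalars along \<open>\<phi>\<close> to \<open>K\<close>.\<close>

definition total_index ::
    "('b, 'z) ring_scheme \<Rightarrow> ('k::field \<Rightarrow> 'b) \<Rightarrow> nat \<Rightarrow> 'k mpoly \<Rightarrow> nat"
  where "total_index K \<phi> n q =
           Max {vectorspace.dim K (coord_space K n\<lparr>carrier := W\<rparr>) | W.
                  subspace K W (coord_space K n) \<and> (\<forall>w\<in>W. ring_meval K \<phi> w q = \<zero>\<^bsub>K\<^esub>)}"

definition first_witt_index :: "nat \<Rightarrow> 'k::field mpoly \<Rightarrow> nat"
  where "first_witt_index n q =
           total_index (function_field {{..<n}} q) (to_function_field {{..<n}} q) n q"

end

theory Submission
  imports Defs "HOL-Library.Function_Algebras"
begin

text \<open>In suitable coordinates \<open>q = \<Sum>i a\<^sub>i x\<^sub>i\<^sup>2\<close>. Let \<open>\<Omega>\<close> be an algebraic closure of \<open>k\<close> and \<open>\<alpha>\<^sub>i \<in> \<Omega>\<close>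
  the square root of \<open>a\<^sub>i\<close>. In characteristic two \<open>q\<close> is the square of the linear form \<open>\<epsilon> = \<Sum>i \<alpha>\<^sub>i
  x\<^sub>i\<close>, and \<open>q\<close> is anisotropic iff the \<open>\<alpha>\<^sub>i\<close> are linearly independent over \<open>k\<close>. Everything takes
  place inside the field \<open>M\<close> of rational functions over \<open>\<Omega>\<close>. A generic point \<open>\<xi>\<close> of \<open>X\<close> has the
  independent variables \<open>x\<^sub>1, x\<^sub>2, \<dots>\<close> as coordinates, and \<open>\<xi>\<^sub>0\<close> is determined by \<open>\<epsilon>(\<xi>) = 0\<close>. The
  function field of \<open>X\<close> is the field \<open>K \<subseteq> M\<close> of the fractions \<open>f(\<xi>)/g(\<xi>)\<close> with \<open>f\<close>, \<open>g\<close> forms of one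
  degree over \<open>k\<close> (\<open>function_field_embedding\<close>). Over a field \<open>L\<close> with \<open>k \<subseteq> L \<subseteq> M\<close> the zeros of \<open>q\<close>
  form a linear space, \<open>W(L) = {v \<in> L\<^sup>n. \<Sum>i \<alpha>\<^sub>i v\<^sub>i = 0}\<close>, and \<open>r = i\<^sub>1(X)\<close> is the dimension of
  \<open>W(K)\<close> (\<open>first_witt_index_eq_dim_zeros\<close>).

  The first ingredient is a descent (\<open>zeros_span_descent\<close>): if \<open>k \<subseteq> F \<subseteq> K\<close> and \<open>q\<close> has a nonzero
  zero \<open>z\<close> over \<open>F\<close>, then \<open>W(F)\<close> spans \<open>W(K)\<close>. For \<open>v \<in> W(K)\<close> and \<open>z\<close> with polynomial coordinates,
  \<open>\<epsilon>\<close> divides both \<open>\<Sum>i \<alpha>\<^sub>i v\<^sub>i = \<epsilon> e\<^sub>v\<close> and \<open>\<Sum>i \<alpha>\<^sub>i z\<^sub>i = \<epsilon> e\<^sub>z\<close>, and \<open>e\<^sub>z\<^sup>2\<close> has coefficients in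
  \<open>k\<close>. Hence \<open>e\<^sub>z\<^sup>2 (\<Sum>i \<alpha>\<^sub>i v\<^sub>i) = (e\<^sub>z e\<^sub>v) (\<Sum>i \<alpha>\<^sub>i z\<^sub>i)\<close>. Comparing coefficients in a basis of \<open>\<Omega>\<close>
  over \<open>k\<close> that contains the \<open>\<alpha>\<^sub>i\<close>, one writes \<open>v\<close> as a combination of vectors of \<open>W(F)\<close>.

  Now let \<open>Y\<close> be given by a subspace \<open>U\<close> of dimension \<open>m = n - (r - 1)\<close>. As \<open>m + r > n\<close>, the space
  \<open>U \<otimes> K\<close> contains a nonzero zero \<open>z\<close> of \<open>q\<close> (\<open>subform_zero_exists\<close>). Apply the descent to the field
  \<open>F\<close> generated over \<open>k\<close> by the ratios of the coordinates of \<open>z\<close>: the space \<open>W(F)\<close> has a basis \<open>b\<^sub>1,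
  \<dots>, b\<^sub>r\<close>, which depends rationally on \<open>z\<close>, and \<open>\<xi> = \<Sum>l p\<^sub>l b\<^sub>l(z)\<close> with coefficients \<open>p\<^sub>l\<close> that are
  rational in \<open>\<xi>\<close>. So \<open>\<xi>\<close> can be recovered from \<open>z\<close> and \<open>p\<close>, which is a point of \<open>Y \<times> P\<^sup>r\<^sup>-\<^sup>1\<close>.

  It remains to see that this point is generic. After rescaling \<open>z\<close> by a further variable, all of
  \<open>x\<^sub>0, \<dots>, x\<^sub>n\<^sub>-\<^sub>1\<close> lie in the field generated over \<open>\<Omega>\<close> by \<open>m - 1\<close> coordinates of \<open>z\<close> and by the \<open>r\<close>
  numbers \<open>p\<^sub>l\<close>. These are \<open>m - 1 + r = n\<close> generators, so that they are algebraically independent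
  (\<open>parametrization\<close>). In place of transcendence degrees this count uses bases of \<open>M\<close> over the
  subfield of squares (\<open>square_independent_exchange\<close>). The same count with one generator less is
  impossible, so no nonzero zero of \<open>q\<close> over \<open>K\<close> has last coordinate zero in a basis of \<open>U\<close>
  (\<open>subform_zero_eq_0\<close>). Two independent zeros in \<open>U \<otimes> K\<close> would have a nonzero combination of this
  kind, and therefore \<open>Y\<close> has first Witt index one. Since \<open>\<xi>\<close> and \<open>(z, p)\<close> are generic points, the
  identities that make \<open>x \<mapsto> (z(x), p(x))\<close> and \<open>(y, p) \<mapsto> \<Sum>l p\<^sub>l b\<^sub>l(y)\<close> inverse birational maps need
  to be checked at these two points only (\<open>index_and_birational\<close>).\<close>

section \<open>Evaluation of polynomials\<close>

lemma mpoly_sum_monomials: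
  fixes p :: "'k::comm_monoid_add mpoly"
  shows "p = (\<Sum>e\<in>Poly_Mapping.keys p. Poly_Mapping.single e (Poly_Mapping.lookup p e))"
  by (rule poly_mapping_eqI)
     (auto simp: lookup_sum lookup_single when_def in_keys_iff)

lemma mpoly_additive_induct [case_names single add]:
  fixes p :: "'k::comm_monoid_add mpoly"
  assumes "\<And>e c. P (Poly_Mapping.single e c)"
    and "\<And>p q. P p \<Longrightarrow> P q \<Longrightarrow> P (p + q)"
  shows "P p"
proof -
  have "P (\<Sum>e\<in>A. Poly_Mapping.single e (Poly_Mapping.lookup p e))" if "finite A" for A
    using that
  proof induction
    case empty
    have "P (Poly_Mapping.single 0 0)" by (rule assms(1))
    then show ?case by simp
  qed (auto intro: assms)
  from this[of "Poly_Mapping.keys p"] show ?thesis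
    by (simp flip: mpoly_sum_monomials)
qed

definition monom_eval :: "(nat \<Rightarrow> 'b::comm_monoid_mult) \<Rightarrow> (nat \<Rightarrow>\<^sub>0 nat) \<Rightarrow> 'b" where
  "monom_eval x e = (\<Prod>i\<in>Poly_Mapping.keys e. x i ^ Poly_Mapping.lookup e i)"

lemma monom_eval_superset:
  assumes "finite A" "Poly_Mapping.keys e \<subseteq> A"
  shows "monom_eval x e = (\<Prod>i\<in>A. x i ^ Poly_Mapping.lookup e i)"
  unfolding monom_eval_def using assms
  by (intro prod.mono_neutral_left) (auto simp: in_keys_iff)

lemma monom_eval_0 [simp]: "monom_eval x 0 = 1"
  by (simp add: monom_eval_def)

lemma monom_eval_single [simp]: "monom_eval x (Poly_Mapping.single i n) = x i ^ n"
  by (cases "n = 0") (auto simp: monom_eval_def)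

lemma monom_eval_add: "monom_eval x (e + f) = monom_eval x e * monom_eval x f"
proof -
  let ?A = "Poly_Mapping.keys e \<union> Poly_Mapping.keys f"
  have "Poly_Mapping.keys (e + f) \<subseteq> ?A" by (rule Poly_Mapping.keys_add)
  then show ?thesis
    by (simp add: monom_eval_superset[of ?A] lookup_add power_add prod.distrib)
qed

lemma monom_eval_mult: "monom_eval (\<lambda>i. x i * y i) e = monom_eval x e * monom_eval y e"
  by (simp add: monom_eval_def power_mult_distrib prod.distrib)

lemma meval_monom_eval:
  "meval \<phi> x p = (\<Sum>e\<in>Poly_Mapping.keys p. \<phi> (Poly_Mapping.lookup p e) * monom_eval x e)"
  by (simp add: meval_def monom_eval_def)

definition mvars :: "'k::zero mpoly \<Rightarrow> nat set" where
  "mvars p = (\<Union>e\<in>Poly_Mapping.keys p. Poly_Mapping.keys e)"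

lemma meval_cong:
  assumes "\<And>i. i \<in> mvars p \<Longrightarrow> x i = y i"
  shows "meval \<phi> x p = meval \<phi> y p"
proof -
  have "x i = y i" if "e \<in> Poly_Mapping.keys p" "i \<in> Poly_Mapping.keys e" for e i
    using that assms by (auto simp: mvars_def)
  then show ?thesis by (simp add: meval_def)
qed

lemma mvars_add: "mvars (p + q) \<subseteq> mvars p \<union> mvars q"
  unfolding mvars_def using Poly_Mapping.keys_add[of p q] by blast

lemma mvars_mult:
  fixes p q :: "'k::comm_semiring_0 mpoly"
  shows "mvars (p * q) \<subseteq> mvars p \<union> mvars q"
proof
  fix i assume "i \<in> mvars (p * q)"
  then obtain e where e: "e \<in> Poly_Mapping.keys (p * q)" "i \<in> Poly_Mapping.keys e"
    by (auto simp: mvars_def)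
  then obtain f g where "e = f + g" "f \<in> Poly_Mapping.keys p" "g \<in> Poly_Mapping.keys q"
    using Poly_Mapping.keys_mult[of p q] by blast
  with e(2) show "i \<in> mvars p \<union> mvars q"
    using Poly_Mapping.keys_add[of f g] by (auto simp: mvars_def)
qed

lemma mvars_sum: "mvars (\<Sum>i\<in>A. f i) \<subseteq> (\<Union>i\<in>A. mvars (f i))"
proof (induction A rule: infinite_finite_induct)
  case (insert a A)
  then show ?case using mvars_add[of "f a" "sum f A"] by auto
qed (auto simp: mvars_def)

lemma mvars_mconst [simp]: "mvars (mconst c) = {}"
  by (auto simp: mvars_def mconst_def)

lemma mvars_mvar [simp]: "mvars (mvar i :: 'k::zero_neq_one mpoly) = {i}"
  by (auto simp: mvars_def mvar_def)

lemma mconst_add: "mconst (a + b) = mconst a + mconst b"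
  by (simp add: mconst_def single_add)

lemma mconst_mult: "mconst (a * b :: 'k::comm_semiring_0) = mconst a * mconst b"
  by (simp add: mconst_def mult_single)

lemma mconst_0 [simp]: "mconst 0 = 0" and mconst_1 [simp]: "mconst 1 = 1"
  by (simp_all add: mconst_def)

lemma mvars_1 [simp]: "mvars (1 :: 'k::zero_neq_one mpoly) = {}"
  using mvars_mconst[of "1::'k"] by (simp del: mvars_mconst)

lemma mvar_ne_0 [simp]: "(mvar i :: 'k::zero_neq_one mpoly) \<noteq> 0"
  by (simp add: mvar_def poly_mapping_eq_iff fun_eq_iff)
     (metis lookup_single_eq lookup_zero zero_neq_one)

lemma mvar_power: "(mvar i :: 'k::comm_semiring_1 mpoly) ^ n = Poly_Mapping.single (Poly_Mapping.single i n) 1"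
  by (induction n) (simp_all add: mvar_def mult_single flip: single_add)

lemma lookup_mconst_mult:
  "Poly_Mapping.lookup (mconst c * p) e = c * Poly_Mapping.lookup (p :: 'k::comm_semiring_1 mpoly) e"
proof (induction p rule: mpoly_additive_induct)
  case (single f d)
  then show ?case by (simp add: mconst_def mult_single lookup_single when_def)
qed (simp add: distrib_left lookup_add)

lemma monom_eval_mvar: "monom_eval mvar e = (Poly_Mapping.single e 1 :: 'k::comm_semiring_1 mpoly)"
proof -
  have "(\<Prod>i\<in>A. mvar i ^ Poly_Mapping.lookup e i) =
      (Poly_Mapping.single (\<Sum>i\<in>A. Poly_Mapping.single i (Poly_Mapping.lookup e i)) 1 :: 'k mpoly)"
    if "finite A" for A
    using that by induction (simp_all add: mvar_power mult_single)
  moreover have "(\<Sum>i\<in>Poly_Mapping.keys e. Poly_Mapping.single i (Poly_Mapping.lookup e i)) = e"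
    by (rule poly_mapping_eqI) (auto simp: lookup_sum lookup_single when_def in_keys_iff)
  ultimately show ?thesis by (simp add: monom_eval_def)
qed

lemma single_eq_mconst_monom:
  "Poly_Mapping.single e c = mconst c * monom_eval mvar e" for c :: "'k::comm_semiring_1"
  by (simp add: monom_eval_mvar mconst_def mult_single)

lemma mpoly_ring_induct [case_names mconst mvar add mult]:
  fixes p :: "'k::comm_semiring_1 mpoly"
  assumes c: "\<And>c. P (mconst c)" and v: "\<And>i. P (mvar i)"
    and add: "\<And>p q. P p \<Longrightarrow> P q \<Longrightarrow> P (p + q)" and mult: "\<And>p q. P p \<Longrightarrow> P q \<Longrightarrow> P (p * q)"
  shows "P p"
proof (induction p rule: mpoly_additive_induct)
  case (single e c)
  have 1: "P 1" using c[of 1] by simp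
  have pow: "P (mvar i ^ n)" for i n by (induction n) (auto simp: 1 intro: v mult)
  have "P (\<Prod>i\<in>A. mvar i ^ Poly_Mapping.lookup e i)" if "finite A" for A
    using that by induction (auto simp: 1 intro: pow mult)
  then show ?case unfolding single_eq_mconst_monom monom_eval_def
    by (intro mult c) auto
qed (rule add)

text \<open>The evaluation \<^const>\<open>meval\<close> is a ring homomorphism as soon as the map on the coefficients is one.
  The homomorphism is a locale parameter because evaluation is used with several coefficient maps:
  the inclusions of \<open>k\<close> and \<open>\<Omega>\<close> into rational functions, and \<^const>\<open>mconst\<close>, which gives substitution.\<close>

locale coefficient_hom =
  fixes \<phi> :: "'k::comm_ring_1 \<Rightarrow> 'b::comm_ring_1"
  assumes hom_add: "\<phi> (a + b) = \<phi> a + \<phi> b"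
    and hom_mult: "\<phi> (a * b) = \<phi> a * \<phi> b"
    and hom_1 [simp]: "\<phi> 1 = 1"
begin

lemma hom_0 [simp]: "\<phi> 0 = 0"
  using hom_add[of 0 0] by simp

lemma hom_uminus: "\<phi> (- a) = - \<phi> a"
  using hom_add[of a "- a"] by (simp add: eq_neg_iff_add_eq_0 add.commute)

lemma hom_diff: "\<phi> (a - b) = \<phi> a - \<phi> b"
  using hom_add[of a "- b"] by (simp add: hom_uminus)

lemma hom_power: "\<phi> (a ^ n) = \<phi> a ^ n"
  by (induction n) (auto simp: hom_mult)

lemma hom_sum: "\<phi> (\<Sum>i\<in>A. f i) = (\<Sum>i\<in>A. \<phi> (f i))"
  by (induction A rule: infinite_finite_induct) (auto simp: hom_add)

lemma hom_prod: "\<phi> (\<Prod>i\<in>A. f i) = (\<Prod>i\<in>A. \<phi> (f i))"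
  by (induction A rule: infinite_finite_induct) (auto simp: hom_mult)

lemma hom_monom_eval: "\<phi> (monom_eval x e) = monom_eval (\<lambda>i. \<phi> (x i)) e"
  by (simp add: monom_eval_def hom_prod hom_power)

lemma meval_superset:
  assumes "finite A" "Poly_Mapping.keys p \<subseteq> A"
  shows "meval \<phi> x p = (\<Sum>e\<in>A. \<phi> (Poly_Mapping.lookup p e) * monom_eval x e)"
  unfolding meval_monom_eval using assms
  by (intro sum.mono_neutral_left) (auto simp: in_keys_iff)

lemma meval_single [simp]: "meval \<phi> x (Poly_Mapping.single e c) = \<phi> c * monom_eval x e"
  by (subst meval_superset[of "{e}"]) auto

lemma meval_mconst [simp]: "meval \<phi> x (mconst c) = \<phi> c"
  by (simp add: mconst_def)

lemma meval_mvar [simp]: "meval \<phi> x (mvar i) = x i"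
  by (simp add: mvar_def)

lemma meval_0 [simp]: "meval \<phi> x 0 = 0"
  by (simp add: meval_def)

lemma meval_1 [simp]: "meval \<phi> x 1 = 1"
  using meval_mconst[of x 1] by simp

lemma meval_add: "meval \<phi> x (p + q) = meval \<phi> x p + meval \<phi> x q"
proof -
  let ?A = "Poly_Mapping.keys p \<union> Poly_Mapping.keys q"
  have "Poly_Mapping.keys (p + q) \<subseteq> ?A" by (rule Poly_Mapping.keys_add)
  then show ?thesis
    by (simp add: meval_superset[of ?A] lookup_add hom_add ring_distribs sum.distrib)
qed

lemma meval_mult: "meval \<phi> x (p * q) = meval \<phi> x p * meval \<phi> x q"
proof (induction p rule: mpoly_additive_induct)
  case (single e c)
  show ?case
    by (induction q rule: mpoly_additive_induct)
       (simp_all add: mult_single hom_mult monom_eval_add meval_add ring_distribs mult_ac)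
qed (simp add: meval_add ring_distribs)

lemma coefficient_hom_meval: "coefficient_hom (meval \<phi> x)"
  by unfold_locales (simp_all add: meval_add meval_mult)

lemmas meval_diff = coefficient_hom.hom_diff[OF coefficient_hom_meval]
lemmas meval_power = coefficient_hom.hom_power[OF coefficient_hom_meval]
lemmas meval_sum = coefficient_hom.hom_sum[OF coefficient_hom_meval]

end

lemma coefficient_hom_mconst: "coefficient_hom (mconst :: 'k::comm_ring_1 \<Rightarrow> _)"
  by unfold_locales (simp_all add: mconst_add mconst_mult)

lemma coefficient_hom_comp:
  assumes "coefficient_hom f" "coefficient_hom g"
  shows "coefficient_hom (\<lambda>c. g (f c))"
  using assms by (simp add: coefficient_hom_def)

lemma (in coefficient_hom) meval_comp:
  assumes "coefficient_hom \<psi>"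
  shows "\<psi> (meval \<phi> x p) = meval (\<lambda>c. \<psi> (\<phi> c)) (\<lambda>i. \<psi> (x i)) p"
proof -
  interpret \<psi>: coefficient_hom \<psi> by fact
  show ?thesis
    by (simp add: meval_monom_eval \<psi>.hom_sum \<psi>.hom_mult \<psi>.hom_monom_eval)
qed

interpretation msubst: coefficient_hom "mconst :: 'k::field \<Rightarrow> 'k mpoly"
  rewrites "meval mconst = msubst"
  by (rule coefficient_hom_mconst) (simp add: msubst_def fun_eq_iff)

lemma (in coefficient_hom) meval_msubst:
  fixes F :: "nat \<Rightarrow> 'f::field mpoly" and \<psi> :: "'f \<Rightarrow> 'b"
  assumes "coefficient_hom \<psi>"
  shows "meval \<psi> x (msubst F p) = meval \<psi> (\<lambda>i. meval \<psi> x (F i)) p"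
proof -
  interpret \<psi>: coefficient_hom \<psi> by fact
  show ?thesis
    using msubst.meval_comp[OF \<psi>.coefficient_hom_meval, of x F p] by simp
qed

lemma msubst_mvar: "msubst mvar p = p"
  by (simp add: msubst_def meval_monom_eval monom_eval_mvar mconst_def mult_single
           flip: mpoly_sum_monomials)

lemma msubst_cong_dvd:
  fixes F G :: "nat \<Rightarrow> 'k::field mpoly"
  assumes "\<And>i. h dvd F i - G i"
  shows "h dvd msubst F p - msubst G p"
proof (induction p rule: mpoly_ring_induct)
  case (mult p q)
  have "msubst F (p * q) - msubst G (p * q) =
      msubst F p * (msubst F q - msubst G q) + (msubst F p - msubst G p) * msubst G q"
    by (simp add: msubst.meval_mult algebra_simps)
  then show ?case using mult by simp
next
  case (add p q)
  have "msubst F (p + q) - msubst G (p + q) =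
      (msubst F p - msubst G p) + (msubst F q - msubst G q)"
    by (simp add: msubst.meval_add)
  then show ?case using add by (metis dvd_add)
qed (simp_all add: assms)

lemma mvars_msubst: "mvars (msubst F p) \<subseteq> (\<Union>i\<in>mvars p. mvars (F i))"
proof -
  have pow: "mvars (f ^ n) \<subseteq> mvars f" for f :: "'a mpoly" and n
  proof (induction n)
    case 0
    then show ?case by simp
  next
    case (Suc n)
    then show ?case using mvars_mult[of f "f ^ n"] by auto
  qed
  have pr: "mvars (\<Prod>i\<in>A. f i) \<subseteq> (\<Union>i\<in>A. mvars (f i))" for f :: "nat \<Rightarrow> 'a mpoly" and A
  proof (induction A rule: infinite_finite_induct)
    case (insert a A)
    then show ?case using mvars_mult[of "f a" "prod f A"] by auto
  qed auto
  have "mvars (mconst c * monom_eval F e) \<subseteq> (\<Union>i\<in>mvars p. mvars (F i))"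
    if e: "e \<in> Poly_Mapping.keys p" for c e
  proof -
    have "mvars (mconst c * monom_eval F e) \<subseteq> mvars (monom_eval F e)"
      using mvars_mult[of "mconst c" "monom_eval F e"] by simp
    also have "\<dots> \<subseteq> (\<Union>i\<in>Poly_Mapping.keys e. mvars (F i ^ Poly_Mapping.lookup e i))"
      unfolding monom_eval_def by (rule pr)
    also have "\<dots> \<subseteq> (\<Union>i\<in>Poly_Mapping.keys e. mvars (F i))"
      using pow by blast
    also have "\<dots> \<subseteq> (\<Union>i\<in>mvars p. mvars (F i))"
      using e by (auto simp: mvars_def[of p])
    finally show ?thesis .
  qed
  then show ?thesis
    unfolding msubst_def meval_monom_eval
    by (intro order_trans[OF mvars_sum] UN_least)
qed

section \<open>Multihomogeneous polynomials\<close>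

lemma multihomogeneous_0 [simp]: "multihomogeneous Bs d 0"
  by (simp add: multihomogeneous_def)

lemma multihomogeneous_mconst [simp]: "multihomogeneous Bs (\<lambda>_. 0) (mconst c)"
  by (auto simp: multihomogeneous_def mconst_def)

lemma multihomogeneous_add:
  "multihomogeneous Bs d p \<Longrightarrow> multihomogeneous Bs d q \<Longrightarrow> multihomogeneous Bs d (p + q)"
  unfolding multihomogeneous_def using Poly_Mapping.keys_add[of p q] by blast

lemma multihomogeneous_mult:
  fixes p q :: "'k::comm_semiring_0 mpoly"
  assumes p: "multihomogeneous Bs d p" and q: "multihomogeneous Bs d' q"
  shows "multihomogeneous Bs (\<lambda>B. d B + d' B) (p * q)"
  unfolding multihomogeneous_def
proof
  fix e assume "e \<in> Poly_Mapping.keys (p * q)"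
  then obtain f g where e: "e = f + g" "f \<in> Poly_Mapping.keys p" "g \<in> Poly_Mapping.keys q"
    using Poly_Mapping.keys_mult[of p q] by blast
  have "Poly_Mapping.keys e \<subseteq> Poly_Mapping.keys f \<union> Poly_Mapping.keys g"
    unfolding e(1) by (rule Poly_Mapping.keys_add)
  also have "\<dots> \<subseteq> \<Union> Bs"
    using p q e(2,3) by (auto simp: multihomogeneous_def)
  finally have "Poly_Mapping.keys e \<subseteq> \<Union> Bs" .
  moreover have "(\<Sum>i\<in>B. Poly_Mapping.lookup e i) = d B + d' B" if "B \<in> Bs" for B
    using p q e that by (simp add: multihomogeneous_def lookup_add sum.distrib)
  ultimately show "Poly_Mapping.keys e \<subseteq> \<Union> Bs \<and>
      (\<forall>B\<in>Bs. (\<Sum>i\<in>B. Poly_Mapping.lookup e i) = d B + d' B)"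
    by blast
qed

lemma multihomogeneous_sum:
  "(\<And>i. i \<in> A \<Longrightarrow> multihomogeneous Bs d (f i)) \<Longrightarrow> multihomogeneous Bs d (\<Sum>i\<in>A. f i)"
  by (induction A rule: infinite_finite_induct) (auto intro: multihomogeneous_add)

lemma multihomogeneous_mconst_mult:
  "multihomogeneous Bs d p \<Longrightarrow> multihomogeneous Bs d (mconst c * p)"
  for p :: "'k::comm_semiring_1 mpoly"
  using multihomogeneous_mult[OF multihomogeneous_mconst[of Bs c], of d p] by simp

lemma multihomogeneous_cong:
  "(\<And>B. B \<in> Bs \<Longrightarrow> d B = d' B) \<Longrightarrow> multihomogeneous Bs d p = multihomogeneous Bs d' p"
  by (auto simp: multihomogeneous_def)

lemma multihomogeneous_mvars: "multihomogeneous Bs d p \<Longrightarrow> mvars p \<subseteq> \<Union>Bs"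
  by (auto simp: multihomogeneous_def mvars_def)

abbreviation hom_poly :: "nat \<Rightarrow> nat \<Rightarrow> 'k::zero mpoly \<Rightarrow> bool" where
  "hom_poly n d \<equiv> multihomogeneous {{..<n}} (\<lambda>_. d)"

lemma hom_poly_mult: "hom_poly n d p \<Longrightarrow> hom_poly n d' q \<Longrightarrow> hom_poly n (d + d') (p * q)"
  for p q :: "'k::comm_semiring_0 mpoly"
  by (rule multihomogeneous_mult)

lemma hom_poly_power: "hom_poly n d p \<Longrightarrow> hom_poly n (d * k) (p ^ k)"
  for p :: "'k::comm_semiring_1 mpoly"
proof (induction k)
  case 0
  show ?case using multihomogeneous_mconst[of "{{..<n}}" "1::'k"] by simp
next
  case (Suc k)
  then show ?case using hom_poly_mult[of n d p "d * k" "p ^ k"] by simp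
qed

lemma hom_poly_mvar: "i < n \<Longrightarrow> hom_poly n 1 (mvar i :: 'k::zero_neq_one mpoly)"
  by (auto simp: multihomogeneous_def mvar_def lookup_single when_def)

lemma hom_poly_prod:
  fixes f :: "nat \<Rightarrow> 'k::comm_semiring_1 mpoly"
  shows "(\<And>i. i \<in> A \<Longrightarrow> hom_poly n (d i) (f i)) \<Longrightarrow> hom_poly n (\<Sum>i\<in>A. d i) (\<Prod>i\<in>A. f i)"
proof (induction A rule: infinite_finite_induct)
  case (insert a A)
  then show ?case by (simp add: hom_poly_mult)
qed (use multihomogeneous_mconst[of "{{..<n}}" "1::'k"] in simp_all)

lemma hom_poly_msubst:
  assumes p: "hom_poly m d p" and F: "\<And>i. i < m \<Longrightarrow> hom_poly n d' (F i)"
  shows "hom_poly n (d * d') (msubst F p)"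
  unfolding msubst_def meval_monom_eval
proof (intro multihomogeneous_sum multihomogeneous_mconst_mult)
  fix e assume "e \<in> Poly_Mapping.keys p"
  then have e: "Poly_Mapping.keys e \<subseteq> {..<m}" "(\<Sum>i<m. Poly_Mapping.lookup e i) = d"
    using p by (auto simp: multihomogeneous_def)
  have "hom_poly n (\<Sum>i<m. d' * Poly_Mapping.lookup e i) (\<Prod>i<m. F i ^ Poly_Mapping.lookup e i)"
    by (intro hom_poly_prod hom_poly_power F) auto
  then show "hom_poly n (d * d') (monom_eval F e)"
    using e by (simp add: monom_eval_superset[of "{..<m}"] mult.commute flip: sum_distrib_left)
qed

lemma meval_hom_poly_scale:
  assumes "hom_poly n d p"
  shows "meval \<phi> (\<lambda>i. t * x i) p = t ^ d * meval \<phi> x p"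
proof -
  have "monom_eval (\<lambda>i. t * x i) e = t ^ d * monom_eval x e" if "e \<in> Poly_Mapping.keys p" for e
  proof -
    have e: "Poly_Mapping.keys e \<subseteq> {..<n}" "(\<Sum>i<n. Poly_Mapping.lookup e i) = d"
      using assms that by (auto simp: multihomogeneous_def)
    show ?thesis unfolding monom_eval_mult
      using e by (simp add: monom_eval_superset[of "{..<n}" e "\<lambda>_. t"] flip: power_sum)
  qed
  then show ?thesis
    by (simp add: meval_monom_eval sum_distrib_left mult_ac)
qed

section \<open>Linear algebra over a subfield\<close>

text \<open>Subfields are sets inside one fixed field \<open>M\<close>, so that vectors over different subfields can be
  compared, and combined with coefficients from \<open>M\<close>.\<close>

locale closed_subfield =
  fixes L :: "'m::field set"
  assumes one_mem [intro]: "1 \<in> L"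
    and add_mem [intro]: "a \<in> L \<Longrightarrow> b \<in> L \<Longrightarrow> a + b \<in> L"
    and mult_mem [intro]: "a \<in> L \<Longrightarrow> b \<in> L \<Longrightarrow> a * b \<in> L"
    and uminus_mem [intro]: "a \<in> L \<Longrightarrow> - a \<in> L"
    and inverse_mem [intro]: "a \<in> L \<Longrightarrow> inverse a \<in> L"
begin

lemma zero_mem [intro, simp]: "0 \<in> L"
  using add_mem[OF one_mem uminus_mem[OF one_mem]] by simp

lemma diff_mem [intro]: "a \<in> L \<Longrightarrow> b \<in> L \<Longrightarrow> a - b \<in> L"
  using add_mem[of a "- b"] by auto

lemma divide_mem [intro]: "a \<in> L \<Longrightarrow> b \<in> L \<Longrightarrow> a / b \<in> L"
  by (auto simp: divide_inverse)

lemma sum_mem [intro]: "(\<And>i. i \<in> A \<Longrightarrow> f i \<in> L) \<Longrightarrow> (\<Sum>i\<in>A. f i) \<in> L"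
  by (induction A rule: infinite_finite_induct) auto

text \<open>A finite family spans a finite-dimensional \<open>L\<close>-subspace of \<open>M\<close>; a maximal \<open>L\<close>-independent
  subfamily is a basis of it. This turns a linear relation with coefficients in \<open>M\<close> into relations
  with coefficients in \<open>L\<close>, one for each basis element.\<close>

lemma expand_over_independent_subset:
  fixes \<kappa> :: "'e \<Rightarrow> 'm"
  assumes "finite J"
  shows "\<exists>J' f. J' \<subseteq> J \<and> (\<forall>e\<in>J. \<forall>b\<in>J'. f e b \<in> L) \<and>
      (\<forall>e\<in>J. \<kappa> e = (\<Sum>b\<in>J'. f e b * \<kappa> b)) \<and>
      (\<forall>c. (\<forall>b\<in>J'. c b \<in> L) \<longrightarrow> (\<Sum>b\<in>J'. c b * \<kappa> b) = 0 \<longrightarrow> (\<forall>b\<in>J'. c b = 0))"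
  using assms
proof (induction J)
  case empty
  show ?case by (intro exI[of _ "{}"]) auto
next
  case (insert a J)
  then obtain J' f where J': "J' \<subseteq> J" and f: "\<forall>e\<in>J. \<forall>b\<in>J'. f e b \<in> L"
    and \<kappa>: "\<forall>e\<in>J. \<kappa> e = (\<Sum>b\<in>J'. f e b * \<kappa> b)"
    and ind: "\<forall>c. (\<forall>b\<in>J'. c b \<in> L) \<longrightarrow> (\<Sum>b\<in>J'. c b * \<kappa> b) = 0 \<longrightarrow> (\<forall>b\<in>J'. c b = 0)"
    by blast
  have [simp]: "finite J'" using J' insert.hyps finite_subset by blast
  have aJ': "a \<notin> J'" using J' insert.hyps by auto
  show ?case
  proof (cases "\<exists>c. (\<forall>b\<in>J'. c b \<in> L) \<and> \<kappa> a = (\<Sum>b\<in>J'. c b * \<kappa> b)")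
    case True
    then obtain c where c: "\<forall>b\<in>J'. c b \<in> L" "\<kappa> a = (\<Sum>b\<in>J'. c b * \<kappa> b)" by blast
    define g where "g e b = (if e = a then c b else f e b)" for e b
    have "\<forall>e\<in>insert a J. \<forall>b\<in>J'. g e b \<in> L"
      using f c(1) by (simp add: g_def)
    moreover have "\<forall>e\<in>insert a J. \<kappa> e = (\<Sum>b\<in>J'. g e b * \<kappa> b)"
      using \<kappa> c(2) insert.hyps(2) by (auto simp: g_def intro!: sum.cong)
    moreover have "J' \<subseteq> insert a J" using J' by blast
    ultimately show ?thesis using ind by blast
  next
    case False
    define g where "g e b = (if e = a then (if b = a then 1 else 0)
        else if b = a then 0 else f e b)" for e b
    have ga: "(\<Sum>b\<in>insert a J'. g e b * \<kappa> b) = (if e = a then \<kappa> a else (\<Sum>b\<in>J'. f e b * \<kappa> b))" for e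
    proof -
      have "(\<Sum>b\<in>J'. g e b * \<kappa> b) = (if e = a then 0 else (\<Sum>b\<in>J'. f e b * \<kappa> b))"
        using aJ' by (auto simp: g_def intro!: sum.neutral sum.cong)
      then show ?thesis using aJ' by (simp add: g_def)
    qed
    have "\<forall>b\<in>insert a J'. c b = 0"
      if c: "\<forall>b\<in>insert a J'. c b \<in> L" "(\<Sum>b\<in>insert a J'. c b * \<kappa> b) = 0" for c
    proof -
      have s: "c a * \<kappa> a = - (\<Sum>b\<in>J'. c b * \<kappa> b)"
        using c(2) aJ' by (simp add: eq_neg_iff_add_eq_0)
      have "c a = 0"
      proof (rule ccontr)
        assume n: "c a \<noteq> 0"
        have "\<kappa> a = (c a * \<kappa> a) / c a" using n by simp
        also have "\<dots> = (\<Sum>b\<in>J'. (- c b / c a) * \<kappa> b)"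
          unfolding s by (simp add: sum_divide_distrib sum_negf)
        finally have "\<kappa> a = (\<Sum>b\<in>J'. (- c b / c a) * \<kappa> b)" .
        moreover have "\<forall>b\<in>J'. - c b / c a \<in> L" using c(1) by auto
        ultimately have "\<exists>c. (\<forall>b\<in>J'. c b \<in> L) \<and> \<kappa> a = (\<Sum>b\<in>J'. c b * \<kappa> b)"
          by (intro exI[of _ "\<lambda>b. - c b / c a"] conjI)
        then show False using False by contradiction
      qed
      moreover from this have "(\<Sum>b\<in>J'. c b * \<kappa> b) = 0" using s by simp
      ultimately show ?thesis using ind c(1) by auto
    qed
    moreover have "\<forall>e\<in>insert a J. \<forall>b\<in>insert a J'. g e b \<in> L"
      using f by (auto simp: g_def)
    moreover have "\<forall>e\<in>insert a J. \<kappa> e = (\<Sum>b\<in>insert a J'. g e b * \<kappa> b)"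
      using \<kappa> unfolding ga by auto
    moreover have "insert a J' \<subseteq> insert a J" using J' by blast
    ultimately show ?thesis by blast
  qed
qed

text \<open>Gaussian elimination: a vector with nonzero last entry is used to clear the last entries of the
  others, which leaves one vector and one equation less.\<close>

lemma underdetermined_system:
  assumes "finite J" "card J > n" "\<And>j i. j \<in> J \<Longrightarrow> i < n \<Longrightarrow> w j i \<in> L"
  shows "\<exists>c. (\<forall>j\<in>J. c j \<in> L) \<and> (\<exists>j\<in>J. c j \<noteq> 0) \<and> (\<forall>i<n. (\<Sum>j\<in>J. c j * w j i) = 0)"
  using assms
proof (induction n arbitrary: J w)
  case 0
  then have "J \<noteq> {}" by auto
  then show ?case by (intro exI[of _ "\<lambda>_. 1"]) auto
next
  case (Suc n)
  show ?case
  proof (cases "\<forall>j\<in>J. w j n = 0")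
    case True
    obtain c where "\<forall>j\<in>J. c j \<in> L" "\<exists>j\<in>J. c j \<noteq> 0" "\<forall>i<n. (\<Sum>j\<in>J. c j * w j i) = 0"
      using Suc.IH[of J w] Suc.prems by auto
    then show ?thesis using True by (auto simp: less_Suc_eq intro!: exI[of _ c])
  next
    case False
    then obtain j0 where j0: "j0 \<in> J" "w j0 n \<noteq> 0" by blast
    define w' where "w' j i = w j i - (w j n / w j0 n) * w j0 i" for j i
    have "card (J - {j0}) > n" using Suc.prems j0 by (simp add: card_Diff_singleton)
    moreover have "w' j i \<in> L" if "j \<in> J - {j0}" "i < n" for i j
      unfolding w'_def using that Suc.prems(3) j0 by (intro diff_mem mult_mem divide_mem) auto
    ultimately obtain c where c: "\<forall>j\<in>J - {j0}. c j \<in> L" "\<exists>j\<in>J - {j0}. c j \<noteq> 0"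
        "\<forall>i<n. (\<Sum>j\<in>J - {j0}. c j * w' j i) = 0"
      using Suc.IH[of "J - {j0}" w'] Suc.prems(1) by auto
    define d where "d = c(j0 := - (\<Sum>j\<in>J - {j0}. c j * w j n) / w j0 n)"
    have s: "(\<Sum>j\<in>J. d j * w j i) = (\<Sum>j\<in>J - {j0}. c j * w' j i)" for i
    proof -
      have "(\<Sum>j\<in>J. d j * w j i) = d j0 * w j0 i + (\<Sum>j\<in>J - {j0}. c j * w j i)"
        using Suc.prems(1) j0(1) by (subst sum.remove[of J j0]) (auto simp: d_def intro!: sum.cong)
      also have "d j0 * w j0 i = - (\<Sum>j\<in>J - {j0}. c j * (w j n / w j0 n * w j0 i))"
        by (simp add: d_def sum_divide_distrib sum_distrib_right mult.assoc)
      finally show ?thesis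
        by (simp add: w'_def right_diff_distrib sum_subtractf)
    qed
    have "(\<Sum>j\<in>J. d j * w j i) = 0" if "i < Suc n" for i
    proof (cases "i = n")
      case True
      then show ?thesis using j0(2) unfolding s by (simp add: w'_def)
    next
      case False
      then show ?thesis using that c(3) unfolding s by simp
    qed
    moreover have "\<forall>j\<in>J. d j \<in> L"
      using c(1) j0 Suc.prems(3) by (auto simp: d_def intro!: divide_mem uminus_mem sum_mem mult_mem)
    moreover have "\<exists>j\<in>J. d j \<noteq> 0" using c(2) by (auto simp: d_def)
    ultimately show ?thesis by blast
  qed
qed

text \<open>Linear independence of vectors with entries in \<open>L\<close> does not change when the scalars are enlarged
  to \<open>M\<close>: expanding the scalars of a relation over an \<open>L\<close>-independent subset of them splits the
  relation into relations over \<open>L\<close>.\<close>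

lemma independent_extend_scalars:
  fixes b :: "'j \<Rightarrow> nat \<Rightarrow> 'm"
  assumes J: "finite J" and b: "\<And>j i. j \<in> J \<Longrightarrow> i < n \<Longrightarrow> b j i \<in> L"
    and ind: "\<And>c j. (\<And>j. j \<in> J \<Longrightarrow> c j \<in> L) \<Longrightarrow> (\<And>i. i < n \<Longrightarrow> (\<Sum>j\<in>J. c j * b j i) = 0) \<Longrightarrow>
        j \<in> J \<Longrightarrow> c j = 0"
    and rel: "\<And>i. i < n \<Longrightarrow> (\<Sum>j\<in>J. \<mu> j * b j i) = 0" and j: "j \<in> J"
  shows "\<mu> j = 0"
proof -
  obtain J' f where f: "\<forall>e\<in>J. \<forall>b\<in>J'. f e b \<in> L"
    and \<mu>: "\<forall>e\<in>J. \<mu> e = (\<Sum>b\<in>J'. f e b * \<mu> b)"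
    and li: "\<forall>c. (\<forall>b\<in>J'. c b \<in> L) \<longrightarrow> (\<Sum>b\<in>J'. c b * \<mu> b) = 0 \<longrightarrow> (\<forall>b\<in>J'. c b = 0)"
    using expand_over_independent_subset[OF J, of \<mu>] by blast
  have "(\<Sum>j\<in>J. f j e * b j i) = 0" if "i < n" "e \<in> J'" for i e
  proof -
    have "(\<Sum>e\<in>J'. (\<Sum>j\<in>J. f j e * b j i) * \<mu> e) = (\<Sum>j\<in>J. (\<Sum>e\<in>J'. f j e * \<mu> e) * b j i)"
      unfolding sum_distrib_right by (subst sum.swap) (simp add: mult_ac)
    also have "\<dots> = (\<Sum>j\<in>J. \<mu> j * b j i)"
      using \<mu> by (intro sum.cong) auto
    finally have "(\<Sum>e\<in>J'. (\<Sum>j\<in>J. f j e * b j i) * \<mu> e) = 0" using rel that by simp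
    moreover have "\<forall>e\<in>J'. (\<Sum>j\<in>J. f j e * b j i) \<in> L"
      by (intro ballI sum_mem mult_mem) (use f b that in auto)
    ultimately have "\<forall>e\<in>J'. (\<Sum>j\<in>J. f j e * b j i) = 0"
      by (intro li[THEN spec, of "\<lambda>e. \<Sum>j\<in>J. f j e * b j i", THEN mp, THEN mp])
    then show ?thesis using that by blast
  qed
  then have "f j' e = 0" if "j' \<in> J" "e \<in> J'" for j' e
    using that f by (intro ind[of "\<lambda>j. f j e"]) auto
  then show ?thesis using \<mu> j by simp
qed

text \<open>If a coordinate \<open>\<mu> j\<close> were outside \<open>L\<close>, then \<open>v\<close> and the \<open>b j\<close> would be independent over \<open>L\<close>,
  hence over the whole field, against the given expansion of \<open>v\<close>.\<close>

lemma coordinates_mem: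
  fixes b :: "'j \<Rightarrow> nat \<Rightarrow> 'm"
  assumes J: "finite J" and b: "\<And>j i. j \<in> J \<Longrightarrow> i < n \<Longrightarrow> b j i \<in> L"
    and ind: "\<And>c j. (\<And>i. i < n \<Longrightarrow> (\<Sum>j\<in>J. c j * b j i) = 0) \<Longrightarrow> j \<in> J \<Longrightarrow> c j = 0"
    and v: "\<And>i. i < n \<Longrightarrow> v i \<in> L" and rel: "\<And>i. i < n \<Longrightarrow> v i = (\<Sum>j\<in>J. \<mu> j * b j i)"
    and j: "j \<in> J"
  shows "\<mu> j \<in> L"
proof -
  \<comment> \<open>The index \<open>None\<close> stands for \<open>v\<close>, and \<open>c'\<close> is the relation between \<open>v\<close> and the \<open>b j\<close>.\<close>
  define c' where "c' = case_option 1 (\<lambda>j. - \<mu> j)"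
  define b' where "b' = case_option v b"
  have sum_eq: "(\<Sum>j\<in>insert None (Some ` J). c j * b' j i) = c None * v i + (\<Sum>j\<in>J. c (Some j) * b j i)"
    for c i using J by (simp add: b'_def sum.reindex)
  show ?thesis
  proof (rule ccontr)
    assume n: "\<mu> j \<notin> L"
    have "c' None = 0"
    proof (rule independent_extend_scalars[where J = "insert None (Some ` J)" and b = b' and n = n])
      show "(\<Sum>j\<in>insert None (Some ` J). c' j * b' j i) = 0" if "i < n" for i
        using rel[OF that] unfolding sum_eq by (simp add: c'_def sum_negf)
      fix c :: "'j option \<Rightarrow> 'm" and k
      assume c: "\<And>j. j \<in> insert None (Some ` J) \<Longrightarrow> c j \<in> L"
        and r: "\<And>i. i < n \<Longrightarrow> (\<Sum>j\<in>insert None (Some ` J). c j * b' j i) = 0"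
        and k: "k \<in> insert None (Some ` J)"
      have z: "c None * \<mu> l + c (Some l) = 0" if "l \<in> J" for l
      proof (rule ind[of "\<lambda>l. c None * \<mu> l + c (Some l)"])
        fix i assume i: "i < n"
        have "(\<Sum>j\<in>J. (c None * \<mu> j + c (Some j)) * b j i) = c None * v i + (\<Sum>j\<in>J. c (Some j) * b j i)"
          by (simp add: rel[OF i] distrib_right sum.distrib sum_distrib_left mult.assoc)
        then show "(\<Sum>j\<in>J. (c None * \<mu> j + c (Some j)) * b j i) = 0"
          using r[OF i] unfolding sum_eq by simp
      qed fact
      have "c None = 0"
      proof (rule ccontr)
        assume "c None \<noteq> 0"
        moreover have "c None * \<mu> j = - c (Some j)"
          using z[OF j] by (simp add: eq_neg_iff_add_eq_0)
        ultimately have "\<mu> j = - c (Some j) / c None"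
          by (metis nonzero_mult_div_cancel_left)
        then show False using n c j by auto
      qed
      then show "c k = 0" using z k by auto
    qed (use J b v in \<open>auto simp: b'_def\<close>)
    then show False by (simp add: c'_def)
  qed
qed

end

text \<open>The spaces \<open>M\<^sup>n\<close> for all \<open>n\<close> are realised in one type, by functions on the natural numbers that
  vanish from \<open>n\<close> on.\<close>

interpretation vec: vector_space "\<lambda>(a::'m::field) v (i::nat). a * v i"
  by unfold_locales (simp_all add: fun_eq_iff distrib_left distrib_right mult.assoc)

lemma sum_fun_apply: "(\<Sum>a\<in>A. f a) i = (\<Sum>a\<in>A. f a i)" for f :: "'a \<Rightarrow> nat \<Rightarrow> 'm::comm_monoid_add"
  by (induction A rule: infinite_finite_induct) auto

section \<open>Squares in characteristic two\<close>

locale char_two =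
  fixes ty :: "'m::comm_ring_1 itself"
  assumes two_eq_0: "(1::'m) + 1 = 0"
begin

lemma add_self: "(x::'m) + x = 0"
  using two_eq_0 by (metis distrib_left mult.right_neutral mult_zero_right)

lemma uminus_eq: "- (x::'m) = x"
  using add_self[of x] by (simp add: neg_eq_iff_add_eq_0)

lemma minus_eq: "(x::'m) - y = x + y"
  using uminus_eq[of y] by (metis diff_conv_add_uminus)

lemma add_square: "((x::'m) + y)\<^sup>2 = x\<^sup>2 + y\<^sup>2"
  using add_self[of "x * y"] by (simp add: power2_eq_square algebra_simps)

lemma sum_square: "(\<Sum>i\<in>A. f i :: 'm)\<^sup>2 = (\<Sum>i\<in>A. (f i)\<^sup>2)"
  by (induction A rule: infinite_finite_induct) (auto simp: add_square)

end

definition squarefree_monom :: "nat set \<Rightarrow> (nat \<Rightarrow>\<^sub>0 nat)" where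
  "squarefree_monom S = (\<Sum>i\<in>S. Poly_Mapping.single i 1)"

lemma lookup_squarefree_monom:
  "finite S \<Longrightarrow> Poly_Mapping.lookup (squarefree_monom S) i = (if i \<in> S then 1 else 0)"
  by (simp add: squarefree_monom_def lookup_sum lookup_single when_def)

lemma monom_eval_squarefree:
  "finite S \<Longrightarrow> monom_eval x (squarefree_monom S) = (\<Prod>i\<in>S. x i)"
  unfolding squarefree_monom_def
  by (induction S rule: finite_induct) (simp_all add: monom_eval_add)

text \<open>The set \<open>S\<close> is recovered as the set of the variables with odd exponent, and then \<open>e\<close> by halving.\<close>

lemma monom_parity_eq:
  assumes "finite S" "finite T" "e + e + squarefree_monom S = f + f + squarefree_monom T"
  shows "e = f \<and> S = T"
proof -
  have *: "Poly_Mapping.lookup e i + Poly_Mapping.lookup e i + (if i \<in> S then 1 else 0) =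
      Poly_Mapping.lookup f i + Poly_Mapping.lookup f i + (if i \<in> T then 1 else 0)" for i
    using arg_cong[OF assms(3), of "\<lambda>e. Poly_Mapping.lookup e i"] assms(1,2)
    by (simp add: lookup_add lookup_squarefree_monom)
  have "i \<in> S \<longleftrightarrow> i \<in> T" for i
    using arg_cong[OF *[of i], of even] by (auto split: if_splits)
  then have "S = T" by blast
  moreover have "e = f"
  proof (intro poly_mapping_eqI)
    fix i
    show "Poly_Mapping.lookup e i = Poly_Mapping.lookup f i"
      using *[of i] \<open>S = T\<close> by simp
  qed
  ultimately show ?thesis by simp
qed

lemma (in char_two) mpoly_square:
  "p\<^sup>2 = (\<Sum>e\<in>Poly_Mapping.keys p. Poly_Mapping.single (e + e) ((Poly_Mapping.lookup p e)\<^sup>2))"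
  for p :: "'m mpoly"
proof -
  interpret P: char_two "TYPE('m mpoly)"
    by unfold_locales (metis mconst_1 mconst_0 mconst_add two_eq_0)
  have "p\<^sup>2 = (\<Sum>e\<in>Poly_Mapping.keys p. Poly_Mapping.single e (Poly_Mapping.lookup p e))\<^sup>2"
    by (simp flip: mpoly_sum_monomials)
  then show ?thesis unfolding P.sum_square
    by (simp add: power2_eq_square mult_single)
qed

text \<open>The monomials of \<open>(P S)\<^sup>2 \<cdot> \<Prod>i\<in>S. x\<^sub>i\<close> have odd exponents exactly at \<open>S\<close>, so the summands have
  no monomial in common.\<close>

lemma (in char_two) squares_independent_mpoly:
  fixes P :: "nat set \<Rightarrow> 'm mpoly"
  assumes A: "finite A" "\<And>S. S \<in> A \<Longrightarrow> finite S"
    and rel: "(\<Sum>S\<in>A. (P S)\<^sup>2 * monom_eval mvar (squarefree_monom S)) = 0"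
    and S: "S \<in> A" and red: "\<And>x::'m. x\<^sup>2 = 0 \<Longrightarrow> x = 0"
  shows "P S = 0"
proof (rule poly_mapping_eqI)
  fix f
  have "Poly_Mapping.lookup ((P T)\<^sup>2 * monom_eval mvar (squarefree_monom T)) (f + f + squarefree_monom S) =
      (if T = S then (Poly_Mapping.lookup (P T) f)\<^sup>2 else 0)" if "T \<in> A" for T
  proof -
    have eq: "e + e + squarefree_monom T = f + f + squarefree_monom S \<longleftrightarrow> e = f \<and> T = S" for e
      using monom_parity_eq[of T S e f] A S that by auto
    have "Poly_Mapping.lookup ((P T)\<^sup>2 * monom_eval mvar (squarefree_monom T)) (f + f + squarefree_monom S) =
       (\<Sum>e\<in>Poly_Mapping.keys (P T). if e = f \<and> T = S then (Poly_Mapping.lookup (P T) e)\<^sup>2 else 0)"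
      unfolding mpoly_square monom_eval_mvar sum_distrib_right mult_single lookup_sum lookup_single
      by (simp add: when_def eq)
    also have "\<dots> = (if T = S then (Poly_Mapping.lookup (P T) f)\<^sup>2 else 0)"
      by (auto simp: in_keys_iff)
    finally show ?thesis .
  qed
  then have "0 = (\<Sum>T\<in>A. if T = S then (Poly_Mapping.lookup (P T) f)\<^sup>2 else 0)"
    using arg_cong[OF rel, of "\<lambda>p. Poly_Mapping.lookup p (f + f + squarefree_monom S)"]
    by (simp add: lookup_sum)
  then have "(Poly_Mapping.lookup (P S) f)\<^sup>2 = 0" using A S by simp
  then show "Poly_Mapping.lookup (P S) f = Poly_Mapping.lookup 0 f" using red by simp
qed

locale char_two_field = char_two ty for ty :: "'m::field itself"
begin

text \<open>The field \<open>M\<close> over its subfield of squares, as a vector space over \<open>M\<close> itself on which a scalar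
  acts through its square.\<close>

sublocale sq: vector_space "\<lambda>a (v::'m). a\<^sup>2 * v"
  by unfold_locales (simp_all add: add_square algebra_simps power_mult_distrib)

text \<open>For finite \<open>J\<close> this is the field generated by the \<open>g j\<close> over the field of squares: the square of
  a generator is a scalar, so squarefree monomials suffice.\<close>

definition squarefree_span :: "'i set \<Rightarrow> ('i \<Rightarrow> 'm) \<Rightarrow> 'm set" where
  "squarefree_span J g = sq.span ((\<lambda>T. \<Prod>j\<in>T. g j) ` Pow J)"

lemma squarefree_span_one: "1 \<in> squarefree_span J g"
  unfolding squarefree_span_def by (rule sq.span_base) (auto intro: image_eqI[of _ _ "{}"])

lemma squarefree_span_gen: "j \<in> J \<Longrightarrow> g j \<in> squarefree_span J g"
  unfolding squarefree_span_def by (rule sq.span_base) (auto intro: image_eqI[of _ _ "{j}"])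

lemma squarefree_span_square_mult: "b \<in> squarefree_span J g \<Longrightarrow> a\<^sup>2 * b \<in> squarefree_span J g"
  unfolding squarefree_span_def by (rule sq.span_scale)

lemma squarefree_span_square: "a\<^sup>2 \<in> squarefree_span J g"
  using squarefree_span_square_mult[OF squarefree_span_one, of a] by simp

lemma squarefree_span_mult:
  assumes J: "finite J" and a: "a \<in> squarefree_span J g" and b: "b \<in> squarefree_span J g"
  shows "a * b \<in> squarefree_span J g"
proof -
  have gen: "(\<Prod>j\<in>S. g j) * (\<Prod>j\<in>T. g j) \<in> squarefree_span J g" if "S \<subseteq> J" "T \<subseteq> J" for S T
  proof -
    have [simp]: "finite S" "finite T" using that J finite_subset by auto
    have "(\<Prod>j\<in>S. g j) = (\<Prod>j\<in>S - T. g j) * (\<Prod>j\<in>S \<inter> T. g j)"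
      "(\<Prod>j\<in>T. g j) = (\<Prod>j\<in>T - S. g j) * (\<Prod>j\<in>S \<inter> T. g j)"
      by (subst prod.union_disjoint[symmetric]; (force intro!: prod.cong)?)+
    moreover have "(\<Prod>j\<in>S - T. g j) * (\<Prod>j\<in>T - S. g j) = (\<Prod>j\<in>(S - T) \<union> (T - S). g j)"
      by (subst prod.union_disjoint) auto
    ultimately have "(\<Prod>j\<in>S. g j) * (\<Prod>j\<in>T. g j) =
        (\<Prod>j\<in>S \<inter> T. g j)\<^sup>2 * (\<Prod>j\<in>(S - T) \<union> (T - S). g j)"
      by (simp add: power2_eq_square mult_ac)
    moreover have "(\<Prod>j\<in>(S - T) \<union> (T - S). g j) \<in> squarefree_span J g"
      unfolding squarefree_span_def using that by (intro sq.span_base) auto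
    ultimately show ?thesis by (simp add: squarefree_span_square_mult)
  qed
  have step: "a * (\<Prod>j\<in>T. g j) \<in> squarefree_span J g" if T: "T \<subseteq> J" for T
    using a unfolding squarefree_span_def
  proof (induction rule: sq.span_induct_alt)
    case base
    show ?case by (simp add: sq.span_zero)
  next
    case (step c x y)
    then obtain S where S: "S \<subseteq> J" "x = (\<Prod>j\<in>S. g j)" by auto
    have "(c\<^sup>2 * x + y) * (\<Prod>j\<in>T. g j) = c\<^sup>2 * (x * (\<Prod>j\<in>T. g j)) + y * (\<Prod>j\<in>T. g j)"
      by (simp add: algebra_simps)
    then show ?case
      using step(2) gen[OF S(1) T] unfolding S(2) squarefree_span_def
      by (auto intro: sq.span_add sq.span_scale)
  qed
  show ?thesis
    using b unfolding squarefree_span_def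
  proof (induction rule: sq.span_induct_alt)
    case base
    show ?case by (simp add: sq.span_zero)
  next
    case (step c x y)
    then obtain S where S: "S \<subseteq> J" "x = (\<Prod>j\<in>S. g j)" by auto
    have "a * (c\<^sup>2 * x + y) = c\<^sup>2 * (a * x) + a * y"
      by (simp add: algebra_simps)
    then show ?case
      using step(2) \<open>\<And>T. T \<subseteq> J \<Longrightarrow> a * (\<Prod>j\<in>T. g j) \<in> squarefree_span J g\<close>[OF S(1)]
      unfolding S(2) squarefree_span_def by (auto intro: sq.span_add sq.span_scale)
  qed
qed

text \<open>An inverse is a multiple by a square: \<open>1/a = (1/a)\<^sup>2 a\<close>. So closure under products already gives
  a field.\<close>

lemma squarefree_span_inverse:
  assumes "a \<in> squarefree_span J g" shows "inverse a \<in> squarefree_span J g"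
proof -
  have "inverse a = (inverse a)\<^sup>2 * a" by (cases "a = 0") (auto simp: power2_eq_square)
  then show ?thesis using squarefree_span_square_mult[OF assms, of "inverse a"] by simp
qed

lemma squarefree_span_prod:
  assumes "finite J" "\<And>i. i \<in> A \<Longrightarrow> f i \<in> squarefree_span J g"
  shows "(\<Prod>i\<in>A. f i) \<in> squarefree_span J g"
  using assms(2)
  by (induction A rule: infinite_finite_induct)
     (auto intro: squarefree_span_one squarefree_span_mult[OF assms(1)])

lemma squarefree_span_sum:
  assumes "\<And>i. i \<in> A \<Longrightarrow> f i \<in> squarefree_span J g"
  shows "(\<Sum>i\<in>A. f i) \<in> squarefree_span J g"
  using assms unfolding squarefree_span_def by (rule sq.span_sum)

lemma squarefree_span_power:
  "finite J \<Longrightarrow> a \<in> squarefree_span J g \<Longrightarrow> a ^ n \<in> squarefree_span J g"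
  by (induction n) (auto intro: squarefree_span_one squarefree_span_mult)

lemma squarefree_span_meval:
  assumes "finite J" "\<And>c. \<phi> c \<in> squarefree_span J g"
    "\<And>i. i \<in> mvars p \<Longrightarrow> x i \<in> squarefree_span J g"
  shows "meval \<phi> x p \<in> squarefree_span J g"
  unfolding meval_def
  by (intro squarefree_span_sum squarefree_span_mult squarefree_span_prod squarefree_span_power assms)
     (auto simp: mvars_def)

text \<open>This is the notion of \<open>p\<close>-independence for \<open>p = 2\<close>.\<close>

definition square_independent :: "'i set \<Rightarrow> ('i \<Rightarrow> 'm) \<Rightarrow> bool" where
  "square_independent J g \<longleftrightarrow>
     (\<forall>f. (\<Sum>T\<in>Pow J. (f T)\<^sup>2 * (\<Prod>j\<in>T. g j)) = 0 \<longrightarrow> (\<forall>T\<in>Pow J. f T = 0))"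

lemma square_independent_inj_independent:
  assumes J: "finite J" and ind: "square_independent J g"
  shows "inj_on (\<lambda>T. \<Prod>j\<in>T. g j) (Pow J) \<and> sq.independent ((\<lambda>T. \<Prod>j\<in>T. g j) ` Pow J)"
proof
  show inj: "inj_on (\<lambda>T. \<Prod>j\<in>T. g j) (Pow J)"
  proof (rule inj_onI, rule ccontr)
    fix S T assume ST: "S \<in> Pow J" "T \<in> Pow J" "(\<Prod>j\<in>S. g j) = (\<Prod>j\<in>T. g j)" "S \<noteq> T"
    define f where "f U = (if U = S \<or> U = T then 1 else 0 :: 'm)" for U
    have "(\<Sum>U\<in>Pow J. (f U)\<^sup>2 * (\<Prod>j\<in>U. g j)) = (\<Sum>U\<in>{S, T}. (f U)\<^sup>2 * (\<Prod>j\<in>U. g j))"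
      using J ST by (intro sum.mono_neutral_right) (auto simp: f_def)
    also have "\<dots> = 0" using ST by (simp add: f_def add_self)
    finally have "f S = 0" using ind ST(1) by (auto simp: square_independent_def)
    then show False by (simp add: f_def)
  qed
  show "sq.independent ((\<lambda>T. \<Prod>j\<in>T. g j) ` Pow J)"
  proof (rule sq.independent_if_scalars_zero)
    show "finite ((\<lambda>T. \<Prod>j\<in>T. g j) ` Pow J)" using J by simp
    fix f x assume s: "(\<Sum>x\<in>(\<lambda>T. \<Prod>j\<in>T. g j) ` Pow J. (f x)\<^sup>2 * x) = 0"
      and x: "x \<in> (\<lambda>T. \<Prod>j\<in>T. g j) ` Pow J"
    have "(\<Sum>T\<in>Pow J. (f (\<Prod>j\<in>T. g j))\<^sup>2 * (\<Prod>j\<in>T. g j)) = 0"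
      using s unfolding sum.reindex[OF inj] by simp
    then have "\<forall>T\<in>Pow J. f (\<Prod>j\<in>T. g j) = 0"
      using ind[unfolded square_independent_def, rule_format, of "\<lambda>T. f (\<Prod>j\<in>T. g j)"] by blast
    then show "f x = 0" using x by blast
  qed
qed

text \<open>With \<open>s\<close> elements \<open>x i\<close> in the field generated by \<open>t\<close> elements \<open>g j\<close> over the squares, \<open>2\<^sup>s\<close>
  independent monomials lie in the span of \<open>2\<^sup>t\<close> monomials. So \<open>s \<le> t\<close>, and in the case of
  equality a spanning set of minimal size is independent. This bound replaces the comparison of
  transcendence degrees.\<close>

lemma square_independent_exchange:
  assumes I: "finite I" "square_independent I x" and J: "finite J"
    and mem: "\<And>i. i \<in> I \<Longrightarrow> x i \<in> squarefree_span J g"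
  shows "card I \<le> card J" and "card I = card J \<Longrightarrow> square_independent J g"
proof -
  let ?X = "(\<lambda>T. \<Prod>j\<in>T. x j) ` Pow I" and ?G = "(\<lambda>T. \<Prod>j\<in>T. g j) ` Pow J"
  have inj: "inj_on (\<lambda>T. \<Prod>j\<in>T. x j) (Pow I)" and ind: "sq.independent ?X"
    using square_independent_inj_independent[OF I] by auto
  have cX: "card ?X = 2 ^ card I" using card_image[OF inj] card_Pow[OF I(1)] by simp
  have sub: "?X \<subseteq> sq.span ?G"
    using squarefree_span_prod[OF J, of _ x g] mem unfolding squarefree_span_def by blast
  have fG: "finite ?G" using J by simp
  have cG: "card ?G \<le> 2 ^ card J" using card_image_le[of "Pow J"] J card_Pow[OF J] by (metis finite_Pow_iff)
  have "card ?X \<le> card ?G" using sq.independent_span_bound[OF fG ind sub] by simp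
  then have "(2::nat) ^ card I \<le> 2 ^ card J" using cX cG by linarith
  then show "card I \<le> card J" by simp
  assume eq: "card I = card J"
  obtain B where B: "B \<subseteq> ?G" "sq.independent B" "?G \<subseteq> sq.span B"
    using sq.maximal_independent_subset[of ?G] by blast
  have fB: "finite B" using B(1) fG finite_subset by blast
  have "sq.span ?G \<subseteq> sq.span B" using B(3) by (simp add: sq.span_minimal)
  then have "card ?X \<le> card B" using sq.independent_span_bound[OF fB ind] sub by auto
  moreover have "card B \<le> card ?G" using B(1) fG by (rule card_mono[rotated])
  ultimately have c: "card B = card ?G" "card ?G = 2 ^ card J" using cX cG eq by auto
  then have BG: "B = ?G" using B(1) fG card_subset_eq by blast
  have inj': "inj_on (\<lambda>T. \<Prod>j\<in>T. g j) (Pow J)"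
    using c(2) J by (intro eq_card_imp_inj_on) (auto simp: card_Pow)
  show "square_independent J g"
    unfolding square_independent_def
  proof (intro allI impI ballI)
    fix f T assume s: "(\<Sum>T\<in>Pow J. (f T)\<^sup>2 * (\<Prod>j\<in>T. g j)) = 0" and T: "T \<in> Pow J"
    let ?h = "inv_into (Pow J) (\<lambda>T. \<Prod>j\<in>T. g j)"
    have "(\<Sum>v\<in>?G. (f (?h v))\<^sup>2 * v) = 0"
      unfolding sum.reindex[OF inj'] using s inj' by (simp add: inv_into_f_f)
    then have "f (?h (\<Prod>j\<in>T. g j)) = 0"
      using sq.independentD[of ?G ?G "\<lambda>v. f (?h v)"] B(2) fG T unfolding BG by blast
    then show "f T = 0" using inj' T by (simp add: inv_into_f_f)
  qed
qed

text \<open>Over a perfect field a polynomial is a combination of squarefree monomials with squares of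
  polynomials of about half the degree as coefficients. By square independence a polynomial
  relation between the \<open>g j\<close> gives relations of half the degree, and finally a constant one.\<close>

lemma square_independent_imp_algebraically_independent:
  fixes \<phi> :: "'a::field \<Rightarrow> 'm"
  assumes \<phi>: "coefficient_hom \<phi>" and perf: "\<And>c::'a. \<exists>d. d\<^sup>2 = c"
    and J: "finite J" and ind: "square_independent J g"
  shows "mvars p \<subseteq> J \<Longrightarrow> meval \<phi> g p = 0 \<Longrightarrow> p = 0"
proof -
  interpret \<phi>: coefficient_hom \<phi> by fact
  obtain rt where rt: "\<And>c::'a. (rt c)\<^sup>2 = c" using perf by metis
  have "p = 0" if "mvars p \<subseteq> J" "meval \<phi> g p = 0"
    "\<And>e i. e \<in> Poly_Mapping.keys p \<Longrightarrow> Poly_Mapping.lookup e i < 2 ^ D" for D p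
    using that
  proof (induction D arbitrary: p)
    case 0
    have "e = 0" if "e \<in> Poly_Mapping.keys p" for e
      using 0(3)[OF that] by (intro poly_mapping_eqI) simp
    then have "p = mconst (Poly_Mapping.lookup p 0)"
      by (intro poly_mapping_eqI) (metis in_keys_iff lookup_single_eq lookup_single_not_eq mconst_def)
    moreover from this have "\<phi> (Poly_Mapping.lookup p 0) = 0" using 0(2) by (metis \<phi>.meval_mconst)
    moreover have "c = 0" if "\<phi> c = 0" for c
      using that \<phi>.hom_mult[of c "inverse c"] by (cases "c = 0") auto
    ultimately show ?case by (metis mconst_0)
  next
    case (Suc D)
    \<comment> \<open>The monomial \<open>e\<close> is the square of \<open>half e\<close> times the squarefree monomial of \<open>odd_part e\<close>;
      collecting the terms of \<open>p\<close> by their odd parts gives \<open>p = \<Sum>T. (P T)\<^sup>2 \<cdot> \<Prod>j\<in>T. x\<^sub>j\<close>.\<close>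
    define odd_part where "odd_part e = {i \<in> J. odd (Poly_Mapping.lookup e i)}" for e :: "nat \<Rightarrow>\<^sub>0 nat"
    define half where "half e = Poly_Mapping.map (\<lambda>a. a div 2) e" for e :: "nat \<Rightarrow>\<^sub>0 nat"
    have lh: "Poly_Mapping.lookup (half e) i = Poly_Mapping.lookup e i div 2" for e i
      by (simp add: half_def Poly_Mapping.map.rep_eq when_def)
    have decomp: "e = half e + half e + squarefree_monom (odd_part e)" if "e \<in> Poly_Mapping.keys p" for e
    proof (rule poly_mapping_eqI)
      fix i
      have "i \<in> J" if "Poly_Mapping.lookup e i \<noteq> 0"
      proof -
        have "i \<in> Poly_Mapping.keys e" using that by (simp add: in_keys_iff)
        then show ?thesis using \<open>e \<in> Poly_Mapping.keys p\<close> Suc.prems(1) unfolding mvars_def by blast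
      qed
      then have "Poly_Mapping.lookup e i = 0" if "i \<notin> J" using that by blast
      have par: "a = a div 2 + a div 2 + (if odd a then 1 else 0)" for a :: nat
        by presburger
      show "Poly_Mapping.lookup e i =
          Poly_Mapping.lookup (half e + half e + squarefree_monom (odd_part e)) i"
      proof (cases "i \<in> J")
        case True
        then show ?thesis using J
          by (subst par) (simp add: lookup_add lh lookup_squarefree_monom odd_part_def)
      next
        case False
        then show ?thesis using J \<open>i \<notin> J \<Longrightarrow> Poly_Mapping.lookup e i = 0\<close>
          by (simp add: lookup_add lh lookup_squarefree_monom odd_part_def)
      qed
    qed
    define part where "part T = {e \<in> Poly_Mapping.keys p. odd_part e = T}" for T
    define P where "P T = (\<Sum>e\<in>part T. Poly_Mapping.single (half e) (rt (Poly_Mapping.lookup p e)))" for T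
    have fin_part [simp]: "finite (part T)" for T by (simp add: part_def)
    have "meval \<phi> g p = (\<Sum>T\<in>Pow J. \<Sum>e\<in>part T. \<phi> (Poly_Mapping.lookup p e) * monom_eval g e)"
      unfolding meval_monom_eval part_def using J
      by (intro sum.group[symmetric]) (auto simp: odd_part_def)
    also have "\<dots> = (\<Sum>T\<in>Pow J. (meval \<phi> g (P T))\<^sup>2 * (\<Prod>j\<in>T. g j))"
    proof (rule sum.cong[OF refl])
      fix T assume T: "T \<in> Pow J"
      then have finT: "finite T" using J finite_subset by auto
      have "\<phi> (Poly_Mapping.lookup p e) * monom_eval g e =
          (\<phi> (rt (Poly_Mapping.lookup p e)) * monom_eval g (half e))\<^sup>2 * (\<Prod>j\<in>T. g j)"
        if e: "e \<in> part T" for e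
      proof -
        have "monom_eval g e = monom_eval g (half e + half e + squarefree_monom T)"
          using decomp[of e] e by (auto simp: part_def)
        then have "monom_eval g e = (monom_eval g (half e))\<^sup>2 * (\<Prod>j\<in>T. g j)"
          by (simp add: monom_eval_add monom_eval_squarefree finT power2_eq_square)
        moreover have "\<phi> (Poly_Mapping.lookup p e) = (\<phi> (rt (Poly_Mapping.lookup p e)))\<^sup>2"
          by (metis \<phi>.hom_power rt)
        ultimately show ?thesis by (simp add: power_mult_distrib mult_ac)
      qed
      then have "(\<Sum>e\<in>part T. \<phi> (Poly_Mapping.lookup p e) * monom_eval g e) =
          (\<Sum>e\<in>part T. (\<phi> (rt (Poly_Mapping.lookup p e)) * monom_eval g (half e))\<^sup>2) * (\<Prod>j\<in>T. g j)"
        by (simp add: sum_distrib_right)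
      also have "\<dots> = (meval \<phi> g (P T))\<^sup>2 * (\<Prod>j\<in>T. g j)"
        by (simp add: P_def \<phi>.meval_sum sum_square)
      finally show "(\<Sum>e\<in>part T. \<phi> (Poly_Mapping.lookup p e) * monom_eval g e) =
          (meval \<phi> g (P T))\<^sup>2 * (\<Prod>j\<in>T. g j)" .
    qed
    finally have zP: "\<forall>T\<in>Pow J. meval \<phi> g (P T) = 0"
      using ind Suc.prems(2) unfolding square_independent_def by auto
    have keysP: "\<exists>e'\<in>part T. e = half e'" if "e \<in> Poly_Mapping.keys (P T)" for e T
    proof (rule ccontr)
      assume "\<not> (\<exists>e'\<in>part T. e = half e')"
      then have "Poly_Mapping.lookup (P T) e = 0"
        unfolding P_def lookup_sum by (intro sum.neutral) (auto simp: lookup_single when_def)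
      then show False using that by (simp add: in_keys_iff)
    qed
    have mP: "mvars (P T) \<subseteq> J" for T
    proof
      fix i assume "i \<in> mvars (P T)"
      then obtain e where "e \<in> Poly_Mapping.keys (P T)" "i \<in> Poly_Mapping.keys e"
        by (auto simp: mvars_def)
      moreover from this obtain e' where "e' \<in> part T" "e = half e'" using keysP by blast
      ultimately have "e' \<in> Poly_Mapping.keys p" "i \<in> Poly_Mapping.keys e'"
        by (auto simp: part_def in_keys_iff lh)
      then show "i \<in> J" using Suc.prems(1) by (auto simp: mvars_def)
    qed
    have bP: "Poly_Mapping.lookup e i < 2 ^ D" if "e \<in> Poly_Mapping.keys (P T)" for e i T
    proof -
      obtain e' where "e' \<in> part T" "e = half e'" using keysP[OF \<open>e \<in> _\<close>] by blast
      then show ?thesis using Suc.prems(3)[of e' i] by (auto simp: part_def lh)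
    qed
    have P0: "P T = 0" if "T \<in> Pow J" for T
      by (rule Suc.IH) (use zP mP bP that in auto)
    show "p = 0"
    proof (rule poly_mapping_eqI, rule ccontr)
      fix e assume "Poly_Mapping.lookup p e \<noteq> Poly_Mapping.lookup 0 e"
      then have e: "e \<in> Poly_Mapping.keys p" by (simp add: in_keys_iff)
      let ?T = "odd_part e"
      have inj: "e' = e" if "e' \<in> part ?T" "half e' = half e" for e'
        using decomp[of e'] decomp[OF e] that by (simp add: part_def)
      have "Poly_Mapping.lookup (P ?T) (half e) =
          (\<Sum>e'\<in>part ?T. if e' = e then rt (Poly_Mapping.lookup p e') else 0)"
        unfolding P_def lookup_sum lookup_single when_def
        by (intro sum.cong) (auto dest: inj)
      also have "\<dots> = rt (Poly_Mapping.lookup p e)" using e by (simp add: part_def)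
      finally have "rt (Poly_Mapping.lookup p e) = 0"
        using P0[of ?T] by (auto simp: odd_part_def)
      then have "Poly_Mapping.lookup p e = 0" by (metis rt zero_power2)
      then show False using e by (simp add: in_keys_iff)
    qed
  qed
  moreover have "\<exists>D. \<forall>e\<in>Poly_Mapping.keys p. \<forall>i. Poly_Mapping.lookup e i < 2 ^ D"
  proof -
    let ?A = "(\<Union>e\<in>Poly_Mapping.keys p. Poly_Mapping.lookup e ` Poly_Mapping.keys e)"
    have fin: "finite (insert 0 ?A)" by simp
    have "Poly_Mapping.lookup e i < 2 ^ Max (insert 0 ?A)" if "e \<in> Poly_Mapping.keys p" for e i
    proof -
      have "Poly_Mapping.lookup e i \<in> insert 0 ?A"
      proof (cases "i \<in> Poly_Mapping.keys e")
        case True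
        then show ?thesis using that by blast
      qed (simp add: in_keys_iff)
      then have "Poly_Mapping.lookup e i \<le> Max (insert 0 ?A)" using fin by (rule Max_ge[rotated])
      also have "\<dots> < 2 ^ Max (insert 0 ?A)" by (rule less_exp)
      finally show ?thesis .
    qed
    then show ?thesis by blast
  qed
  ultimately show "mvars p \<subseteq> J \<Longrightarrow> meval \<phi> g p = 0 \<Longrightarrow> p = 0" by blast
qed

end

lemma Fract_sum_same: "(\<Sum>i\<in>A. Fract (f i) d) = Fract (\<Sum>i\<in>A. f i) (d::'a::idom)"
proof (induction A rule: infinite_finite_induct)
  case (insert a A)
  have "Fract a d + Fract b d = Fract (a + b) d" for a b
    by (cases "d = 0") (simp_all add: fract_collapse eq_fract algebra_simps)
  with insert show ?case by simp
qed (simp_all add: fract_collapse)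

lemma common_denominator_fract:
  fixes f :: "'i \<Rightarrow> 'a::idom fract"
  assumes "finite A"
  shows "\<exists>d P. d \<noteq> 0 \<and> (\<forall>i\<in>A. f i = Fract (P i) d)"
  using assms
proof induction
  case empty
  show ?case by (intro exI[of _ 1]) simp
next
  case (insert a A)
  then obtain d P where dP: "d \<noteq> 0" "\<forall>i\<in>A. f i = Fract (P i) d" by blast
  obtain p b where b: "f a = Fract p b" "b \<noteq> 0" by (cases "f a") auto
  show ?case
    using dP b insert.hyps
    by (intro exI[of _ "d * b"] exI[of _ "\<lambda>i. if i = a then p * d else P i * b"])
       (auto simp: eq_fract mult_ac)
qed

text \<open>The variables are square independent in the field of rational functions: multiplying a relation
  by the square of a common denominator makes it a relation between polynomials.\<close>

lemma mvars_square_independent: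
  fixes A :: "nat set"
  assumes c2: "(1::'a::field) + 1 = 0" and A: "finite A"
  shows "char_two_field.square_independent A (\<lambda>i. Fract (mvar i :: 'a mpoly) 1)"
proof -
  interpret a: char_two "TYPE('a)" by unfold_locales fact
  interpret char_two_field "TYPE('a mpoly fract)"
  proof unfold_locales
    have "(1::'a mpoly) + 1 = 0" using c2 by (metis mconst_1 mconst_0 mconst_add)
    then show "(1 :: 'a mpoly fract) + 1 = 0"
      by (simp add: One_fract_def Zero_fract_def)
  qed
  have pr: "(\<Prod>i\<in>T. Fract (mvar i :: 'a mpoly) 1) = Fract (monom_eval mvar (squarefree_monom T)) 1"
    if "finite T" for T
    unfolding monom_eval_squarefree[OF that] using that
    by induction (simp_all add: One_fract_def)
  show ?thesis unfolding square_independent_def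
  proof (intro allI impI ballI)
    fix f :: "nat set \<Rightarrow> 'a mpoly fract" and T
    assume s: "(\<Sum>T\<in>Pow A. (f T)\<^sup>2 * (\<Prod>j\<in>T. Fract (mvar j) 1)) = 0" and T: "T \<in> Pow A"
    obtain d P where d: "d \<noteq> 0" and P: "\<forall>T\<in>Pow A. f T = Fract (P T) d"
      using common_denominator_fract[of "Pow A" f] A by auto
    have fin: "finite S" if "S \<in> Pow A" for S using that A finite_subset by auto
    have "(\<Sum>T\<in>Pow A. (f T)\<^sup>2 * (\<Prod>j\<in>T. Fract (mvar j) 1)) =
        (\<Sum>T\<in>Pow A. Fract ((P T)\<^sup>2 * monom_eval mvar (squarefree_monom T)) (d\<^sup>2))"
      using P fin by (intro sum.cong) (simp_all add: pr power2_eq_square)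
    then have "Fract (\<Sum>T\<in>Pow A. (P T)\<^sup>2 * monom_eval mvar (squarefree_monom T)) (d\<^sup>2) = 0"
      using s unfolding Fract_sum_same by simp
    then have "(\<Sum>T\<in>Pow A. (P T)\<^sup>2 * monom_eval mvar (squarefree_monom T)) = 0"
      using d by (simp add: Zero_fract_def eq_fract)
    then have "P T = 0"
      using a.squares_independent_mpoly[of "Pow A" P T] A fin T by auto
    then show "f T = 0" using P T d by (simp add: fract_collapse)
  qed
qed

section \<open>Generic points of an anisotropic diagonal form\<close>

lemma char_two_mpoly:
  assumes "(1::'k::comm_ring_1) + 1 = 0"
  shows "char_two TYPE('k mpoly)"
  using assms by unfold_locales (metis mconst_1 mconst_0 mconst_add)

lemma char_two_fract:
  assumes "(1::'k::idom) + 1 = 0"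
  shows "char_two TYPE('k fract)"
  using assms by unfold_locales (simp add: One_fract_def Zero_fract_def)

lemma coefficient_hom_Fract: "coefficient_hom (\<lambda>p::'a::idom. Fract p 1)"
  by unfold_locales (simp_all add: One_fract_def)

lemma meval_Fract: "meval (\<lambda>c. Fract (mconst c) 1) (\<lambda>i. Fract (mvar i) 1) p = Fract p 1"
  for p :: "'a::field mpoly"
  using msubst.meval_comp[OF coefficient_hom_Fract, of mvar p] by (simp add: msubst_mvar)

text \<open>Distinct variables are coprime, as one sees by setting \<open>x\<^sub>i = 0\<close>.\<close>

lemma mvar_dvd_cancel:
  fixes g h :: "'k::field mpoly"
  assumes "i \<noteq> j" and eq: "mvar j * g = mvar i * h"
  shows "mvar i dvd g"
proof -
  let ?s = "msubst (mvar(i := 0)) :: 'k mpoly \<Rightarrow> _"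
  have "mvar j * ?s g = 0"
    using arg_cong[OF eq, of ?s] assms(1) by (simp add: msubst.meval_mult)
  then have "?s g = 0" by simp
  moreover have "mvar i dvd msubst mvar g - ?s g"
    by (rule msubst_cong_dvd) auto
  ultimately show ?thesis by (simp add: msubst_mvar)
qed

type_synonym 'a ratfun = "'a mpoly fract"

text \<open>The form \<open>q = \<Sum>i a\<^sub>i x\<^sub>i\<^sup>2\<close> over \<open>k\<close> (the type \<open>'k\<close>), with square roots \<open>\<alpha>\<^sub>i\<close> of the
  coefficients in an extension field \<open>\<Omega>\<close> (the type \<open>'a\<close>). Independence of the \<open>\<alpha>\<^sub>i\<close> over \<open>k\<close> is
  anisotropy, because \<open>q(c) = (\<Sum>i c\<^sub>i \<alpha>\<^sub>i)\<^sup>2\<close>.\<close>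

locale diagonal_form =
  fixes emb :: "'k::field \<Rightarrow> 'a::field" and N :: nat and a :: "nat \<Rightarrow> 'k" and \<alpha> :: "nat \<Rightarrow> 'a"
  assumes emb: "coefficient_hom emb"
    and char2: "(1::'k) + 1 = 0"
    and \<alpha>_square: "\<And>i. i < N \<Longrightarrow> (\<alpha> i)\<^sup>2 = emb (a i)"
    and \<alpha>_independent: "\<And>c i. (\<Sum>i<N. emb (c i) * \<alpha> i) = 0 \<Longrightarrow> i < N \<Longrightarrow> c i = 0"
    and N: "N \<ge> 2"
begin

sublocale emb: coefficient_hom emb by (rule emb)

sublocale c2a: char_two "TYPE('a)"
  using char2 by unfold_locales (metis emb.hom_0 emb.hom_1 emb.hom_add)

sublocale c2p: char_two "TYPE('a mpoly)"
  by (rule char_two_mpoly[OF c2a.two_eq_0])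

sublocale c2r: char_two "TYPE('a ratfun)"
  by (rule char_two_fract[OF c2p.two_eq_0])

definition q :: "'k mpoly" where
  "q = (\<Sum>i<N. mconst (a i) * (mvar i)\<^sup>2)"

definition \<epsilon> :: "'a mpoly" where
  "\<epsilon> = (\<Sum>i<N. mconst (\<alpha> i) * mvar i)"

definition emb_poly :: "'k mpoly \<Rightarrow> 'a mpoly" where
  "emb_poly = meval (\<lambda>c. mconst (emb c)) mvar"

definition \<phi>' :: "'a \<Rightarrow> 'a ratfun" where
  "\<phi>' c = Fract (mconst c) 1"

definition \<phi> :: "'k \<Rightarrow> 'a ratfun" where
  "\<phi> c = \<phi>' (emb c)"

sublocale \<phi>': coefficient_hom \<phi>'
  unfolding \<phi>'_def by (rule coefficient_hom_comp[OF coefficient_hom_mconst coefficient_hom_Fract])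

sublocale \<phi>: coefficient_hom \<phi>
  unfolding \<phi>_def by (rule coefficient_hom_comp[OF emb \<phi>'.coefficient_hom_axioms])

sublocale emb_poly: coefficient_hom emb_poly
  unfolding emb_poly_def
  by (rule coefficient_hom.coefficient_hom_meval, rule coefficient_hom_comp[OF emb coefficient_hom_mconst])

lemma emb_poly_mconst [simp]: "emb_poly (mconst c) = mconst (emb c)"
  and emb_poly_mvar [simp]: "emb_poly (mvar i) = mvar i"
proof -
  interpret h: coefficient_hom "\<lambda>c. mconst (emb c)"
    by (rule coefficient_hom_comp[OF emb coefficient_hom_mconst])
  show "emb_poly (mconst c) = mconst (emb c)" "emb_poly (mvar i) = mvar i" by (simp_all add: emb_poly_def)
qed

lemma lookup_emb_poly: "Poly_Mapping.lookup (emb_poly p) e = emb (Poly_Mapping.lookup p e)"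
proof (induction p rule: mpoly_additive_induct)
  case (single f c)
  have "emb_poly (Poly_Mapping.single f c) = Poly_Mapping.single f (emb c)"
    unfolding single_eq_mconst_monom by (simp add: emb_poly.hom_mult emb_poly.hom_monom_eval)
  then show ?case by (simp add: lookup_single when_def)
qed (simp add: emb_poly.hom_add lookup_add emb.hom_add)

lemma mvars_emb_poly: "mvars (emb_poly p) \<subseteq> mvars p"
proof -
  have "Poly_Mapping.keys (emb_poly p) \<subseteq> Poly_Mapping.keys p"
    by (auto simp: in_keys_iff lookup_emb_poly)
  then show ?thesis by (auto simp only: mvars_def)
qed

lemma meval_emb_poly: "meval \<phi>' x (emb_poly p) = meval \<phi> x p"
proof -
  interpret h: coefficient_hom "\<lambda>c. mconst (emb c)"
    by (rule coefficient_hom_comp[OF emb coefficient_hom_mconst])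
  show ?thesis
    unfolding emb_poly_def h.meval_comp[OF \<phi>'.coefficient_hom_meval] by (simp add: \<phi>_def[abs_def])
qed

lemma emb_eq_0_iff [simp]: "emb c = 0 \<longleftrightarrow> c = 0"
  using emb.hom_mult[of c "inverse c"] by (cases "c = 0") auto

lemma \<phi>'_eq_0_iff [simp]: "\<phi>' c = 0 \<longleftrightarrow> c = 0"
  using \<phi>'.hom_mult[of c "inverse c"] by (cases "c = 0") auto

lemma \<phi>_eq_0_iff [simp]: "\<phi> c = 0 \<longleftrightarrow> c = 0"
  by (simp add: \<phi>_def)

lemma emb_poly_eq_0_iff [simp]: "emb_poly p = 0 \<longleftrightarrow> p = 0"
  by (simp add: poly_mapping_eq_iff fun_eq_iff lookup_emb_poly)

lemma \<alpha>_ne_0: "i < N \<Longrightarrow> \<alpha> i \<noteq> 0"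
proof
  assume i: "i < N" "\<alpha> i = 0"
  have "(\<Sum>j<N. emb (if j = i then 1 else 0) * \<alpha> j) = 0"
    using i by (intro sum.neutral) auto
  from \<alpha>_independent[OF this i(1)] show False by simp
qed

lemma inj_\<alpha>: "inj_on \<alpha> {..<N}"
proof (rule inj_onI, rule ccontr)
  fix i j assume ij: "i \<in> {..<N}" "j \<in> {..<N}" "\<alpha> i = \<alpha> j" "i \<noteq> j"
  have "(\<Sum>l<N. emb (if l = i \<or> l = j then 1 else 0) * \<alpha> l) =
      (\<Sum>l\<in>{i, j}. emb (if l = i \<or> l = j then 1 else 0) * \<alpha> l)"
    using ij by (intro sum.mono_neutral_right) auto
  also have "\<dots> = 0" using ij by (simp add: c2a.add_self)
  finally show False using \<alpha>_independent[of "\<lambda>l. if l = i \<or> l = j then 1 else 0" i] ij by simp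
qed

lemma emb_poly_quadratic: "emb_poly (\<Sum>i<N. mconst (a i) * (Z i)\<^sup>2) = (\<Sum>i<N. mconst (\<alpha> i) * emb_poly (Z i))\<^sup>2"
proof -
  have "mconst (emb (a i)) = (mconst (\<alpha> i))\<^sup>2" if "i < N" for i
    using \<alpha>_square[OF that] by (metis mconst_mult power2_eq_square)
  then show ?thesis
    by (simp add: c2p.sum_square emb_poly.hom_sum emb_poly.hom_mult emb_poly.hom_power power_mult_distrib)
qed

lemma \<epsilon>_square: "\<epsilon>\<^sup>2 = emb_poly q"
  using emb_poly_quadratic[of mvar] by (simp add: \<epsilon>_def q_def)

lemma meval_quadratic:
  "meval \<phi> x (\<Sum>i<N. mconst (a i) * (Z i)\<^sup>2) = (\<Sum>i<N. \<phi>' (\<alpha> i) * meval \<phi> x (Z i))\<^sup>2"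
  unfolding meval_emb_poly[symmetric] emb_poly_quadratic
  by (simp add: \<phi>'.meval_sum \<phi>'.meval_mult \<phi>'.meval_power)

lemma meval_q: "meval \<phi> x q = (\<Sum>i<N. \<phi>' (\<alpha> i) * x i)\<^sup>2"
  using meval_quadratic[of x mvar] by (simp add: q_def)

lemma q_ne_0: "q \<noteq> 0"
proof
  assume "q = 0"
  then have "(\<Sum>i<N. \<phi>' (\<alpha> i) * (if i = 0 then 1 else 0)) = 0"
    using meval_q[of "\<lambda>i. if i = 0 then 1 else 0"] by simp
  moreover have "(\<Sum>i<N. \<phi>' (\<alpha> i) * (if i = 0 then 1 else 0)) = \<phi>' (\<alpha> 0)"
    using N by (simp add: if_distrib cong: if_cong)
  ultimately show False using \<alpha>_ne_0[of 0] N by simp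
qed

lemma \<epsilon>_ne_0: "\<epsilon> \<noteq> 0"
  using \<epsilon>_square q_ne_0 by auto

subsection \<open>Coefficients in a basis of the coefficient field extension\<close>

sublocale kv: vector_space "\<lambda>c (v::'a). emb c * v"
  by unfold_locales (simp_all add: emb.hom_add emb.hom_mult distrib_left distrib_right mult.assoc)

definition \<alpha>_basis :: "'a set" where "\<alpha>_basis = kv.extend_basis (\<alpha> ` {..<N})"

lemma \<alpha>_basis: "\<alpha> ` {..<N} \<subseteq> \<alpha>_basis" "kv.independent \<alpha>_basis" "kv.span \<alpha>_basis = UNIV"
proof -
  have "kv.independent (\<alpha> ` {..<N})"
  proof (rule kv.independent_if_scalars_zero)
    fix f x assume s: "(\<Sum>x\<in>\<alpha> ` {..<N}. emb (f x) * x) = 0" and x: "x \<in> \<alpha> ` {..<N}"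
    have "(\<Sum>i<N. emb (f (\<alpha> i)) * \<alpha> i) = 0"
      using s unfolding sum.reindex[OF inj_\<alpha>] by simp
    from \<alpha>_independent[OF this] show "f x = 0" using x by auto
  qed simp
  then show "\<alpha> ` {..<N} \<subseteq> \<alpha>_basis" "kv.independent \<alpha>_basis" "kv.span \<alpha>_basis = UNIV"
    unfolding \<alpha>_basis_def by (simp_all add: kv.extend_basis_superset kv.independent_extend_basis)
qed

lemma finite_representation:
  assumes "finite C"
  shows "\<exists>D r. finite D \<and> D \<subseteq> \<alpha>_basis \<and> \<alpha> ` {..<N} \<subseteq> D \<and> (\<forall>c\<in>C. c = (\<Sum>d\<in>D. emb (r c d) * d))"
proof -
  define D where "D = \<alpha> ` {..<N} \<union> (\<Union>c\<in>C. {b. kv.representation \<alpha>_basis c b \<noteq> 0})"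
  have fin: "finite D" using assms by (auto simp: D_def kv.finite_representation)
  have "c = (\<Sum>d\<in>D. emb (kv.representation \<alpha>_basis c d) * d)" if "c \<in> C" for c
  proof -
    have "c = (\<Sum>b | kv.representation \<alpha>_basis c b \<noteq> 0. emb (kv.representation \<alpha>_basis c b) * b)"
      using kv.sum_nonzero_representation_eq[OF \<alpha>_basis(2), of c] \<alpha>_basis(3) by simp
    also have "\<dots> = (\<Sum>d\<in>D. emb (kv.representation \<alpha>_basis c d) * d)"
      using fin that by (intro sum.mono_neutral_left) (auto simp: D_def)
    finally show ?thesis .
  qed
  moreover have "D \<subseteq> \<alpha>_basis" using \<alpha>_basis(1) by (auto simp: D_def dest: kv.representation_ne_zero)
  ultimately show ?thesis using fin
    by (intro exI[of _ D] exI[of _ "kv.representation \<alpha>_basis"]) (auto simp: D_def)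
qed

text \<open>A polynomial over \<open>\<Omega>\<close> is a combination of basis elements with polynomials over \<open>k\<close> as
  coefficients. Its finitely many coefficients involve a finite part \<open>D\<close> of the basis, which is
  enlarged by all \<open>\<alpha>\<^sub>i\<close> for later comparisons.\<close>

lemma mpoly_decomposition:
  obtains D g where "finite D" "D \<subseteq> \<alpha>_basis" "\<alpha> ` {..<N} \<subseteq> D" "F = (\<Sum>d\<in>D. mconst d * emb_poly (g d))"
proof -
  obtain D r where D: "finite D" "D \<subseteq> \<alpha>_basis" "\<alpha> ` {..<N} \<subseteq> D"
    and r: "\<forall>c\<in>Poly_Mapping.lookup F ` Poly_Mapping.keys F. c = (\<Sum>d\<in>D. emb (r c d) * d)"
    using finite_representation[of "Poly_Mapping.lookup F ` Poly_Mapping.keys F"] by auto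
  define g where "g d = (\<Sum>e\<in>Poly_Mapping.keys F. Poly_Mapping.single e (r (Poly_Mapping.lookup F e) d))" for d
  have lg: "Poly_Mapping.lookup (g d) e = (if e \<in> Poly_Mapping.keys F then r (Poly_Mapping.lookup F e) d else 0)" for d e
    by (simp add: g_def lookup_sum lookup_single when_def)
  have "F = (\<Sum>d\<in>D. mconst d * emb_poly (g d))"
  proof (rule poly_mapping_eqI)
    fix e
    have "Poly_Mapping.lookup F e = (\<Sum>d\<in>D. d * emb (Poly_Mapping.lookup (g d) e))"
    proof (cases "e \<in> Poly_Mapping.keys F")
      case True
      then have "Poly_Mapping.lookup F e = (\<Sum>d\<in>D. emb (r (Poly_Mapping.lookup F e) d) * d)"
        using r by blast
      then show ?thesis using True by (simp add: lg mult.commute)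
    qed (simp add: lg in_keys_iff)
    then show "Poly_Mapping.lookup F e = Poly_Mapping.lookup (\<Sum>d\<in>D. mconst d * emb_poly (g d)) e"
      by (simp add: lookup_sum lookup_mconst_mult lookup_emb_poly)
  qed
  then show ?thesis using that D by blast
qed

lemma compare_coefficients:
  assumes D: "finite D" "D \<subseteq> \<alpha>_basis" "\<alpha> ` {..<N} \<subseteq> D"
    and eq: "(\<Sum>i<N. mconst (\<alpha> i) * emb_poly (f i)) = (\<Sum>d\<in>D. mconst d * emb_poly (g d))"
  shows "i < N \<Longrightarrow> f i = g (\<alpha> i)" and "d \<in> D - \<alpha> ` {..<N} \<Longrightarrow> g d = 0"
proof -
  define h where "h d = (if d \<in> \<alpha> ` {..<N} then f (inv_into {..<N} \<alpha> d) else 0)" for d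
  have "(\<Sum>d\<in>D. mconst d * emb_poly (h d)) = (\<Sum>d\<in>\<alpha> ` {..<N}. mconst d * emb_poly (h d))"
    using D by (intro sum.mono_neutral_right) (auto simp: h_def)
  also have "\<dots> = (\<Sum>i<N. mconst (\<alpha> i) * emb_poly (f i))"
    unfolding sum.reindex[OF inj_\<alpha>] using inj_\<alpha> by (simp add: h_def inv_into_f_f)
  finally have s: "(\<Sum>d\<in>D. mconst d * emb_poly (h d - g d)) = 0"
    using eq by (simp add: emb_poly.hom_diff right_diff_distrib sum_subtractf)
  have gh: "h d = g d" if "d \<in> D" for d
  proof (rule poly_mapping_eqI)
    fix e
    have "(\<Sum>d\<in>D. emb (Poly_Mapping.lookup (h d - g d) e) * d) = 0"
      using arg_cong[OF s, of "\<lambda>p. Poly_Mapping.lookup p e"]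
      by (simp add: lookup_sum lookup_mconst_mult lookup_emb_poly mult.commute)
    then have "Poly_Mapping.lookup (h d - g d) e = 0"
      using kv.independentD[OF \<alpha>_basis(2) D(1,2), of "\<lambda>d. Poly_Mapping.lookup (h d - g d) e" d] that by simp
    then show "Poly_Mapping.lookup (h d) e = Poly_Mapping.lookup (g d) e"
      by (simp add: lookup_minus)
  qed
  show "f i = g (\<alpha> i)" if "i < N"
    using gh[of "\<alpha> i"] D(3) that inj_\<alpha> by (auto simp: h_def inv_into_f_f)
  show "g d = 0" if "d \<in> D - \<alpha> ` {..<N}"
    using gh[of d] that by (auto simp: h_def)
qed

text \<open>The linear form \<open>\<epsilon>\<close> is not defined over \<open>k\<close>, and vanishing on \<open>{\<epsilon> = 0}\<close> is the same as vanishing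
  on \<open>{q = 0}\<close> for polynomials over \<open>k\<close>. Indeed \<open>f = \<epsilon> F\<close> gives \<open>\<epsilon> f = q F\<close>, where the coefficient
  of \<open>\<alpha>\<^sub>i\<close> is \<open>x\<^sub>i f = q g\<^sub>i\<close>. The variables \<open>x\<^sub>0\<close> and \<open>x\<^sub>1\<close> are coprime, so \<open>q\<close> divides \<open>f\<close>.\<close>

lemma q_dvd_if_\<epsilon>_dvd:
  assumes "\<epsilon> dvd emb_poly f"
  shows "q dvd f"
proof -
  obtain F where F: "emb_poly f = \<epsilon> * F" using assms by blast
  obtain D g where D: "finite D" "D \<subseteq> \<alpha>_basis" "\<alpha> ` {..<N} \<subseteq> D" and g: "F = (\<Sum>d\<in>D. mconst d * emb_poly (g d))"
    by (rule mpoly_decomposition)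
  have "emb_poly f * \<epsilon> = \<epsilon>\<^sup>2 * F" by (simp add: F power2_eq_square mult_ac)
  also have "\<dots> = (\<Sum>d\<in>D. mconst d * emb_poly (q * g d))"
    unfolding \<epsilon>_square g by (simp add: emb_poly.hom_mult sum_distrib_left mult_ac)
  also have "emb_poly f * \<epsilon> = (\<Sum>i<N. mconst (\<alpha> i) * emb_poly (f * mvar i))"
    by (simp add: \<epsilon>_def emb_poly.hom_mult sum_distrib_left mult_ac)
  finally have fg: "f * mvar i = q * g (\<alpha> i)" if "i < N" for i
    using compare_coefficients(1)[OF D, of "\<lambda>i. f * mvar i" "\<lambda>d. q * g d" i] that by simp
  have f0: "f * mvar 0 = q * g (\<alpha> 0)" and f1: "f * mvar 1 = q * g (\<alpha> 1)"
    using fg[of 0] fg[of 1] N by auto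
  have "q * (mvar 1 * g (\<alpha> 0)) = mvar 1 * (f * mvar 0)" unfolding f0 by (rule mult.left_commute)
  also have "\<dots> = mvar 0 * (f * mvar 1)" by (simp add: mult_ac)
  also have "\<dots> = q * (mvar 0 * g (\<alpha> 1))" unfolding f1 by (rule mult.left_commute)
  finally have "q * (mvar 1 * g (\<alpha> 0)) = q * (mvar 0 * g (\<alpha> 1))" .
  then have "mvar 1 * g (\<alpha> 0) = mvar 0 * g (\<alpha> 1)" using q_ne_0 by simp
  then have "mvar 0 dvd g (\<alpha> 0)" by (rule mvar_dvd_cancel[rotated]) simp
  then obtain h where "g (\<alpha> 0) = mvar 0 * h" by blast
  then have "mvar 0 * f = q * (mvar 0 * h)" using f0 by (simp add: mult.commute[of f])
  also have "\<dots> = mvar 0 * (q * h)" by (rule mult.left_commute)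
  finally have "f = q * h" by simp
  then show ?thesis by simp
qed

subsection \<open>Generic points\<close>

text \<open>The kernel of the evaluation at \<open>\<zeta>\<close> is generated by \<open>q\<close>, so \<open>\<zeta>\<close> is a generic point of \<open>{q = 0}\<close>.
  The index set \<open>I\<close> may be larger than that of the variables of \<open>q\<close>: the coordinates outside are
  those of a further factor, such as \<open>P\<^sup>r\<^sup>-\<^sup>1\<close>.\<close>

definition generic :: "nat set \<Rightarrow> (nat \<Rightarrow> 'a ratfun) \<Rightarrow> bool" where
  "generic I \<zeta> \<longleftrightarrow> (\<forall>f. mvars f \<subseteq> I \<longrightarrow> (meval \<phi> \<zeta> f = 0 \<longleftrightarrow> q dvd f))"

text \<open>The same property over the extension field \<open>\<Omega>\<close>, where the reduced equation of the quadric is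
  \<open>\<epsilon>\<close>.\<close>

definition generic' :: "nat set \<Rightarrow> (nat \<Rightarrow> 'a ratfun) \<Rightarrow> bool" where
  "generic' I \<zeta> \<longleftrightarrow> (\<forall>F. mvars F \<subseteq> I \<longrightarrow> (meval \<phi>' \<zeta> F = 0 \<longleftrightarrow> \<epsilon> dvd F))"

lemma generic'_imp_generic: "generic' I \<zeta> \<Longrightarrow> generic I \<zeta>"
  unfolding generic_def
proof (intro allI impI iffI)
  fix f :: "'k mpoly" assume g: "generic' I \<zeta>" and f: "mvars f \<subseteq> I"
  have m: "mvars (emb_poly f) \<subseteq> I" using f mvars_emb_poly by blast
  show "q dvd f" if "meval \<phi> \<zeta> f = 0"
    using g m that q_dvd_if_\<epsilon>_dvd by (auto simp: generic'_def meval_emb_poly)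
  show "meval \<phi> \<zeta> f = 0" if "q dvd f"
  proof -
    have "emb_poly q dvd emb_poly f" using that by (auto simp: emb_poly.hom_mult)
    then have "\<epsilon> dvd emb_poly f" unfolding \<epsilon>_square[symmetric] by (auto simp: power2_eq_square mult_ac)
    then show ?thesis using g m by (auto simp: generic'_def meval_emb_poly)
  qed
qed

lemma meval_\<epsilon>: "meval \<phi>' \<zeta> \<epsilon> = (\<Sum>i<N. \<phi>' (\<alpha> i) * \<zeta> i)"
  by (simp add: \<epsilon>_def \<phi>'.meval_sum \<phi>'.meval_mult)

text \<open>Modulo \<open>\<epsilon>\<close> the variable \<open>x\<^sub>0\<close> can be replaced by its expression in the other variables, and a
  polynomial without \<open>x\<^sub>0\<close> vanishes at \<open>\<zeta>\<close> only if it is zero.\<close>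

lemma generic'_if_algebraically_independent:
  assumes I: "{..<N} \<subseteq> I" and rel: "(\<Sum>i<N. \<phi>' (\<alpha> i) * \<zeta> i) = 0"
    and ind: "\<And>F. mvars F \<subseteq> I - {0} \<Longrightarrow> meval \<phi>' \<zeta> F = 0 \<Longrightarrow> F = 0"
  shows "generic' I \<zeta>"
  unfolding generic'_def
proof (intro allI impI iffI)
  fix F :: "'a mpoly" assume F: "mvars F \<subseteq> I"
  show "meval \<phi>' \<zeta> F = 0" if "\<epsilon> dvd F"
    using that rel by (auto simp: \<phi>'.meval_mult meval_\<epsilon>)
  assume z: "meval \<phi>' \<zeta> F = 0"
  \<comment> \<open>The solution of \<open>\<epsilon> = 0\<close> for \<open>x\<^sub>0\<close>; signs do not occur in characteristic two.\<close>
  define l where "l = (\<Sum>i\<in>{1..<N}. mconst (\<alpha> i / \<alpha> 0) * mvar i)"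
  define G where "G = mvar(0 := l)"
  have N0: "{..<N} = insert 0 {1..<N}" using N by auto
  have a0: "\<alpha> 0 \<noteq> 0" using \<alpha>_ne_0 N by simp
  have cl: "mconst (\<alpha> 0) * l = (\<Sum>i\<in>{1..<N}. mconst (\<alpha> i) * mvar i)"
  proof -
    have "mconst (\<alpha> 0) * (mconst (\<alpha> i / \<alpha> 0) * mvar i) = mconst (\<alpha> i) * mvar i" for i
    proof -
      have "\<alpha> i = \<alpha> 0 * (\<alpha> i / \<alpha> 0)" using a0 by simp
      then show ?thesis by (metis mconst_mult mult.assoc)
    qed
    then show ?thesis unfolding l_def sum_distrib_left by (intro sum.cong refl)
  qed
  have "\<epsilon> = mconst (\<alpha> 0) * mvar 0 + (\<Sum>i\<in>{1..<N}. mconst (\<alpha> i) * mvar i)"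
    unfolding \<epsilon>_def N0 by (subst sum.insert) auto
  then have el: "\<epsilon> = mconst (\<alpha> 0) * (mvar 0 - l)"
    by (simp only: cl[symmetric] c2p.minus_eq distrib_left)
  have "\<epsilon> dvd mvar 0 - l"
  proof
    have "mconst (\<alpha> 0) * mconst (inverse (\<alpha> 0)) = 1"
      using a0 by (simp flip: mconst_mult)
    then show "mvar 0 - l = \<epsilon> * mconst (inverse (\<alpha> 0))"
      unfolding el by (metis mult.assoc mult.commute mult.right_neutral)
  qed
  then have dvd: "\<epsilon> dvd msubst mvar F - msubst G F"
    by (intro msubst_cong_dvd) (auto simp: G_def)
  have "\<phi>' (\<alpha> 0) * (\<zeta> 0 - meval \<phi>' \<zeta> l) = 0"
    using rel unfolding meval_\<epsilon>[symmetric] el by (simp add: \<phi>'.meval_mult \<phi>'.meval_diff)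
  then have "meval \<phi>' \<zeta> l = \<zeta> 0" using a0 by simp
  then have "(\<lambda>i. meval \<phi>' \<zeta> (G i)) = \<zeta>" by (auto simp: G_def)
  then have "meval \<phi>' \<zeta> (msubst G F) = 0"
    using z \<phi>'.meval_msubst[OF \<phi>'.coefficient_hom_axioms, of \<zeta> G F] by simp
  moreover have "mvars (msubst G F) \<subseteq> I - {0}"
  proof -
    have "mvars l \<subseteq> I - {0}"
      unfolding l_def using I
      by (intro order_trans[OF mvars_sum] UN_least order_trans[OF mvars_mult]) auto
    then show ?thesis
      using F by (intro order_trans[OF mvars_msubst] UN_least) (auto simp: G_def)
  qed
  ultimately have "msubst G F = 0" using ind by blast
  then show "\<epsilon> dvd F" using dvd by (simp add: msubst_mvar)
qed

subsection \<open>Zeros over subfields\<close>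

text \<open>The zeros of \<open>q\<close> over \<open>L\<close>. By \<open>meval_q\<close> the value of \<open>q\<close> is the square of the sum, so that this
  is a linear condition.\<close>

definition zeros :: "'a ratfun set \<Rightarrow> (nat \<Rightarrow> 'a ratfun) set" where
  "zeros L = {v. (\<forall>i<N. v i \<in> L) \<and> (\<forall>i\<ge>N. v i = 0) \<and> (\<Sum>i<N. \<phi>' (\<alpha> i) * v i) = 0}"

text \<open>One zero \<open>Z(\<xi>)/w\<close> of \<open>q\<close> over \<open>L\<close> suffices for the zeros over \<open>L\<close> to span all zeros that are
  rational in \<open>\<xi>\<close>. In the polynomial ring over \<open>\<Omega>\<close> the linear forms of \<open>V\<close> and \<open>Z\<close> are \<open>\<epsilon> e\<^sub>V\<close> and
  \<open>\<epsilon> e\<^sub>Z\<close>, and \<open>e\<^sub>Z\<^sup>2 = s\<close> is defined over \<open>k\<close>, whence \<open>s V = e\<^sub>Z e\<^sub>V Z\<close> after pairing with the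
  \<open>\<alpha>\<^sub>i\<close>. So \<open>V\<close> is obtained from \<open>Z\<close> by multiplication with an element of \<open>\<Omega>\<close> over \<open>k(\<xi>)\<close>;
  multiplying \<open>Z/w\<close> by elements of \<open>\<Omega>\<close> only involves structure constants of \<open>\<Omega>\<close> over \<open>k\<close>, which
  lie in \<open>L\<close>.\<close>

lemma zeros_span_descent:
  assumes \<xi>: "generic' UNIV \<xi>"
    and L: "closed_subfield L" "\<And>c. \<phi> c \<in> L"
    and V: "(\<Sum>i<N. \<phi>' (\<alpha> i) * meval \<phi> \<xi> (V i)) = 0"
    and Z: "(\<Sum>i<N. \<phi>' (\<alpha> i) * meval \<phi> \<xi> (Z i)) = 0" "i\<^sub>0 < N" "meval \<phi> \<xi> (Z i\<^sub>0) \<noteq> 0"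
    and w: "w \<noteq> 0" "\<And>i. i < N \<Longrightarrow> meval \<phi> \<xi> (Z i) / w \<in> L"
  shows "(\<lambda>i. if i < N then meval \<phi> \<xi> (V i) else 0) \<in> vec.span (zeros L)"
proof -
  interpret closed_subfield L by fact
  let ?ev = "meval \<phi> \<xi>" and ?ev' = "meval \<phi>' \<xi>"
  have ker: "\<epsilon> dvd F" if "?ev' F = 0" for F
    using \<xi> that by (simp add: generic'_def)
  define \<alpha>V where "\<alpha>V = (\<Sum>i<N. mconst (\<alpha> i) * emb_poly (V i))"
  define \<alpha>Z where "\<alpha>Z = (\<Sum>i<N. mconst (\<alpha> i) * emb_poly (Z i))"
  have "?ev' \<alpha>V = 0" "?ev' \<alpha>Z = 0"
    using V Z by (simp_all add: \<alpha>V_def \<alpha>Z_def \<phi>'.meval_sum \<phi>'.meval_mult meval_emb_poly)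
  then obtain eV eZ where eV: "\<alpha>V = \<epsilon> * eV" and eZ: "\<alpha>Z = \<epsilon> * eZ"
    using ker unfolding dvd_def by metis
  have "emb_poly (\<Sum>i<N. mconst (a i) * (Z i)\<^sup>2) = \<epsilon> * (\<epsilon> * eZ\<^sup>2)"
    unfolding emb_poly_quadratic \<alpha>Z_def[symmetric] eZ by (simp add: power2_eq_square mult_ac)
  then have "q dvd (\<Sum>i<N. mconst (a i) * (Z i)\<^sup>2)"
    by (intro q_dvd_if_\<epsilon>_dvd) simp
  then obtain s where s: "(\<Sum>i<N. mconst (a i) * (Z i)\<^sup>2) = q * s" by blast
  have "\<epsilon>\<^sup>2 * eZ\<^sup>2 = \<epsilon>\<^sup>2 * emb_poly s"
    using emb_poly_quadratic[of Z] unfolding s \<alpha>Z_def[symmetric] eZ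
    by (auto simp: emb_poly.hom_mult \<epsilon>_square[symmetric] power_mult_distrib)
  then have eZs: "eZ\<^sup>2 = emb_poly s" using \<epsilon>_ne_0 by simp
  \<comment> \<open>Otherwise \<open>\<epsilon>\<close> divides \<open>e\<^sub>Z\<close>, the linear form of \<open>Z\<close> is divisible by \<open>\<epsilon>\<^sup>2 = q\<close>, and all
    coordinates of \<open>Z\<close> vanish at \<open>\<xi>\<close>.\<close>
  have s_ne: "?ev s \<noteq> 0"
  proof
    assume "?ev s = 0"
    then have "(?ev' eZ)\<^sup>2 = 0" by (simp add: eZs meval_emb_poly flip: \<phi>'.meval_power)
    then obtain F where F: "eZ = \<epsilon> * F" using ker[of eZ] by auto
    obtain D g where D: "finite D" "D \<subseteq> \<alpha>_basis" "\<alpha> ` {..<N} \<subseteq> D" and g: "F = (\<Sum>d\<in>D. mconst d * emb_poly (g d))"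
      by (rule mpoly_decomposition)
    have "\<alpha>Z = \<epsilon>\<^sup>2 * F" by (simp add: eZ F power2_eq_square mult_ac)
    also have "\<dots> = (\<Sum>d\<in>D. mconst d * emb_poly (q * g d))"
      unfolding \<epsilon>_square g by (simp add: emb_poly.hom_mult sum_distrib_left mult_ac)
    finally have "Z i\<^sub>0 = q * g (\<alpha> i\<^sub>0)"
      using compare_coefficients(1)[OF D, of Z "\<lambda>d. q * g d"] Z(2) by (simp add: \<alpha>Z_def)
    moreover have "?ev q = 0"
      using generic'_imp_generic[OF \<xi>] by (simp add: generic_def)
    ultimately show False using Z(3) by (simp add: \<phi>.meval_mult)
  qed
  \<comment> \<open>The factor \<open>e\<^sub>Z e\<^sub>V\<close> is a combination of basis elements \<open>b \<in> C\<close>, the linear form of \<open>Z\<close>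
    one of the \<open>\<alpha>\<^sub>l\<close>; the products \<open>b \<alpha>\<^sub>l\<close> are expanded in the basis, with structure constants
    \<open>\<rho> d b l \<in> k\<close>.\<close>
  obtain C c where C: "finite C" and c: "eZ * eV = (\<Sum>b\<in>C. mconst b * emb_poly (c b))"
    using mpoly_decomposition[of "eZ * eV"] by metis
  obtain D r where D: "finite D" "D \<subseteq> \<alpha>_basis" "\<alpha> ` {..<N} \<subseteq> D"
    and r: "\<forall>x\<in>(\<lambda>(b, l). b * \<alpha> l) ` (C \<times> {..<N}). x = (\<Sum>d\<in>D. emb (r x d) * d)"
    using finite_representation[of "(\<lambda>(b, l). b * \<alpha> l) ` (C \<times> {..<N})"] C by auto
  define \<rho> where "\<rho> d b l = r (b * \<alpha> l) d" for d b l
  have \<rho>: "b * \<alpha> l = (\<Sum>d\<in>D. emb (\<rho> d b l) * d)" if "b \<in> C" "l < N" for b l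
    using r that unfolding \<rho>_def by auto
  define U where "U d = (\<Sum>b\<in>C. \<Sum>l<N. mconst (\<rho> d b l) * c b * Z l)" for d
  have "(\<Sum>i<N. mconst (\<alpha> i) * emb_poly (s * V i)) = emb_poly s * \<alpha>V"
    by (simp add: \<alpha>V_def emb_poly.hom_mult sum_distrib_left mult_ac)
  also have "\<dots> = (eZ * eV) * \<alpha>Z"
    by (simp add: eV eZ power2_eq_square mult_ac flip: eZs)
  also have "\<dots> = (\<Sum>b\<in>C. \<Sum>l<N. mconst (b * \<alpha> l) * emb_poly (c b * Z l))"
    unfolding c \<alpha>Z_def by (simp add: sum_product mconst_mult emb_poly.hom_mult mult_ac)
  also have "\<dots> = (\<Sum>b\<in>C. \<Sum>l<N. \<Sum>d\<in>D. mconst d * emb_poly (mconst (\<rho> d b l) * c b * Z l))"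
  proof (intro sum.cong refl)
    fix b l assume "b \<in> C" "l \<in> {..<N}"
    then have "mconst (b * \<alpha> l) = (\<Sum>d\<in>D. mconst (emb (\<rho> d b l)) * mconst d)"
      using \<rho>[of b l] coefficient_hom.hom_sum[OF coefficient_hom_mconst, of "\<lambda>d. emb (\<rho> d b l) * d" D]
      by (simp add: mconst_mult)
    then show "mconst (b * \<alpha> l) * emb_poly (c b * Z l) =
        (\<Sum>d\<in>D. mconst d * emb_poly (mconst (\<rho> d b l) * c b * Z l))"
      by (simp add: sum_distrib_right sum_distrib_left emb_poly.hom_mult mult_ac)
  qed
  also have "\<dots> = (\<Sum>d\<in>D. mconst d * emb_poly (U d))"
    unfolding U_def emb_poly.hom_sum sum_distrib_left
    by (subst sum.swap[of _ D], subst sum.swap[of _ "{..<N}"]) (simp add: sum.swap[of _ D])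
  finally have eqU: "(\<Sum>i<N. mconst (\<alpha> i) * emb_poly (s * V i)) = (\<Sum>d\<in>D. mconst d * emb_poly (U d))" .
  note cU = compare_coefficients[OF D eqU]
  \<comment> \<open>The numbers \<open>u d b\<close> below are the coefficients at \<open>d\<close> of \<open>b\<close> times the linear form at
    \<open>Z/w\<close>. They lie in \<open>L\<close>, but for a single \<open>b\<close> they need not vanish at the basis elements
    \<open>d\<close> other than the \<open>\<alpha>\<^sub>i\<close>; only their combination with coefficients \<open>\<kappa> b\<close> does. Over an
    \<open>L\<close>-independent subset of the \<open>\<kappa> b\<close> this combination splits into vectors \<open>W e\<close> over \<open>L\<close>,
    which vanish at these \<open>d\<close> one by one.\<close>
  define \<kappa> where "\<kappa> b = ?ev (c b)" for b
  define z where "z l = ?ev (Z l) / w" for l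
  define u where "u d b = (\<Sum>l<N. \<phi> (\<rho> d b l) * z l)" for d b
  have uL: "u d b \<in> L" for d b
    unfolding u_def by (intro sum_mem mult_mem L(2)) (simp add: z_def w(2))
  have evU: "?ev (U d) = w * (\<Sum>b\<in>C. \<kappa> b * u d b)" for d
    using w(1) by (simp add: U_def u_def z_def \<kappa>_def \<phi>.meval_sum \<phi>.meval_mult sum_distrib_left mult_ac)
  have uzero: "(\<Sum>d\<in>D. \<phi>' d * u d b) = 0" if "b \<in> C" for b
  proof -
    have "(\<Sum>d\<in>D. \<phi>' d * u d b) = (\<Sum>l<N. (\<Sum>d\<in>D. \<phi>' (emb (\<rho> d b l) * d)) * z l)"
      unfolding u_def sum_distrib_left sum_distrib_right
      by (subst sum.swap) (simp add: \<phi>_def \<phi>'.hom_mult mult_ac)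
    also have "\<dots> = (\<Sum>l<N. \<phi>' (b * \<alpha> l) * z l)"
      using \<rho>[OF that] by (simp add: \<phi>'.hom_sum)
    also have "\<dots> = \<phi>' b * (\<Sum>l<N. \<phi>' (\<alpha> l) * ?ev (Z l)) / w"
      by (simp add: z_def \<phi>'.hom_mult sum_distrib_left sum_divide_distrib mult_ac)
    finally show ?thesis using Z(1) by simp
  qed
  obtain J f where J: "J \<subseteq> C" and fL: "\<forall>e\<in>C. \<forall>b\<in>J. f e b \<in> L"
    and \<kappa>: "\<forall>e\<in>C. \<kappa> e = (\<Sum>b\<in>J. f e b * \<kappa> b)"
    and li: "\<forall>c. (\<forall>b\<in>J. c b \<in> L) \<longrightarrow> (\<Sum>b\<in>J. c b * \<kappa> b) = 0 \<longrightarrow> (\<forall>b\<in>J. c b = 0)"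
    using expand_over_independent_subset[OF C, of \<kappa>] by blast
  define W where "W e d = (\<Sum>b\<in>C. f b e * u d b)" for e d
  have \<kappa>u: "(\<Sum>b\<in>C. \<kappa> b * u d b) = (\<Sum>e\<in>J. W e d * \<kappa> e)" for d
  proof -
    have "(\<Sum>b\<in>C. \<kappa> b * u d b) = (\<Sum>b\<in>C. (\<Sum>e\<in>J. f b e * \<kappa> e) * u d b)"
      using \<kappa> by (intro sum.cong) auto
    also have "\<dots> = (\<Sum>e\<in>J. W e d * \<kappa> e)"
      unfolding W_def sum_distrib_right by (subst sum.swap) (simp add: mult_ac)
    finally show ?thesis .
  qed
  have WL: "W e d \<in> L" if "e \<in> J" for e d
    unfolding W_def using fL that uL by (intro sum_mem mult_mem) auto
  have W0: "W e d = 0" if "e \<in> J" "d \<in> D - \<alpha> ` {..<N}" for e d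
  proof -
    have "w * (\<Sum>e\<in>J. W e d * \<kappa> e) = 0"
      using evU[of d] cU(2)[OF that(2)] by (simp add: \<kappa>u)
    then have "(\<Sum>e\<in>J. W e d * \<kappa> e) = 0" using w(1) by simp
    then show ?thesis using li[THEN spec, of "\<lambda>e. W e d"] WL that(1) by blast
  qed
  define v where "v e i = (if i < N then W e (\<alpha> i) else 0)" for e i
  have "v e \<in> zeros L" if e: "e \<in> J" for e
  proof -
    have "(\<Sum>i<N. \<phi>' (\<alpha> i) * v e i) = (\<Sum>d\<in>\<alpha> ` {..<N}. \<phi>' d * W e d)"
      unfolding sum.reindex[OF inj_\<alpha>] by (simp add: v_def)
    also have "\<dots> = (\<Sum>d\<in>D. \<phi>' d * W e d)"
      using D W0[OF e] by (intro sum.mono_neutral_left) auto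
    also have "\<dots> = (\<Sum>b\<in>C. f b e * (\<Sum>d\<in>D. \<phi>' d * u d b))"
      unfolding W_def sum_distrib_left by (subst sum.swap) (simp add: mult_ac)
    also have "\<dots> = 0" using uzero by simp
    finally show ?thesis using WL[OF e] by (auto simp: zeros_def v_def)
  qed
  then have "(\<Sum>e\<in>J. (\<lambda>i. (w * \<kappa> e / ?ev s) * v e i)) \<in> vec.span (zeros L)"
    by (intro vec.span_sum vec.span_scale vec.span_base)
  also have "(\<Sum>e\<in>J. (\<lambda>i. (w * \<kappa> e / ?ev s) * v e i)) = (\<lambda>i. if i < N then ?ev (V i) else 0)"
  proof
    fix i
    show "(\<Sum>e\<in>J. (\<lambda>i. (w * \<kappa> e / ?ev s) * v e i)) i = (if i < N then ?ev (V i) else 0)"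
    proof (cases "i < N")
      case True
      have "?ev s * ?ev (V i) = w * (\<Sum>e\<in>J. W e (\<alpha> i) * \<kappa> e)"
        using evU[of "\<alpha> i"] cU(1)[OF True] by (metis \<phi>.meval_mult \<kappa>u)
      then have "?ev (V i) = (w * (\<Sum>e\<in>J. W e (\<alpha> i) * \<kappa> e)) / ?ev s"
        using s_ne by (metis nonzero_mult_div_cancel_left)
      then show ?thesis using True
        by (simp add: sum_fun_apply v_def sum_distrib_left sum_divide_distrib mult_ac)
    qed (simp add: sum_fun_apply v_def)
  qed
  finally show ?thesis .
qed

end

section \<open>Dimensions of coordinate subspaces\<close>

lemma coord_space_simps:
  "carrier (coord_space K n) = {..<n} \<rightarrow>\<^sub>E carrier K"
  "\<zero>\<^bsub>coord_space K n\<^esub> = (\<lambda>i\<in>{..<n}. \<zero>\<^bsub>K\<^esub>)"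
  "v \<oplus>\<^bsub>coord_space K n\<^esub> w = (\<lambda>i\<in>{..<n}. v i \<oplus>\<^bsub>K\<^esub> w i)"
  "a \<odot>\<^bsub>coord_space K n\<^esub> v = (\<lambda>i\<in>{..<n}. a \<otimes>\<^bsub>K\<^esub> v i)"
  by (simp_all add: coord_space_def)

lemma (in field) coord_space_vectorspace: "vectorspace R (coord_space R n)"
proof -
  have ag: "abelian_group (coord_space R n)"
  proof (rule abelian_groupI)
    fix x assume x: "x \<in> carrier (coord_space R n)"
    show "\<exists>y\<in>carrier (coord_space R n). y \<oplus>\<^bsub>coord_space R n\<^esub> x = \<zero>\<^bsub>coord_space R n\<^esub>"
      by (rule bexI[of _ "\<lambda>i\<in>{..<n}. \<ominus> x i"]) (use x in \<open>auto simp: coord_space_simps l_neg PiE_iff\<close>)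
  next
    fix x assume x: "x \<in> carrier (coord_space R n)"
    show "\<zero>\<^bsub>coord_space R n\<^esub> \<oplus>\<^bsub>coord_space R n\<^esub> x = x"
      using x by (intro extensionalityI[of _ "{..<n}"]) (auto simp: coord_space_simps PiE_iff)
  qed (auto simp: coord_space_simps PiE_iff a_assoc a_comm a_lcomm intro!: restrict_ext)
  have "module R (coord_space R n)"
  proof (rule moduleI[OF is_cring ag])
    fix x assume x: "x \<in> carrier (coord_space R n)"
    show "\<one> \<odot>\<^bsub>coord_space R n\<^esub> x = x"
      using x by (intro extensionalityI[of _ "{..<n}"]) (auto simp: coord_space_simps PiE_iff)
  qed (auto simp: coord_space_simps PiE_iff l_distr r_distr m_assoc)
  then show ?thesis unfolding vectorspace_def using field_axioms by simp
qed

definition support_functions :: "nat \<Rightarrow> (nat \<Rightarrow> 'm::zero) set" where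
  "support_functions n = {v. \<forall>i\<ge>n. v i = 0}"

lemma support_functions_spanned:
  "\<exists>B. finite B \<and> (support_functions n :: (nat \<Rightarrow> 'm::field) set) \<subseteq> vec.span B"
proof (intro exI conjI subsetI)
  let ?e = "\<lambda>j i. if i = j then 1 else (0::'m)"
  show "finite (?e ` {..<n})" by simp
  fix v :: "nat \<Rightarrow> 'm" assume v: "v \<in> support_functions n"
  have "v = (\<Sum>j<n. (\<lambda>i. v j * ?e j i))"
  proof
    fix i
    have "(\<Sum>j<n. (\<lambda>i. v j * ?e j i)) i = (\<Sum>j<n. if j = i then v j else 0)"
      by (simp add: sum_fun_apply if_distrib eq_commute cong: if_cong)
    also have "\<dots> = v i" using v by (auto simp: support_functions_def not_less)
    finally show "v i = (\<Sum>j<n. (\<lambda>i. v j * ?e j i)) i" by simp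
  qed
  also have "\<dots> \<in> vec.span (?e ` {..<n})"
    by (intro vec.span_sum vec.span_scale vec.span_base) simp
  finally show "v \<in> vec.span (?e ` {..<n})" .
qed

lemma support_functions_basis:
  assumes "S \<subseteq> support_functions n"
  obtains C :: "(nat \<Rightarrow> 'm::field) set"
  where "C \<subseteq> S" "finite C" "vec.independent C" "S \<subseteq> vec.span C" "card C = vec.dim S"
proof -
  obtain C where C: "C \<subseteq> S" "vec.independent C" "S \<subseteq> vec.span C"
    using vec.maximal_independent_subset[of S] by blast
  obtain B :: "(nat \<Rightarrow> 'm) set" where B: "finite B" "support_functions n \<subseteq> vec.span B"
    using support_functions_spanned by blast
  have "finite C"
    using vec.independent_span_bound[OF B(1) C(2)] C(1) assms B(2) by blast
  then show ?thesis using that C vec.basis_card_eq_dim[OF C(1,3,2)] by blast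
qed

lemma vec_dim_mono:
  assumes "S \<subseteq> vec.span T" "S \<subseteq> support_functions n" "T \<subseteq> support_functions n"
  shows "vec.dim S \<le> vec.dim (T :: (nat \<Rightarrow> 'm::field) set)"
proof -
  obtain C where C: "C \<subseteq> S" "vec.independent C" "card C = vec.dim S"
    using support_functions_basis[OF assms(2)] by metis
  obtain D where D: "finite D" "T \<subseteq> vec.span D" "card D = vec.dim T"
    using support_functions_basis[OF assms(3)] by metis
  have "vec.span T \<subseteq> vec.span D" using D(2) by (simp add: vec.span_minimal)
  then have "card C \<le> card D"
    using vec.independent_span_bound[OF D(1) C(2)] C(1) assms(1) by blast
  then show ?thesis using C D by simp
qed

text \<open>Function fields are rings of cosets, given as records with a carrier. All computations take
  place in a subfield \<open>L\<close> of a field type, which such a ring is identified with by an isomorphism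
  \<open>\<Phi>\<close>.\<close>

locale embedded_field = field R + L: closed_subfield L
  for R :: "('b, 'z) ring_scheme" (structure) and L :: "'m::field set" +
  fixes \<Phi> :: "'b \<Rightarrow> 'm"
  assumes \<Phi>_add: "a \<in> carrier R \<Longrightarrow> b \<in> carrier R \<Longrightarrow> \<Phi> (a \<oplus> b) = \<Phi> a + \<Phi> b"
    and \<Phi>_mult: "a \<in> carrier R \<Longrightarrow> b \<in> carrier R \<Longrightarrow> \<Phi> (a \<otimes> b) = \<Phi> a * \<Phi> b"
    and \<Phi>_one: "\<Phi> \<one> = 1"
    and \<Phi>_bij: "bij_betw \<Phi> (carrier R) L"
begin

lemma \<Phi>_zero: "\<Phi> \<zero> = 0"
  using \<Phi>_add[of \<zero> \<zero>] by (metis add_cancel_left_left l_zero zero_closed)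

lemma \<Phi>_eq_iff: "a \<in> carrier R \<Longrightarrow> b \<in> carrier R \<Longrightarrow> \<Phi> a = \<Phi> b \<longleftrightarrow> a = b"
  using \<Phi>_bij by (auto simp: bij_betw_def inj_on_eq_iff)

lemma \<Phi>_mem: "a \<in> carrier R \<Longrightarrow> \<Phi> a \<in> L"
  using \<Phi>_bij by (auto simp: bij_betw_def)

lemma \<Phi>_surj: "l \<in> L \<Longrightarrow> \<exists>a\<in>carrier R. \<Phi> a = l"
  using \<Phi>_bij by (auto simp: bij_betw_def)

lemma \<Phi>_finsum: "f \<in> A \<rightarrow> carrier R \<Longrightarrow> \<Phi> (\<Oplus>i\<in>A. f i) = (\<Sum>i\<in>A. \<Phi> (f i))"
  by (induction A rule: infinite_finite_induct) (auto simp: \<Phi>_zero \<Phi>_add Pi_def)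

lemma \<Phi>_finprod: "f \<in> A \<rightarrow> carrier R \<Longrightarrow> \<Phi> (\<Otimes>i\<in>A. f i) = (\<Prod>i\<in>A. \<Phi> (f i))"
  by (induction A rule: infinite_finite_induct) (auto simp: \<Phi>_one \<Phi>_mult Pi_def)

lemma \<Phi>_pow: "a \<in> carrier R \<Longrightarrow> \<Phi> (a [^] (n::nat)) = \<Phi> a ^ n"
  by (induction n) (simp_all add: \<Phi>_one \<Phi>_mult mult.commute)

lemma \<Phi>_ring_meval:
  assumes c: "\<And>c. \<phi> c \<in> carrier R" and x: "\<And>i. i \<in> mvars p \<Longrightarrow> x i \<in> carrier R"
  shows "\<Phi> (ring_meval R \<phi> x p) = meval (\<lambda>c. \<Phi> (\<phi> c)) (\<lambda>i. \<Phi> (x i)) p"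
proof -
  have m: "x i \<in> carrier R" if "e \<in> Poly_Mapping.keys p" "i \<in> Poly_Mapping.keys e" for e i
    using x that by (auto simp: mvars_def)
  have "\<Phi> (ring_meval R \<phi> x p) = (\<Sum>e\<in>Poly_Mapping.keys p. \<Phi> (\<phi> (Poly_Mapping.lookup p e) \<otimes>
      (\<Otimes>i\<in>Poly_Mapping.keys e. x i [^] Poly_Mapping.lookup e i)))"
    unfolding ring_meval_def using c m by (intro \<Phi>_finsum) (auto intro!: finprod_closed)
  also have "\<dots> = meval (\<lambda>c. \<Phi> (\<phi> c)) (\<lambda>i. \<Phi> (x i)) p"
    unfolding meval_def
  proof (intro sum.cong refl)
    fix e assume e: "e \<in> Poly_Mapping.keys p"
    have "\<Phi> (\<Otimes>i\<in>Poly_Mapping.keys e. x i [^] Poly_Mapping.lookup e i) =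
        (\<Prod>i\<in>Poly_Mapping.keys e. \<Phi> (x i [^] Poly_Mapping.lookup e i))"
      using m[OF e] by (intro \<Phi>_finprod) auto
    also have "\<dots> = (\<Prod>i\<in>Poly_Mapping.keys e. \<Phi> (x i) ^ Poly_Mapping.lookup e i)"
      using m[OF e] by (intro prod.cong) (auto simp: \<Phi>_pow)
    finally show "\<Phi> (\<phi> (Poly_Mapping.lookup p e) \<otimes> (\<Otimes>i\<in>Poly_Mapping.keys e. x i [^] Poly_Mapping.lookup e i)) =
        \<Phi> (\<phi> (Poly_Mapping.lookup p e)) * (\<Prod>i\<in>Poly_Mapping.keys e. \<Phi> (x i) ^ Poly_Mapping.lookup e i)"
      using c m[OF e] by (subst \<Phi>_mult) (auto intro!: finprod_closed)
  qed
  finally show ?thesis .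
qed

definition \<psi> :: "nat \<Rightarrow> (nat \<Rightarrow> 'b) \<Rightarrow> nat \<Rightarrow> 'm" where
  "\<psi> n v i = (if i < n then \<Phi> (v i) else 0)"

lemma \<psi>_inj: "inj_on (\<psi> n) (carrier (coord_space R n))"
proof (rule inj_onI)
  fix v w assume vw: "v \<in> carrier (coord_space R n)" "w \<in> carrier (coord_space R n)" "\<psi> n v = \<psi> n w"
  show "v = w"
  proof (rule extensionalityI[of _ "{..<n}"])
    fix i assume i: "i \<in> {..<n}"
    then have "\<Phi> (v i) = \<Phi> (w i)" using fun_cong[OF vw(3), of i] by (simp add: \<psi>_def)
    then show "v i = w i"
      using vw(1,2) i by (auto simp: coord_space_simps \<Phi>_eq_iff PiE_iff)
  qed (use vw in \<open>auto simp: coord_space_simps PiE_iff\<close>)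
qed

lemma \<psi>_support: "\<psi> n v \<in> support_functions n"
  by (simp add: \<psi>_def support_functions_def)

lemma \<psi>_add_smult:
  assumes "a \<in> carrier R" "v \<in> carrier (coord_space R n)" "w \<in> carrier (coord_space R n)"
  shows "\<psi> n (a \<odot>\<^bsub>coord_space R n\<^esub> v \<oplus>\<^bsub>coord_space R n\<^esub> w) = (\<lambda>i. \<Phi> a * \<psi> n v i) + \<psi> n w"
proof
  fix i
  show "\<psi> n (a \<odot>\<^bsub>coord_space R n\<^esub> v \<oplus>\<^bsub>coord_space R n\<^esub> w) i = ((\<lambda>i. \<Phi> a * \<psi> n v i) + \<psi> n w) i"
    using assms by (cases "i < n") (auto simp: \<psi>_def coord_space_simps \<Phi>_add \<Phi>_mult PiE_iff)
qed

lemma \<psi>_lincomb: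
  assumes W: "subspace R W (coord_space R n)" and A: "finite A" "A \<subseteq> W" and a: "a \<in> A \<rightarrow> carrier R"
  shows "\<psi> n (module.lincomb (coord_space R n\<lparr>carrier := W\<rparr>) a A) = (\<Sum>v\<in>A. (\<lambda>i. \<Phi> (a v) * \<psi> n v i))"
proof -
  let ?V = "coord_space R n" and ?W = "coord_space R n\<lparr>carrier := W\<rparr>"
  interpret V: vectorspace R ?V by (rule coord_space_vectorspace)
  interpret W: vectorspace R ?W by (rule V.subspace_is_vs[OF W])
  have sub: "W \<subseteq> carrier ?V" using W by (auto simp: subspace_def submodule_def)
  show ?thesis
    unfolding W.lincomb_def using A a
  proof (induction A rule: finite_induct)
    case empty
    show ?case by (auto simp: \<psi>_def coord_space_simps \<Phi>_zero)
  next
    case (insert v A)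
    have v: "v \<in> W" "a v \<in> carrier R" and A: "A \<subseteq> W" "a \<in> A \<rightarrow> carrier R"
      using insert.prems by auto
    have m: "(\<lambda>v. a v \<odot>\<^bsub>?W\<^esub> v) \<in> A \<rightarrow> carrier ?W" "a v \<odot>\<^bsub>?W\<^esub> v \<in> carrier ?W"
      using A v W.smult_closed by auto
    let ?s = "\<Oplus>\<^bsub>?W\<^esub>v\<in>A. a v \<odot>\<^bsub>?W\<^esub> v"
    have s: "?s \<in> W" using W.finsum_closed[OF m(1)] by simp
    have "\<psi> n (\<Oplus>\<^bsub>?W\<^esub>v\<in>insert v A. a v \<odot>\<^bsub>?W\<^esub> v) = \<psi> n (a v \<odot>\<^bsub>?W\<^esub> v \<oplus>\<^bsub>?W\<^esub> ?s)"
      using insert.hyps m by (subst W.finsum_insert) auto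
    also have "\<dots> = (\<lambda>i. \<Phi> (a v) * \<psi> n v i) + \<psi> n ?s"
      using \<psi>_add_smult[of "a v" v n ?s] v s sub by auto
    finally show ?case using insert.IH[OF A] insert.hyps by simp
  qed
qed

text \<open>A basis of the span over the large field that consists of vectors of the subspace is also a
  basis of the subspace: coordinates of vectors over \<open>L\<close> lie in \<open>L\<close> by \<open>coordinates_mem\<close>.\<close>

lemma dim_coord_subspace:
  assumes W: "subspace R W (coord_space R n)"
  shows "vectorspace.dim R (coord_space R n\<lparr>carrier := W\<rparr>) = vec.dim (\<psi> n ` W)"
proof -
  let ?V = "coord_space R n" and ?W = "coord_space R n\<lparr>carrier := W\<rparr>"
  interpret V: vectorspace R ?V by (rule coord_space_vectorspace)
  interpret W: vectorspace R ?W by (rule V.subspace_is_vs[OF W])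
  have sub: "W \<subseteq> carrier ?V" using W by (auto simp: subspace_def submodule_def)
  have inj: "inj_on (\<psi> n) W" using \<psi>_inj sub by (rule inj_on_subset)
  have "\<psi> n ` W \<subseteq> support_functions n" using \<psi>_support by auto
  then obtain C where C: "C \<subseteq> \<psi> n ` W" "finite C" "vec.independent C" "\<psi> n ` W \<subseteq> vec.span C"
      "card C = vec.dim (\<psi> n ` W)"
    by (rule support_functions_basis)
  obtain A where A: "A \<subseteq> W" "C = \<psi> n ` A" using C(1) by (meson subset_imageE)
  have injA: "inj_on (\<psi> n) A" using inj A(1) by (rule inj_on_subset)
  have finA: "finite A" using C(2) injA A(2) by (simp add: finite_image_iff)
  have cardA: "card A = card C" using injA A(2) by (simp add: card_image)
  have indep: "c v = 0" if "(\<Sum>v\<in>A. (\<lambda>i. c v * \<psi> n v i)) = 0" "v \<in> A" for c v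
  proof -
    let ?c = "\<lambda>x. c (inv_into A (\<psi> n) x)"
    have "(\<Sum>x\<in>C. (\<lambda>i. ?c x * x i)) = 0"
      using that(1) unfolding A(2) sum.reindex[OF injA] by (simp add: inv_into_f_f[OF injA] cong: sum.cong)
    then have "?c (\<psi> n v) = 0"
      using vec.independentD[OF C(3) C(2) subset_refl, of ?c "\<psi> n v"] that(2) A(2) by auto
    then show ?thesis using injA that(2) by (simp add: inv_into_f_f)
  qed
  have "W.basis A" unfolding W.basis_def
  proof (intro conjI)
    show "A \<subseteq> carrier ?W" using A by simp
    show "W.lin_indpt A"
    proof
      assume "W.lin_dep A"
      then obtain a v where a: "a \<in> A \<rightarrow> carrier R" "W.lincomb a A = \<zero>\<^bsub>?W\<^esub>" "v \<in> A" "a v \<noteq> \<zero>"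
        using W.finite_lin_dep[OF finA] A(1) by auto
      have "(\<Sum>v\<in>A. (\<lambda>i. \<Phi> (a v) * \<psi> n v i)) = \<psi> n \<zero>\<^bsub>?V\<^esub>"
        using \<psi>_lincomb[OF W finA A(1) a(1)] a(2) by simp
      also have "\<dots> = 0" by (auto simp: \<psi>_def coord_space_simps \<Phi>_zero)
      finally have "\<Phi> (a v) = 0" using indep[of "\<lambda>v. \<Phi> (a v)" v] a(3) by simp
      then show False using a \<Phi>_eq_iff[of "a v" \<zero>] by (auto simp: \<Phi>_zero)
    qed
    show "W.gen_set A"
    proof
      show "W.span A \<subseteq> carrier ?W"
        using A(1) by (intro W.span_is_subset2) simp
      show "carrier ?W \<subseteq> W.span A"
      proof
        fix w assume "w \<in> carrier ?W"
        then have w: "w \<in> W" by simp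
        then have "\<psi> n w \<in> vec.span C" using C(4) by auto
        then obtain r where r: "\<psi> n w = (\<Sum>x\<in>C. (\<lambda>i. r x * x i))"
          using vec.span_finite[OF C(2)] by auto
        then have rA: "\<psi> n w = (\<Sum>v\<in>A. (\<lambda>i. r (\<psi> n v) * \<psi> n v i))"
          unfolding A(2) sum.reindex[OF injA] by simp
        have entries: "\<psi> n v i \<in> L" if "v \<in> W" "i < n" for v i
          using that sub by (auto simp: \<psi>_def coord_space_simps PiE_iff intro: \<Phi>_mem)
        have rL: "r (\<psi> n v) \<in> L" if "v \<in> A" for v
        proof (rule L.coordinates_mem[OF finA, where b = "\<psi> n" and \<mu> = "\<lambda>v. r (\<psi> n v)" and n = n])
          fix c v assume z: "\<And>i. i < n \<Longrightarrow> (\<Sum>v\<in>A. c v * \<psi> n v i) = 0" and v: "v \<in> A"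
          have "(\<Sum>v\<in>A. (\<lambda>i. c v * \<psi> n v i)) i = 0" for i
            using z[of i] by (cases "i < n") (simp_all add: sum_fun_apply \<psi>_def)
          then have "(\<Sum>v\<in>A. (\<lambda>i. c v * \<psi> n v i)) = 0" by (simp add: fun_eq_iff)
          then show "c v = 0" using indep v by blast
        next
          show "\<psi> n w i = (\<Sum>v\<in>A. r (\<psi> n v) * \<psi> n v i)" if "i < n" for i
            using fun_cong[OF rA, of i] by (simp add: sum_fun_apply)
        qed (use entries A(1) w that in auto)
        define a where "a v = inv_into (carrier R) \<Phi> (r (\<psi> n v))" for v
        have a: "a v \<in> carrier R" "\<Phi> (a v) = r (\<psi> n v)" if "v \<in> A" for v
          using rL[OF that] \<Phi>_bij unfolding a_def bij_betw_def
          by (auto intro: inv_into_into f_inv_into_f)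
        have aA: "a \<in> A \<rightarrow> carrier R" using a by auto
        have "\<psi> n (W.lincomb a A) = \<psi> n w"
          unfolding \<psi>_lincomb[OF W finA A(1) aA] rA using a by (intro sum.cong) auto
        moreover have "W.lincomb a A \<in> W" using W.lincomb_closed[of A a] A(1) aA by simp
        ultimately have "w = W.lincomb a A" using inj w by (auto simp: inj_on_def)
        then show "w \<in> W.span A" using finA aA unfolding W.span_def by blast
      qed
    qed
  qed
  then show ?thesis using W.dim_basis[OF finA] cardA C(5) by simp
qed

end

section \<open>The function field of an anisotropic diagonal form\<close>

lemma cring_type_algebra_subset:
  fixes C :: "'m::comm_ring_1 set"
  assumes "0 \<in> C" "1 \<in> C" "\<And>a b. a \<in> C \<Longrightarrow> b \<in> C \<Longrightarrow> a + b \<in> C"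
    "\<And>a b. a \<in> C \<Longrightarrow> b \<in> C \<Longrightarrow> a * b \<in> C" "\<And>a. a \<in> C \<Longrightarrow> - a \<in> C"
  shows "cring (ring_of_type_algebra\<lparr>carrier := C\<rparr>)"
proof (rule cringI)
  show "abelian_group (ring_of_type_algebra\<lparr>carrier := C\<rparr>)"
  proof (rule abelian_groupI)
    fix x assume "x \<in> carrier (ring_of_type_algebra\<lparr>carrier := C\<rparr>)"
    then show "\<exists>y\<in>carrier (ring_of_type_algebra\<lparr>carrier := C\<rparr>).
        y \<oplus>\<^bsub>ring_of_type_algebra\<lparr>carrier := C\<rparr>\<^esub> x = \<zero>\<^bsub>ring_of_type_algebra\<lparr>carrier := C\<rparr>\<^esub>"
      using assms by (intro bexI[of _ "- x"]) (auto simp: ring_of_type_algebra_def)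
  qed (use assms in \<open>auto simp: ring_of_type_algebra_def add_ac\<close>)
  show "Group.comm_monoid (ring_of_type_algebra\<lparr>carrier := C\<rparr>)"
    by (rule comm_monoidI) (use assms in \<open>auto simp: ring_of_type_algebra_def mult_ac\<close>)
qed (auto simp: ring_of_type_algebra_def distrib_right)

context diagonal_form
begin

text \<open>The homogeneous fractions at \<open>\<zeta>\<close>: the field generated over \<open>k\<close> by the ratios of the first \<open>n\<close>
  coordinates of \<open>\<zeta>\<close>. If \<open>\<zeta>\<close> is a generic point, this is the function field.\<close>

definition K0 :: "nat \<Rightarrow> (nat \<Rightarrow> 'a ratfun) \<Rightarrow> 'a ratfun set" where
  "K0 n \<zeta> = {meval \<phi> \<zeta> f / meval \<phi> \<zeta> g | f g d. hom_poly n d f \<and> hom_poly n d g \<and> meval \<phi> \<zeta> g \<noteq> 0}"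

lemma K0_I: "hom_poly n d f \<Longrightarrow> hom_poly n d g \<Longrightarrow> meval \<phi> \<zeta> g \<noteq> 0 \<Longrightarrow> meval \<phi> \<zeta> f / meval \<phi> \<zeta> g \<in> K0 n \<zeta>"
  unfolding K0_def by blast

lemma hom_poly_1 [simp]: "hom_poly n 0 (1 :: 'k mpoly)"
  using multihomogeneous_mconst[of "{{..<n}}" "1::'k"] by simp

lemma K0_const: "\<phi> c \<in> K0 n \<zeta>"
  using K0_I[of n 0 "mconst c" "mconst 1" \<zeta>] by simp

lemma closed_subfield_K0: "closed_subfield (K0 n \<zeta>)"
proof
  show "1 \<in> K0 n \<zeta>" using K0_const[of 1 n \<zeta>] by simp
next
  fix a b assume "a \<in> K0 n \<zeta>" "b \<in> K0 n \<zeta>"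
  then obtain f g d f' g' d' where
    a: "a = meval \<phi> \<zeta> f / meval \<phi> \<zeta> g" "hom_poly n d f" "hom_poly n d g" "meval \<phi> \<zeta> g \<noteq> 0" and
    b: "b = meval \<phi> \<zeta> f' / meval \<phi> \<zeta> g'" "hom_poly n d' f'" "hom_poly n d' g'" "meval \<phi> \<zeta> g' \<noteq> 0"
    unfolding K0_def by blast
  have g: "hom_poly n (d + d') (g * g')" "meval \<phi> \<zeta> (g * g') \<noteq> 0"
    using a b by (auto intro: hom_poly_mult simp: \<phi>.meval_mult)
  have "hom_poly n (d + d') (f * g' + g * f')"
    using a b by (intro multihomogeneous_add hom_poly_mult)
  from K0_I[OF this g] show "a + b \<in> K0 n \<zeta>"
    using a b by (simp add: \<phi>.meval_add \<phi>.meval_mult add_divide_distrib)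
  have "hom_poly n (d + d') (f * f')"
    using a b by (intro hom_poly_mult)
  from K0_I[OF this g] show "a * b \<in> K0 n \<zeta>"
    using a b by (simp add: \<phi>.meval_mult)
next
  fix a assume a: "a \<in> K0 n \<zeta>"
  then show "- a \<in> K0 n \<zeta>" by (simp add: c2r.uminus_eq)
  obtain f g d where
    f: "a = meval \<phi> \<zeta> f / meval \<phi> \<zeta> g" "hom_poly n d f" "hom_poly n d g" "meval \<phi> \<zeta> g \<noteq> 0"
    using a unfolding K0_def by blast
  show "inverse a \<in> K0 n \<zeta>"
  proof (cases "meval \<phi> \<zeta> f = 0")
    case True
    then show ?thesis using K0_const[of 0 n \<zeta>] f by simp
  next
    case False
    then show ?thesis using K0_I[OF f(3,2) False] f(1) by (simp add: inverse_eq_divide)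
  qed
qed

lemma hom_poly_q: "hom_poly N 2 q"
  unfolding q_def
proof (intro multihomogeneous_sum multihomogeneous_mconst_mult)
  fix i assume "i \<in> {..<N}"
  then show "hom_poly N 2 ((mvar i :: 'k mpoly)\<^sup>2)" using hom_poly_power[OF hom_poly_mvar[where 'k = 'k], of i N 2] by simp
qed

lemma mvars_q: "mvars q \<subseteq> {..<N}"
  using multihomogeneous_mvars[OF hom_poly_q] by simp

lemma hom_poly_mvars: "hom_poly n d f \<Longrightarrow> mvars f \<subseteq> {..<n}"
  using multihomogeneous_mvars[of "{{..<n}}"] by auto

lemma multihomogeneous_hom_poly: "multihomogeneous {{..<n}} d f \<longleftrightarrow> hom_poly n (d {..<n}) f"
  by (rule multihomogeneous_cong) auto

text \<open>Evaluation at a generic point is defined on the local ring and has the maximal ideal as its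
  kernel, so it identifies the residue field with the field of homogeneous fractions at that
  point.\<close>

lemma function_field_embedding:
  assumes gen: "generic {..<N} \<zeta>"
  obtains \<Phi> where "embedded_field (function_field {{..<N}} q) (K0 N \<zeta>) \<Phi>"
    "\<And>c. to_function_field {{..<N}} q c \<in> carrier (function_field {{..<N}} q)"
    "\<And>c. \<Phi> (to_function_field {{..<N}} q c) = \<phi> c"
proof -
  let ?ev = "meval \<phi> \<zeta>"
  define C where "C = {Fract f g | f g d. hom_poly N d f \<and> hom_poly N d g \<and> \<not> q dvd g}"
  define I where "I = {Fract f g | f g d. hom_poly N d f \<and> hom_poly N d g \<and> \<not> q dvd g \<and> q dvd f}"
  define A where "A = (ring_of_type_algebra :: 'k mpoly fract ring)\<lparr>carrier := C\<rparr>"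
  define S where "S = (ring_of_type_algebra :: 'a ratfun ring)\<lparr>carrier := K0 N \<zeta>\<rparr>"
  have dvd: "q dvd f \<longleftrightarrow> ?ev f = 0" if "hom_poly N d f" for f d
    using gen hom_poly_mvars[OF that] by (auto simp: generic_def)
  have mh: "(\<exists>d. multihomogeneous {{..<N}} d f \<and> multihomogeneous {{..<N}} d g) \<longleftrightarrow>
      (\<exists>d. hom_poly N d f \<and> hom_poly N d g)" for f g :: "'k mpoly"
    using multihomogeneous_hom_poly[of N _ f, THEN iffD1] multihomogeneous_hom_poly[of N _ g, THEN iffD1]
    by blast
  have "{Fract f g | f g d. multihomogeneous {{..<N}} d f \<and> multihomogeneous {{..<N}} d g \<and> \<not> q dvd g} = C"
    unfolding C_def using mh by blast
  then have A: "generic_local_ring {{..<N}} q = A"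
    by (simp add: generic_local_ring_def A_def)
  have I: "generic_max_ideal {{..<N}} q = I"
    unfolding generic_max_ideal_def I_def using mh by blast
  \<comment> \<open>The value of a fraction at \<open>\<zeta>\<close>; it does not depend on the chosen representation.\<close>
  define h where "h x = (SOME y. \<exists>f g d. hom_poly N d f \<and> hom_poly N d g \<and> \<not> q dvd g \<and>
      x = Fract f g \<and> y = ?ev f / ?ev g)" for x
  have q0: "g \<noteq> 0" if "\<not> q dvd g" for g using that by auto
  have h: "h (Fract f g) = ?ev f / ?ev g" if fg: "hom_poly N d f" "hom_poly N d g" "\<not> q dvd g" for f g d
  proof -
    have "\<exists>y f' g' d. hom_poly N d f' \<and> hom_poly N d g' \<and> \<not> q dvd g' \<and>
        Fract f g = Fract f' g' \<and> y = ?ev f' / ?ev g'"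
      by (intro exI conjI) (use fg in auto)
    then have "\<exists>f' g' d. hom_poly N d f' \<and> hom_poly N d g' \<and> \<not> q dvd g' \<and>
        Fract f g = Fract f' g' \<and> h (Fract f g) = ?ev f' / ?ev g'"
      unfolding h_def by (rule someI_ex)
    then obtain f' g' d' where fg': "hom_poly N d' f'" "hom_poly N d' g'" "\<not> q dvd g'"
        "Fract f g = Fract f' g'" "h (Fract f g) = ?ev f' / ?ev g'"
      by blast
    have "f * g' = f' * g" using fg'(4) q0[OF fg(3)] q0[OF fg'(3)] by (simp add: eq_fract)
    then have "?ev f * ?ev g' = ?ev f' * ?ev g" by (metis \<phi>.meval_mult)
    moreover have "?ev g \<noteq> 0" using dvd[OF fg(2)] fg(3) by simp
    moreover have "?ev g' \<noteq> 0" using dvd[OF fg'(2)] fg'(3) by simp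
    ultimately show ?thesis using fg'(5) by (simp add: frac_eq_eq)
  qed
  have CE: "\<exists>f g d. x = Fract f g \<and> hom_poly N d f \<and> hom_poly N d g \<and> \<not> q dvd g \<and> g \<noteq> 0 \<and> ?ev g \<noteq> 0 \<and>
      h x = ?ev f / ?ev g" if x: "x \<in> C" for x
  proof -
    obtain f g d where *: "x = Fract f g" "hom_poly N d f" "hom_poly N d g" "\<not> q dvd g"
      using x unfolding C_def by blast
    then show ?thesis using h[OF *(2-4)] q0[OF *(4)] dvd[OF *(3)] by blast
  qed
  have CI: "Fract f g \<in> C" if "hom_poly N d f" "hom_poly N d g" "?ev g \<noteq> 0" for f g d
    using that dvd[OF that(2)] unfolding C_def by blast
  have hI: "h (Fract f g) = ?ev f / ?ev g" if "hom_poly N d f" "hom_poly N d g" "?ev g \<noteq> 0" for f g d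
    using h[OF that(1,2)] that dvd[OF that(2)] by blast
  interpret p: char_two "TYPE('k mpoly)" by (rule char_two_mpoly[OF char2])
  interpret p: char_two "TYPE('k mpoly fract)" by (rule char_two_fract[OF p.two_eq_0])
  have const: "Fract (mconst c) 1 \<in> C" "h (Fract (mconst c) 1) = \<phi> c" for c
    using CI[of 0 "mconst c" "mconst 1"] hI[of 0 "mconst c" "mconst 1"] by simp_all
  have add: "x + y \<in> C \<and> h (x + y) = h x + h y" and mult: "x * y \<in> C \<and> h (x * y) = h x * h y"
    if xy: "x \<in> C" "y \<in> C" for x y
  proof -
    obtain f g d where x: "x = Fract f g" "hom_poly N d f" "hom_poly N d g" "g \<noteq> 0" "?ev g \<noteq> 0" "h x = ?ev f / ?ev g"
      using CE[OF xy(1)] by blast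
    obtain f' g' d' where y: "y = Fract f' g'" "hom_poly N d' f'" "hom_poly N d' g'" "g' \<noteq> 0" "?ev g' \<noteq> 0" "h y = ?ev f' / ?ev g'"
      using CE[OF xy(2)] by blast
    have g: "hom_poly N (d + d') (g * g')" "?ev (g * g') \<noteq> 0"
      using x y by (auto intro: hom_poly_mult simp: \<phi>.meval_mult)
    have s: "hom_poly N (d + d') (f * g' + f' * g)"
      using hom_poly_mult[OF x(2) y(3)] hom_poly_mult[OF y(2) x(3)]
      by (intro multihomogeneous_add) (simp_all add: add.commute)
    have m: "hom_poly N (d + d') (f * f')" using x y by (intro hom_poly_mult)
    show "x + y \<in> C \<and> h (x + y) = h x + h y"
      using CI[OF s g] hI[OF s g] x y by (simp add: \<phi>.meval_add \<phi>.meval_mult add_divide_distrib)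
    show "x * y \<in> C \<and> h (x * y) = h x * h y"
      using CI[OF m g] hI[OF m g] x y by (simp add: \<phi>.meval_mult)
  qed
  have zero: "0 \<in> C" "h 0 = 0" and one: "1 \<in> C" "h 1 = 1"
    using const[of 0] const[of 1] by (simp_all add: Zero_fract_def One_fract_def)
  have crA: "cring A" unfolding A_def
    by (rule cring_type_algebra_subset) (use zero one add mult in \<open>auto simp: p.uminus_eq\<close>)
  interpret L: closed_subfield "K0 N \<zeta>" by (rule closed_subfield_K0)
  have crS: "cring S" unfolding S_def
    by (rule cring_type_algebra_subset) auto
  have hK: "h x \<in> K0 N \<zeta>" if "x \<in> C" for x
    using CE[OF that] K0_I by metis
  have img: "h ` C = K0 N \<zeta>"
  proof
    show "h ` C \<subseteq> K0 N \<zeta>" using hK by blast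
    show "K0 N \<zeta> \<subseteq> h ` C"
    proof
      fix y assume "y \<in> K0 N \<zeta>"
      then obtain f g d where *: "y = ?ev f / ?ev g" "hom_poly N d f" "hom_poly N d g" "?ev g \<noteq> 0"
        unfolding K0_def by blast
      then show "y \<in> h ` C" using CI[OF *(2-4)] hI[OF *(2-4)] by (metis imageI)
    qed
  qed
  have hom: "h \<in> ring_hom A S"
    by (rule ring_hom_memI) (use add mult one hK in \<open>auto simp: A_def S_def ring_of_type_algebra_def\<close>)
  interpret h: ring_hom_ring A S h
    using crA crS hom by (intro ring_hom_ringI2) (auto simp: cring_def)
  have ker: "a_kernel A S h = I"
  proof -
    have "carrier A = C" by (simp add: A_def)
    moreover have "\<zero>\<^bsub>S\<^esub> = 0" by (simp add: S_def ring_of_type_algebra_def)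
    ultimately have "a_kernel A S h = {x \<in> C. h x = 0}"
      unfolding a_kernel_def' by (simp only:)
    also have "\<dots> = I"
    proof
      show "{x \<in> C. h x = 0} \<subseteq> I"
      proof
        fix x assume "x \<in> {x \<in> C. h x = 0}"
        then obtain f g d where *: "x = Fract f g" "hom_poly N d f" "hom_poly N d g" "\<not> q dvd g"
            "?ev g \<noteq> 0" "h x = ?ev f / ?ev g" "h x = 0"
          using CE by blast
        have "?ev f = 0" using *(5-7) by simp
        then have "q dvd f" using dvd[OF *(2)] by simp
        then show "x \<in> I" unfolding I_def using *(1-4) by (intro CollectI exI conjI)
      qed
      show "I \<subseteq> {x \<in> C. h x = 0}"
      proof
        fix x assume "x \<in> I"
        then obtain f g d where *: "x = Fract f g" "hom_poly N d f" "hom_poly N d g" "\<not> q dvd g" "q dvd f"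
          unfolding I_def by blast
        have "x \<in> C" unfolding C_def using *(1-4) by (intro CollectI exI conjI)
        moreover have "h x = 0"
          unfolding *(1) h[OF *(2-4)] using dvd[OF *(2)] *(5) by simp
        ultimately show "x \<in> {x \<in> C. h x = 0}" by simp
      qed
    qed
    finally show ?thesis .
  qed
  define FF where "FF = function_field {{..<N}} q"
  have FF: "FF = A Quot (a_kernel A S h)"
    by (simp add: FF_def function_field_def A I ker)
  define \<Phi> where "\<Phi> Z = the_elem (h ` Z)" for Z
  have \<Phi>hom: "\<Phi> \<in> ring_hom FF S"
    unfolding FF \<Phi>_def[abs_def] by (rule h.the_elem_hom)
  have \<Phi>inj: "inj_on \<Phi> (carrier FF)"
    unfolding FF \<Phi>_def by (intro inj_onI h.the_elem_inj)
  have \<Phi>surj: "\<Phi> ` carrier FF = K0 N \<zeta>"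
    unfolding FF \<Phi>_def using h.the_elem_surj img by (simp add: A_def)
  interpret FF: cring FF
    unfolding FF using ideal.quotient_is_cring[OF h.kernel_is_ideal crA] .
  have hom_simps: "\<Phi> (x \<otimes>\<^bsub>FF\<^esub> y) = \<Phi> x * \<Phi> y" "\<Phi> (x \<oplus>\<^bsub>FF\<^esub> y) = \<Phi> x + \<Phi> y"
    if "x \<in> carrier FF" "y \<in> carrier FF" for x y
    using ring_hom_mult[OF \<Phi>hom that] ring_hom_add[OF \<Phi>hom that]
    by (simp_all add: S_def ring_of_type_algebra_def)
  have \<Phi>1: "\<Phi> \<one>\<^bsub>FF\<^esub> = 1"
    using ring_hom_one[OF \<Phi>hom] by (simp add: S_def ring_of_type_algebra_def)
  have \<Phi>0: "\<Phi> \<zero>\<^bsub>FF\<^esub> = 0"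
    using hom_simps(2)[of "\<zero>\<^bsub>FF\<^esub>" "\<zero>\<^bsub>FF\<^esub>"] by (metis FF.l_zero FF.zero_closed add_cancel_left_left)
  have fieldFF: "field FF"
  proof (rule FF.cring_fieldI2)
    show "\<zero>\<^bsub>FF\<^esub> \<noteq> \<one>\<^bsub>FF\<^esub>" using \<Phi>0 \<Phi>1 by auto
    fix x assume x: "x \<in> carrier FF" "x \<noteq> \<zero>\<^bsub>FF\<^esub>"
    have n: "\<Phi> x \<noteq> 0"
      using x \<Phi>0 inj_onD[OF \<Phi>inj, of x "\<zero>\<^bsub>FF\<^esub>"] by auto
    have "inverse (\<Phi> x) \<in> \<Phi> ` carrier FF" using \<Phi>surj x by auto
    then obtain y where y: "y \<in> carrier FF" "\<Phi> y = inverse (\<Phi> x)" by (metis imageE)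
    then have "\<Phi> (x \<otimes>\<^bsub>FF\<^esub> y) = \<Phi> \<one>\<^bsub>FF\<^esub>" using hom_simps x n \<Phi>1 by simp
    then have "x \<otimes>\<^bsub>FF\<^esub> y = \<one>\<^bsub>FF\<^esub>" using inj_onD[OF \<Phi>inj] x y by auto
    then show "\<exists>b\<in>carrier FF. x \<otimes>\<^bsub>FF\<^esub> b = \<one>\<^bsub>FF\<^esub>" using y by blast
  qed
  have emb: "embedded_field FF (K0 N \<zeta>) \<Phi>"
    using fieldFF L.closed_subfield_axioms hom_simps \<Phi>1 \<Phi>inj \<Phi>surj
    by (intro embedded_field.intro embedded_field_axioms.intro) (auto simp: bij_betw_def)
  have coset: "to_function_field {{..<N}} q c = a_kernel A S h +>\<^bsub>A\<^esub> Fract (mconst c) 1" for c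
    by (simp add: to_function_field_def A I ker)
  have cA: "Fract (mconst c) 1 \<in> carrier A" for c using const(1) by (simp add: A_def)
  have "to_function_field {{..<N}} q c \<in> carrier FF" for c
    unfolding coset FF FactRing_def using cA
    by (auto simp: A_RCOSETS_def' )
  moreover have "\<Phi> (to_function_field {{..<N}} q c) = \<phi> c" for c
    unfolding coset \<Phi>_def h.the_elem_simp[OF cA] by (rule const(2))
  ultimately show ?thesis using that emb unfolding FF_def by blast
qed

lemma zeros_support: "zeros L \<subseteq> support_functions N"
  by (auto simp: zeros_def support_functions_def)

text \<open>The form is totally singular, so all its zeros form one subspace, which is the largest subspace
  on which \<open>q\<close> vanishes.\<close>

lemma first_witt_index_eq_dim_zeros:
  assumes gen: "generic {..<N} \<zeta>"
  shows "first_witt_index N q = vec.dim (zeros (K0 N \<zeta>))"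
proof -
  define FF where "FF = function_field {{..<N}} q"
  define tf where "tf = to_function_field {{..<N}} q"
  obtain \<Phi> where emb: "embedded_field FF (K0 N \<zeta>) \<Phi>" and tf: "\<And>c. tf c \<in> carrier FF" "\<And>c. \<Phi> (tf c) = \<phi> c"
    using function_field_embedding[OF gen] unfolding FF_def tf_def by metis
  interpret E: embedded_field FF "K0 N \<zeta>" \<Phi> by (rule emb)
  let ?V = "coord_space FF N"
  interpret V: vectorspace FF ?V by (rule E.coord_space_vectorspace)
  define \<psi> where "\<psi> = E.\<psi> N"
  have zero_iff: "ring_meval FF tf w q = \<zero>\<^bsub>FF\<^esub> \<longleftrightarrow> \<psi> w \<in> zeros (K0 N \<zeta>)" if w: "w \<in> carrier ?V" for w
  proof -
    have wi: "w i \<in> carrier FF" if "i < N" for i using w that by (auto simp: coord_space_simps)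
    have "ring_meval FF tf w q \<in> carrier FF"
      unfolding ring_meval_def using tf(1) wi mvars_q
      by (intro E.finsum_closed Pi_I E.m_closed E.finprod_closed E.nat_pow_closed) (auto simp: mvars_def)
    then have "ring_meval FF tf w q = \<zero>\<^bsub>FF\<^esub> \<longleftrightarrow> \<Phi> (ring_meval FF tf w q) = 0"
      using E.\<Phi>_eq_iff[of "ring_meval FF tf w q" "\<zero>\<^bsub>FF\<^esub>"] by (simp add: E.\<Phi>_zero)
    also have "\<Phi> (ring_meval FF tf w q) = meval (\<lambda>c. \<Phi> (tf c)) (\<lambda>i. \<Phi> (w i)) q"
      using tf(1) wi mvars_q by (intro E.\<Phi>_ring_meval) auto
    also have "\<dots> = (\<Sum>i<N. \<phi>' (\<alpha> i) * \<Phi> (w i))\<^sup>2"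
      by (simp add: tf(2) meval_q)
    also have "\<dots> = 0 \<longleftrightarrow> \<psi> w \<in> zeros (K0 N \<zeta>)"
      using wi by (auto simp: zeros_def \<psi>_def E.\<psi>_def E.\<Phi>_mem)
    finally show ?thesis .
  qed
  define W0 where "W0 = {w \<in> carrier ?V. ring_meval FF tf w q = \<zero>\<^bsub>FF\<^esub>}"
  have W0: "W0 = {w \<in> carrier ?V. \<psi> w \<in> zeros (K0 N \<zeta>)}"
    using zero_iff by (auto simp: W0_def)
  have zeros_lin: "(\<lambda>i. c * v i) + w \<in> zeros (K0 N \<zeta>)"
    if "c \<in> K0 N \<zeta>" "v \<in> zeros (K0 N \<zeta>)" "w \<in> zeros (K0 N \<zeta>)" for c v w
  proof -
    have "(\<Sum>i<N. \<phi>' (\<alpha> i) * (c * v i + w i)) = c * (\<Sum>i<N. \<phi>' (\<alpha> i) * v i) + (\<Sum>i<N. \<phi>' (\<alpha> i) * w i)"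
      by (simp add: distrib_left sum.distrib sum_distrib_left mult_ac)
    then show ?thesis using that by (auto simp: zeros_def)
  qed
  have \<psi>0: "\<psi> \<zero>\<^bsub>?V\<^esub> = 0" by (auto simp: \<psi>_def E.\<psi>_def coord_space_simps E.\<Phi>_zero)
  have z0: "0 \<in> zeros (K0 N \<zeta>)" by (auto simp: zeros_def)
  have subW0: "subspace FF W0 ?V"
  proof (intro subspace.intro submodule.intro)
    show "vectorspace FF ?V" by (rule V.vectorspace_axioms)
    show "module FF ?V" by (rule V.module_axioms)
    show "W0 \<subseteq> carrier ?V" by (auto simp: W0_def)
    show "\<zero>\<^bsub>?V\<^esub> \<in> W0" using \<psi>0 z0 by (simp add: W0)
    fix v w assume v: "v \<in> W0" and w: "w \<in> W0"
    have "\<psi> (v \<oplus>\<^bsub>?V\<^esub> w) = (\<lambda>i. 1 * \<psi> v i) + \<psi> w"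
      using E.\<psi>_add_smult[of "\<one>\<^bsub>FF\<^esub>" v N w] v w by (simp add: W0_def \<psi>_def E.\<Phi>_one)
    then show "v \<oplus>\<^bsub>?V\<^esub> w \<in> W0"
      using zeros_lin[of 1 "\<psi> v" "\<psi> w"] v w unfolding W0 by auto
  next
    fix c v assume c: "c \<in> carrier FF" and v: "v \<in> W0"
    have vc: "v \<in> carrier ?V" using v by (simp add: W0_def)
    have "\<psi> (c \<odot>\<^bsub>?V\<^esub> v) = \<psi> (c \<odot>\<^bsub>?V\<^esub> v \<oplus>\<^bsub>?V\<^esub> \<zero>\<^bsub>?V\<^esub>)"
      using V.smult_closed[OF c vc] by simp
    also have "\<dots> = (\<lambda>i. \<Phi> c * \<psi> v i) + 0"
      using E.\<psi>_add_smult[OF c vc, of "\<zero>\<^bsub>?V\<^esub>"] \<psi>0 by (simp add: \<psi>_def)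
    finally show "c \<odot>\<^bsub>?V\<^esub> v \<in> W0"
      using zeros_lin[of "\<Phi> c" "\<psi> v" 0] v z0 E.\<Phi>_mem[OF c] V.smult_closed[OF c vc] unfolding W0 by auto
  qed
  have img: "\<psi> ` W0 = zeros (K0 N \<zeta>)"
  proof
    show "\<psi> ` W0 \<subseteq> zeros (K0 N \<zeta>)" by (auto simp: W0)
    show "zeros (K0 N \<zeta>) \<subseteq> \<psi> ` W0"
    proof
      fix u assume u: "u \<in> zeros (K0 N \<zeta>)"
      then have "\<exists>b\<in>carrier FF. \<Phi> b = u i" if "i < N" for i
        using E.\<Phi>_surj that by (auto simp: zeros_def)
      then obtain b where b: "\<And>i. i < N \<Longrightarrow> b i \<in> carrier FF \<and> \<Phi> (b i) = u i" by metis
      have "restrict b {..<N} \<in> carrier ?V" using b by (auto simp: coord_space_simps)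
      moreover have "\<psi> (restrict b {..<N}) = u"
        using b u by (auto simp: \<psi>_def E.\<psi>_def zeros_def fun_eq_iff)
      ultimately show "u \<in> \<psi> ` W0" using u unfolding W0 by force
    qed
  qed
  let ?D = "{vectorspace.dim FF (?V\<lparr>carrier := W\<rparr>) | W. subspace FF W ?V \<and> (\<forall>w\<in>W. ring_meval FF tf w q = \<zero>\<^bsub>FF\<^esub>)}"
  have le: "d \<le> vec.dim (zeros (K0 N \<zeta>))" if d: "d \<in> ?D" for d
  proof -
    obtain W where W: "d = vectorspace.dim FF (?V\<lparr>carrier := W\<rparr>)" "subspace FF W ?V"
      "\<forall>w\<in>W. ring_meval FF tf w q = \<zero>\<^bsub>FF\<^esub>" using d by blast
    have "W \<subseteq> W0" using W(2,3) by (auto simp: W0_def subspace_def submodule_def)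
    then have sub: "\<psi> ` W \<subseteq> zeros (K0 N \<zeta>)" using img by auto
    have "vec.dim (\<psi> ` W) \<le> vec.dim (zeros (K0 N \<zeta>))"
      using sub zeros_support vec.span_superset by (intro vec_dim_mono[of _ _ N]) blast+
    then show ?thesis using E.dim_coord_subspace[OF W(2)] W(1) by (simp add: \<psi>_def)
  qed
  have mem: "vec.dim (zeros (K0 N \<zeta>)) \<in> ?D"
    using subW0 E.dim_coord_subspace[OF subW0] img
    by (intro CollectI exI[of _ W0]) (auto simp: W0_def \<psi>_def)
  have "finite ?D" using le by (meson finite_nat_set_iff_bounded_le)
  then have "Max ?D = vec.dim (zeros (K0 N \<zeta>))" using le mem by (intro Max_eqI)
  then show ?thesis unfolding first_witt_index_def total_index_def FF_def tf_def .
qed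

end

section \<open>Subforms\<close>

context diagonal_form
begin

lemma K0_cong:
  assumes "\<And>i. i < n \<Longrightarrow> x i = y i"
  shows "K0 n x = K0 n y"
proof -
  have "meval \<phi> x f = meval \<phi> y f" if "hom_poly n d f" for f d
    using hom_poly_mvars[OF that] assms by (intro meval_cong) auto
  then show ?thesis unfolding K0_def by (metis (no_types, lifting))
qed

text \<open>Fractions of degree zero only depend on the point in projective space.\<close>

lemma K0_scale:
  assumes t: "t \<noteq> 0"
  shows "K0 n (\<lambda>i. t * x i) = K0 n x"
proof -
  have *: "meval \<phi> (\<lambda>i. t * x i) f / meval \<phi> (\<lambda>i. t * x i) g = meval \<phi> x f / meval \<phi> x g \<and>
      (meval \<phi> (\<lambda>i. t * x i) g \<noteq> 0 \<longleftrightarrow> meval \<phi> x g \<noteq> 0)"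
    if "hom_poly n d f" "hom_poly n d g" for f g d
    using t by (simp add: meval_hom_poly_scale[OF that(1)] meval_hom_poly_scale[OF that(2)])
  show ?thesis
  proof (intro equalityI subsetI)
    fix y assume "y \<in> K0 n (\<lambda>i. t * x i)"
    then show "y \<in> K0 n x" unfolding K0_def using * by blast
  next
    fix y assume "y \<in> K0 n x"
    then obtain f g d where y: "y = meval \<phi> x f / meval \<phi> x g" "hom_poly n d f" "hom_poly n d g" "meval \<phi> x g \<noteq> 0"
      unfolding K0_def by blast
    then show "y \<in> K0 n (\<lambda>i. t * x i)"
      using K0_I[OF y(2,3), of "\<lambda>i. t * x i"] *[OF y(2,3)] by simp
  qed
qed

lemma K0_subset:
  assumes Z: "\<And>j. j < \<mu> \<Longrightarrow> hom_poly n d (Z j)"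
  shows "K0 \<mu> (\<lambda>j. meval \<phi> x (Z j)) \<subseteq> K0 n x"
proof
  fix y assume "y \<in> K0 \<mu> (\<lambda>j. meval \<phi> x (Z j))"
  then obtain f g e where y: "y = meval \<phi> (\<lambda>j. meval \<phi> x (Z j)) f / meval \<phi> (\<lambda>j. meval \<phi> x (Z j)) g"
    "hom_poly \<mu> e f" "hom_poly \<mu> e g" "meval \<phi> (\<lambda>j. meval \<phi> x (Z j)) g \<noteq> 0"
    unfolding K0_def by blast
  have ev: "meval \<phi> x (msubst Z f) = meval \<phi> (\<lambda>j. meval \<phi> x (Z j)) f" for f
    by (rule \<phi>.meval_msubst[OF \<phi>.coefficient_hom_axioms])
  have "hom_poly n (e * d) (msubst Z f)" "hom_poly n (e * d) (msubst Z g)"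
    using y Z by (auto intro: hom_poly_msubst)
  from K0_I[OF this, of x] show "y \<in> K0 n x" using y by (simp add: ev)
qed

lemma K0_common_denominator:
  assumes "finite A" "\<And>j. j \<in> A \<Longrightarrow> y j \<in> K0 n x"
  shows "\<exists>f g d. hom_poly n d g \<and> meval \<phi> x g \<noteq> 0 \<and>
      (\<forall>j\<in>A. hom_poly n d (f j) \<and> y j = meval \<phi> x (f j) / meval \<phi> x g)"
  using assms
proof (induction A rule: finite_induct)
  case empty
  show ?case by (intro exI[of _ "\<lambda>_. 0"] exI[of _ 1] exI[of _ 0]) simp
next
  case (insert a A)
  then obtain f g d where g: "hom_poly n d g" "meval \<phi> x g \<noteq> 0"
    and f: "\<And>j. j \<in> A \<Longrightarrow> hom_poly n d (f j)" "\<And>j. j \<in> A \<Longrightarrow> y j = meval \<phi> x (f j) / meval \<phi> x g"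
    by blast
  obtain f' g' d' where a: "y a = meval \<phi> x f' / meval \<phi> x g'" "hom_poly n d' f'" "hom_poly n d' g'" "meval \<phi> x g' \<noteq> 0"
    using insert.prems[of a] unfolding K0_def by blast
  define h where "h j = (if j = a then g * f' else f j * g')" for j
  have "hom_poly n (d + d') (h j) \<and> y j = meval \<phi> x (h j) / meval \<phi> x (g * g')" if "j \<in> insert a A" for j
  proof (cases "j = a")
    case True
    then show ?thesis using g a by (simp add: h_def hom_poly_mult \<phi>.meval_mult)
  next
    case False
    then show ?thesis using g a f[of j] that by (simp add: h_def hom_poly_mult \<phi>.meval_mult)
  qed
  moreover have "hom_poly n (d + d') (g * g')" using g a by (intro hom_poly_mult)
  moreover have "meval \<phi> x (g * g') \<noteq> 0" using g a by (simp add: \<phi>.meval_mult)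
  ultimately show ?case by blast
qed

lemma closed_subfield_range_\<phi>: "closed_subfield (range \<phi>)"
proof
  fix a assume "a \<in> range \<phi>"
  then obtain c where c: "a = \<phi> c" by blast
  show "- a \<in> range \<phi>" using c by (metis \<phi>.hom_uminus rangeI)
  show "inverse a \<in> range \<phi>"
  proof (cases "c = 0")
    case True
    then show ?thesis using c by (metis \<phi>.hom_0 inverse_zero rangeI)
  next
    case False
    then have "\<phi> c * \<phi> (inverse c) = 1" by (simp flip: \<phi>.hom_mult)
    then have "inverse a = \<phi> (inverse c)" unfolding c by (rule inverse_unique)
    then show ?thesis by simp
  qed
qed (auto simp flip: \<phi>.hom_add \<phi>.hom_mult intro: image_eqI[of _ _ 1])

text \<open>The variable \<open>x\<^sub>0\<close>, which does not occur in the generic point \<open>\<xi>\<close> below. It serves as an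
  independent scale for homogeneous coordinates.\<close>

definition \<tau> :: "'a ratfun" where "\<tau> = Fract (mvar 0) 1"

text \<open>The generic point of the quadric: the coordinate \<open>\<xi> 0\<close> solves \<open>\<Sum>i \<alpha>\<^sub>i \<xi>\<^sub>i = 0\<close>.\<close>

definition \<xi> :: "nat \<Rightarrow> 'a ratfun" where
  "\<xi> i = (if i = 0 then \<Sum>j\<in>{1..<N}. \<phi>' (\<alpha> j / \<alpha> 0) * Fract (mvar j) 1 else Fract (mvar i) 1)"

lemma Fract_mvar_ne_0: "Fract (mvar i :: 'a mpoly) 1 \<noteq> 0"
  by (simp add: Zero_fract_def eq_fract)

lemma \<phi>'_divide: "d \<noteq> 0 \<Longrightarrow> \<phi>' d * \<phi>' (c / d) = \<phi>' c"
  by (simp flip: \<phi>'.hom_mult)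

lemma \<xi>_relation: "(\<Sum>i<N. \<phi>' (\<alpha> i) * \<xi> i) = 0"
proof -
  have N0: "{..<N} = insert 0 {1..<N}" using N by auto
  have a0: "\<alpha> 0 \<noteq> 0" using \<alpha>_ne_0 N by simp
  have "(\<Sum>i<N. \<phi>' (\<alpha> i) * \<xi> i) = \<phi>' (\<alpha> 0) * \<xi> 0 + (\<Sum>i\<in>{1..<N}. \<phi>' (\<alpha> i) * \<xi> i)"
    unfolding N0 by (subst sum.insert) auto
  also have "\<phi>' (\<alpha> 0) * \<xi> 0 = (\<Sum>i\<in>{1..<N}. \<phi>' (\<alpha> i) * \<xi> i)"
    using a0 by (simp add: \<xi>_def sum_distrib_left \<phi>'_divide flip: mult.assoc)
  finally show ?thesis by (simp add: c2r.add_self)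
qed

lemma generic'_\<xi>: "generic' UNIV \<xi>"
proof (rule generic'_if_algebraically_independent)
  fix F :: "'a mpoly" assume F: "mvars F \<subseteq> UNIV - {0}" "meval \<phi>' \<xi> F = 0"
  have "meval \<phi>' \<xi> F = meval \<phi>' (\<lambda>i. Fract (mvar i) 1) F"
    using F(1) by (intro meval_cong) (auto simp: \<xi>_def)
  also have "\<dots> = Fract F 1" using meval_Fract[of F] by (simp add: \<phi>'_def[abs_def])
  finally show "F = 0" using F(2) by (simp add: Zero_fract_def eq_fract)
qed (use \<xi>_relation in auto)

lemma generic_\<xi>: "generic I \<xi>"
  using generic'_imp_generic[OF generic'_\<xi>] by (auto simp: generic_def)

lemma \<xi>_1: "\<xi> 1 \<noteq> 0"
  by (simp add: \<xi>_def Fract_mvar_ne_0)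

text \<open>The same point, normalised such that its coordinates lie in the function field.\<close>

definition \<xi>' :: "nat \<Rightarrow> 'a ratfun" where
  "\<xi>' i = (if i < N then \<xi> i / \<xi> 1 else 0)"

lemma \<xi>'_zeros: "\<xi>' \<in> zeros (K0 N \<xi>)"
proof -
  have "\<xi> i / \<xi> 1 \<in> K0 N \<xi>" if "i < N" for i
    using K0_I[OF hom_poly_mvar[OF that] hom_poly_mvar[of 1 N], of \<xi>] N \<xi>_1 by simp
  moreover have "(\<Sum>i<N. \<phi>' (\<alpha> i) * \<xi>' i) = (\<Sum>i<N. \<phi>' (\<alpha> i) * \<xi> i) / \<xi> 1"
    by (simp add: \<xi>'_def sum_divide_distrib)
  ultimately show ?thesis using \<xi>_relation by (simp add: zeros_def \<xi>'_def)
qed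

lemma zeros_subset_span:
  assumes L: "closed_subfield L" "\<And>c. \<phi> c \<in> L"
    and Z: "(\<Sum>i<N. \<phi>' (\<alpha> i) * meval \<phi> \<xi> (Z i)) = 0" "i\<^sub>0 < N" "meval \<phi> \<xi> (Z i\<^sub>0) \<noteq> 0"
    and w: "w \<noteq> 0" "\<And>i. i < N \<Longrightarrow> meval \<phi> \<xi> (Z i) / w \<in> L"
  shows "zeros (K0 N \<xi>) \<subseteq> vec.span (zeros L)"
proof
  fix v assume v: "v \<in> zeros (K0 N \<xi>)"
  then obtain V g d where g: "meval \<phi> \<xi> g \<noteq> 0" and V: "\<And>i. i < N \<Longrightarrow> v i = meval \<phi> \<xi> (V i) / meval \<phi> \<xi> g"
    using K0_common_denominator[of "{..<N}" v N \<xi>] by (auto simp: zeros_def)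
  have "(\<Sum>i<N. \<phi>' (\<alpha> i) * v i) = (\<Sum>i<N. \<phi>' (\<alpha> i) * meval \<phi> \<xi> (V i)) / meval \<phi> \<xi> g"
    by (simp add: V sum_divide_distrib)
  then have "(\<Sum>i<N. \<phi>' (\<alpha> i) * meval \<phi> \<xi> (V i)) = 0" using v g by (simp add: zeros_def)
  from zeros_span_descent[OF generic'_\<xi> L this Z w]
  have "(\<lambda>i. inverse (meval \<phi> \<xi> g) * (if i < N then meval \<phi> \<xi> (V i) else 0)) \<in> vec.span (zeros L)"
    by (rule vec.span_scale)
  also have "(\<lambda>i. inverse (meval \<phi> \<xi> g) * (if i < N then meval \<phi> \<xi> (V i) else 0)) = v"
    using v by (auto simp: fun_eq_iff V zeros_def divide_inverse mult.commute)
  finally show "v \<in> vec.span (zeros L)" .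
qed

end

text \<open>The subspace is spanned by the independent vectors \<open>u 0, \<dots>, u (m - 1)\<close>. The restriction of a
  diagonal form is again diagonal in characteristic two, with coefficients \<open>b\<close> and their square
  roots \<open>\<beta>\<close>. The extension field is perfect, like the algebraic closure of \<open>k\<close>.\<close>

locale diagonal_subform = diagonal_form emb N a \<alpha>
  for emb :: "'k::field \<Rightarrow> 'a::field" and N a \<alpha> +
  fixes m :: nat and u :: "nat \<Rightarrow> nat \<Rightarrow> 'k"
  assumes u_independent: "\<And>c j. (\<And>i. i < N \<Longrightarrow> (\<Sum>j<m. c j * u j i) = 0) \<Longrightarrow> j < m \<Longrightarrow> c j = 0"
    and perfect: "\<And>c::'a. \<exists>d. d\<^sup>2 = c"
begin

definition b :: "nat \<Rightarrow> 'k" where "b j = (\<Sum>i<N. a i * (u j i)\<^sup>2)"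

definition \<beta> :: "nat \<Rightarrow> 'a" where "\<beta> j = (\<Sum>i<N. emb (u j i) * \<alpha> i)"

lemma \<beta>_square: "(\<beta> j)\<^sup>2 = emb (b j)"
proof -
  have "(\<beta> j)\<^sup>2 = (\<Sum>i<N. (emb (u j i) * \<alpha> i)\<^sup>2)"
    unfolding \<beta>_def by (rule c2a.sum_square)
  also have "\<dots> = (\<Sum>i<N. emb (a i * (u j i)\<^sup>2))"
  proof (intro sum.cong refl)
    fix i assume "i \<in> {..<N}"
    then have "(\<alpha> i)\<^sup>2 = emb (a i)" by (simp add: \<alpha>_square)
    then show "(emb (u j i) * \<alpha> i)\<^sup>2 = emb (a i * (u j i)\<^sup>2)"
      unfolding power_mult_distrib emb.hom_mult emb.hom_power by (simp only: mult.commute)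
  qed
  also have "\<dots> = emb (b j)" unfolding b_def by (rule emb.hom_sum[symmetric])
  finally show ?thesis .
qed

lemma \<beta>_independent:
  assumes "(\<Sum>j<m. emb (c j) * \<beta> j) = 0" "j < m"
  shows "c j = 0"
proof (rule u_independent[OF _ assms(2)])
  fix i assume i: "i < N"
  have "(\<Sum>j<m. emb (c j) * \<beta> j) = (\<Sum>j<m. \<Sum>i<N. emb (c j * u j i) * \<alpha> i)"
    unfolding \<beta>_def sum_distrib_left emb.hom_mult by (simp only: mult.assoc)
  also have "\<dots> = (\<Sum>i<N. \<Sum>j<m. emb (c j * u j i) * \<alpha> i)" by (rule sum.swap)
  also have "\<dots> = (\<Sum>i<N. emb (\<Sum>j<m. c j * u j i) * \<alpha> i)"
    by (simp only: emb.hom_sum sum_distrib_right)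
  finally show "(\<Sum>j<m. c j * u j i) = 0"
    using \<alpha>_independent[of "\<lambda>i. \<Sum>j<m. c j * u j i" i] assms(1) i by simp
qed

lemma \<beta>_relation:
  "(\<Sum>i<N. \<phi>' (\<alpha> i) * (\<Sum>j<\<mu>. \<phi> (u j i) * z j)) = (\<Sum>j<\<mu>. \<phi>' (\<beta> j) * z j)"
proof -
  have "(\<Sum>i<N. \<phi>' (\<alpha> i) * (\<Sum>j<\<mu>. \<phi> (u j i) * z j)) = (\<Sum>i<N. \<Sum>j<\<mu>. \<phi>' (emb (u j i) * \<alpha> i) * z j)"
    unfolding sum_distrib_left \<phi>_def \<phi>'.hom_mult
    by (intro sum.cong refl) (simp only: mult.commute mult.left_commute)
  also have "\<dots> = (\<Sum>j<\<mu>. \<Sum>i<N. \<phi>' (emb (u j i) * \<alpha> i) * z j)" by (rule sum.swap)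
  also have "\<dots> = (\<Sum>j<\<mu>. \<phi>' (\<beta> j) * z j)"
    by (simp only: \<beta>_def \<phi>'.hom_sum sum_distrib_right)
  finally show ?thesis .
qed

lemma inclusion_injective:
  assumes \<mu>: "\<mu> \<le> m" and z: "\<And>i. i < N \<Longrightarrow> (\<Sum>j<\<mu>. \<phi> (u j i) * z j) = 0" and j: "j < \<mu>"
  shows "z j = 0"
proof -
  interpret L: closed_subfield "range \<phi>" by (rule closed_subfield_range_\<phi>)
  show ?thesis
  proof (rule L.independent_extend_scalars[where J = "{..<\<mu>}" and b = "\<lambda>j i. \<phi> (u j i)" and n = N and \<mu> = z])
    show "(\<Sum>j<\<mu>. z j * \<phi> (u j i)) = 0" if "i < N" for i using z[OF that] by (simp add: mult.commute)
    fix c j assume c: "\<And>j. j \<in> {..<\<mu>} \<Longrightarrow> c j \<in> range \<phi>"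
      and r: "\<And>i. i < N \<Longrightarrow> (\<Sum>j<\<mu>. c j * \<phi> (u j i)) = 0" and j: "j \<in> {..<\<mu>}"
    have "\<forall>j\<in>{..<\<mu>}. \<exists>y. c j = \<phi> y" using c by blast
    from bchoice[OF this] obtain e where e: "\<And>j. j < \<mu> \<Longrightarrow> c j = \<phi> (e j)" by auto
    define e' where "e' j = (if j < \<mu> then e j else 0)" for j
    have "e' j = 0"
    proof (rule u_independent)
      show "j < m" using j \<mu> by simp
      fix i assume i: "i < N"
      have "\<phi> (\<Sum>j<m. e' j * u j i) = \<phi> (\<Sum>j<\<mu>. e' j * u j i)"
        using \<mu> by (intro arg_cong[of _ _ \<phi>] sum.mono_neutral_right) (auto simp: e'_def)
      also have "\<dots> = (\<Sum>j<\<mu>. c j * \<phi> (u j i))"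
        by (simp add: \<phi>.hom_sum \<phi>.hom_mult e e'_def)
      finally show "(\<Sum>j<m. e' j * u j i) = 0" using r[OF i] by simp
    qed
    then show "c j = 0" using e[of j] j by (simp add: e'_def)
  qed (use j in auto)
qed

text \<open>A zero \<open>Z\<close> of the subform, rational in \<open>\<xi>\<close>, generates a subfield \<open>F\<close> of the function field. By
  descent a basis of the zeros of \<open>q\<close> over \<open>F\<close> spans all zeros. The rows of \<open>B\<close> are such a basis,
  up to a common factor, as polynomials in the coordinates of \<open>Z\<close>, and \<open>P\<close> contains the
  coordinates of \<open>\<xi>\<close> in it, again up to a factor. The point \<open>\<zeta>\<close> consists of \<open>Z\<close>, scaled by \<open>\<tau>\<close>,
  and of \<open>P\<close>, scaled by \<open>c\<close> such that \<open>\<xi>\<close> is recovered exactly.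

  All variables \<open>x\<^sub>0, \<dots>, x\<^sub>N\<^sub>-\<^sub>1\<close> are rational over \<open>\<Omega>\<close> in the numbers \<open>\<zeta> j\<close>, where \<open>\<zeta> 0\<close> is a
  linear combination of others and can be omitted. So there are at least \<open>N\<close> of the remaining
  ones, and they are algebraically independent in the case of equality. The first \<open>\<mu>\<close> vectors of
  the basis of the subspace, instead of all \<open>m\<close>, are used in order to treat hyperplanes as well.\<close>

lemma parametrization:
  fixes \<mu> d :: nat and Z :: "nat \<Rightarrow> 'k mpoly"
  defines "r \<equiv> vec.dim (zeros (K0 N \<xi>))"
  assumes \<mu>: "\<mu> \<le> m" and Z: "\<And>j. j < \<mu> \<Longrightarrow> hom_poly N d (Z j)"
    and j\<^sub>0: "j\<^sub>0 < \<mu>" "meval \<phi> \<xi> (Z j\<^sub>0) \<noteq> 0"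
    and rel: "(\<Sum>j<\<mu>. \<phi>' (\<beta> j) * meval \<phi> \<xi> (Z j)) = 0"
  obtains P B c dP dB \<zeta> where
    "c \<noteq> 0" "\<And>l. l < r \<Longrightarrow> hom_poly N dP (P l)" "\<And>l i. l < r \<Longrightarrow> i < N \<Longrightarrow> hom_poly \<mu> dB (B l i)"
    "\<And>j. j < \<mu> \<Longrightarrow> \<zeta> j = \<tau> * meval \<phi> \<xi> (Z j)" "\<And>l. l < r \<Longrightarrow> \<zeta> (\<mu> + l) = c * meval \<phi> \<xi> (P l)"
    "\<And>i. i < N \<Longrightarrow> \<xi> i = (\<Sum>l<r. \<zeta> (\<mu> + l) * meval \<phi> \<zeta> (B l i))"
    "N \<le> \<mu> + r - 1"
    "\<And>F. N = \<mu> + r - 1 \<Longrightarrow> mvars F \<subseteq> {1..<\<mu> + r} \<Longrightarrow> meval \<phi>' \<zeta> F = 0 \<Longrightarrow> F = 0"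
proof -
  let ?ev = "meval \<phi> \<xi>"
  define x where "x j = ?ev (Z j)" for j
  define F where "F = K0 \<mu> x"
  interpret K: closed_subfield "K0 N \<xi>" by (rule closed_subfield_K0)
  interpret F: closed_subfield F unfolding F_def by (rule closed_subfield_K0)
  have FK: "F \<subseteq> K0 N \<xi>" unfolding F_def x_def by (rule K0_subset[OF Z])
  have \<phi>F: "\<phi> c \<in> F" for c unfolding F_def by (rule K0_const)
  define Y where "Y i = (\<Sum>j<\<mu>. mconst (u j i) * Z j)" for i
  have evY: "?ev (Y i) = (\<Sum>j<\<mu>. \<phi> (u j i) * x j)" for i
    by (simp add: Y_def x_def \<phi>.meval_sum \<phi>.meval_mult)
  have Yrel: "(\<Sum>i<N. \<phi>' (\<alpha> i) * ?ev (Y i)) = 0"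
    using \<beta>_relation[where \<mu> = \<mu> and z = x] rel by (simp add: evY x_def)
  obtain i\<^sub>0 where i\<^sub>0: "i\<^sub>0 < N" "?ev (Y i\<^sub>0) \<noteq> 0"
    using inclusion_injective[OF \<mu>, of x j\<^sub>0] j\<^sub>0 evY by (auto simp: x_def)
  have xF: "x j / x j\<^sub>0 \<in> F" if "j < \<mu>" for j
    unfolding F_def using K0_I[OF hom_poly_mvar[OF that] hom_poly_mvar[OF j\<^sub>0(1)], of x] j\<^sub>0 by (simp add: x_def)
  have YF: "?ev (Y i) / x j\<^sub>0 \<in> F" for i
  proof -
    have "?ev (Y i) / x j\<^sub>0 = (\<Sum>j<\<mu>. \<phi> (u j i) * (x j / x j\<^sub>0))"
      by (simp add: evY sum_divide_distrib)
    also have "\<dots> \<in> F" by (intro F.sum_mem F.mult_mem \<phi>F xF) simp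
    finally show ?thesis .
  qed
  have span: "zeros (K0 N \<xi>) \<subseteq> vec.span (zeros F)"
    by (rule zeros_subset_span[OF F.closed_subfield_axioms \<phi>F Yrel i\<^sub>0, of "x j\<^sub>0"])
       (use j\<^sub>0(2) YF in \<open>simp_all add: x_def\<close>)
  have sub: "zeros F \<subseteq> zeros (K0 N \<xi>)" using FK by (auto simp: zeros_def)
  have "zeros F \<subseteq> vec.span (zeros (K0 N \<xi>))"
    using sub vec.span_superset by (rule order_trans)
  from vec_dim_mono[OF this zeros_support zeros_support] vec_dim_mono[OF span zeros_support zeros_support]
  have "vec.dim (zeros F) = r" unfolding r_def by (rule antisym)
  then obtain C where C: "C \<subseteq> zeros F" "finite C" "vec.independent C" "zeros F \<subseteq> vec.span C" "card C = r"
    using support_functions_basis[OF zeros_support[of F]] by metis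
  obtain bs where "bij_betw bs {0..<card C} C"
    using ex_bij_betw_nat_finite[OF C(2)] by blast
  then have bs: "bij_betw bs {..<r} C" by (simp only: C(5) atLeast0LessThan)
  have bs_zeros: "bs l \<in> zeros F" if "l < r" for l using bs that C(1) by (auto simp: bij_betw_def)
  have bs_indep: "c l = 0" if "\<And>i. i < N \<Longrightarrow> (\<Sum>l<r. c l * bs l i) = 0" "l < r" for c l
  proof -
    let ?c = "\<lambda>v. c (inv_into {..<r} bs v)"
    have inj: "inj_on bs {..<r}" and im: "C = bs ` {..<r}" using bs by (auto simp: bij_betw_def)
    have "(\<Sum>v\<in>C. (\<lambda>i. ?c v * v i)) = (\<Sum>l<r. (\<lambda>i. c l * bs l i))"
      unfolding im sum.reindex[OF inj] by (intro sum.cong refl) (simp add: inv_into_f_f[OF inj])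
    also have "\<dots> = 0"
    proof
      fix i
      show "(\<Sum>l<r. (\<lambda>i. c l * bs l i)) i = 0 i"
      proof (cases "i < N")
        case True
        then show ?thesis using that(1) by (simp add: sum_fun_apply)
      next
        case False
        then show ?thesis using bs_zeros by (simp add: sum_fun_apply zeros_def)
      qed
    qed
    finally have "?c (bs l) = 0"
      by (rule vec.independentD[OF C(3) C(2) subset_refl]) (use im that(2) in simp)
    then show ?thesis using inj that(2) by (simp add: inv_into_f_f)
  qed
  have bsK: "case_prod bs jl \<in> K0 \<mu> x" if "jl \<in> {..<r} \<times> {..<N}" for jl
    using bs_zeros that by (auto simp: zeros_def F_def)
  obtain B g dB where g: "hom_poly \<mu> dB g" "meval \<phi> x g \<noteq> 0"
    and B: "\<And>l i. l < r \<Longrightarrow> i < N \<Longrightarrow> hom_poly \<mu> dB (B (l, i))"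
    "\<And>l i. l < r \<Longrightarrow> i < N \<Longrightarrow> bs l i = meval \<phi> x (B (l, i)) / meval \<phi> x g"
  proof -
    have "finite ({..<r} \<times> {..<N})" by simp
    from K0_common_denominator[OF this, of "case_prod bs" \<mu> x, OF bsK] obtain B g dB where
      gB: "hom_poly \<mu> dB g" "meval \<phi> x g \<noteq> 0" and
      B: "\<forall>jl\<in>{..<r} \<times> {..<N}. hom_poly \<mu> dB (B jl) \<and> case_prod bs jl = meval \<phi> x (B jl) / meval \<phi> x g"
      by blast
    show thesis
    proof (rule that[OF gB])
      fix l i assume "l < r" "i < N"
      then show "hom_poly \<mu> dB (B (l, i))" "bs l i = meval \<phi> x (B (l, i)) / meval \<phi> x g"
        using bspec[OF B, of "(l, i)"] by simp_all
    qed
  qed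
  have "\<xi>' \<in> vec.span C"
    using \<xi>'_zeros span vec.span_minimal[OF C(4) vec.subspace_span] by blast
  then obtain p' where p': "\<xi>' = (\<Sum>v\<in>C. (\<lambda>i. p' v * v i))"
    using vec.span_finite[OF C(2)] by auto
  define p where "p l = p' (bs l)" for l
  have \<xi>'p: "\<xi>' i = (\<Sum>l<r. p l * bs l i)" for i
  proof -
    have "(\<Sum>v\<in>C. (\<lambda>i. p' v * v i)) = (\<Sum>l<r. (\<lambda>i. p l * bs l i))"
      unfolding p_def by (rule sum.reindex_bij_betw[OF bs, symmetric])
    then show ?thesis unfolding p' by (simp add: sum_fun_apply)
  qed
  have pK: "p l \<in> K0 N \<xi>" if "l \<in> {..<r}" for l
  proof (rule K.coordinates_mem[where J = "{..<r}" and b = bs and n = N and \<mu> = p and v = \<xi>'])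
    show "bs j i \<in> K0 N \<xi>" if "j \<in> {..<r}" "i < N" for j i
      using bs_zeros[of j] sub that by (auto simp: zeros_def)
    show "\<xi>' i \<in> K0 N \<xi>" if "i < N" for i using \<xi>'_zeros that by (simp add: zeros_def)
  qed (use bs_indep \<xi>'p that in auto)
  from K0_common_denominator[of "{..<r}" p N \<xi>, OF finite_lessThan pK] obtain P g' dP where g': "?ev g' \<noteq> 0"
    and P': "\<forall>l\<in>{..<r}. hom_poly N dP (P l) \<and> p l = ?ev (P l) / ?ev g'" by blast
  then have P: "hom_poly N dP (P l)" "p l = ?ev (P l) / ?ev g'" if "l < r" for l
    using that by auto
  have \<tau>: "\<tau> \<noteq> 0" by (simp add: \<tau>_def Fract_mvar_ne_0)
  \<comment> \<open>The factors come from the denominators \<open>g'\<close> of \<open>P\<close> and \<open>g\<close> of \<open>B\<close>, from the scale \<open>\<tau>\<close> of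
    \<open>Z\<close>, which enters \<open>B\<close> with degree \<open>dB\<close>, and from \<open>\<xi> = \<xi> 1 \<cdot> \<xi>'\<close>.\<close>
  define c where "c = \<xi> 1 / (?ev g' * meval \<phi> x g * \<tau> ^ dB)"
  have c: "c \<noteq> 0" using \<xi>_1 g g' \<tau> by (simp add: c_def)
  define \<zeta> where "\<zeta> j = (if j < \<mu> then \<tau> * x j else c * ?ev (P (j - \<mu>)))" for j
  have ev\<zeta>: "meval \<phi> \<zeta> (B (l, i)) = \<tau> ^ dB * meval \<phi> x (B (l, i))" if "l < r" "i < N" for l i
  proof -
    have "meval \<phi> \<zeta> (B (l, i)) = meval \<phi> (\<lambda>j. \<tau> * x j) (B (l, i))"
      using hom_poly_mvars[OF B(1)[OF that]] by (intro meval_cong) (auto simp: \<zeta>_def)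
    then show ?thesis by (simp add: meval_hom_poly_scale[OF B(1)[OF that]])
  qed
  have \<xi>eq: "\<xi> i = (\<Sum>l<r. \<zeta> (\<mu> + l) * meval \<phi> \<zeta> (B (l, i)))" if i: "i < N" for i
  proof -
    have "\<xi> i = \<xi> 1 * \<xi>' i" using \<xi>_1 i by (simp add: \<xi>'_def)
    also have "\<dots> = (\<Sum>l<r. \<xi> 1 * ((?ev (P l) / ?ev g') * (meval \<phi> x (B (l, i)) / meval \<phi> x g)))"
      unfolding \<xi>'p sum_distrib_left using i by (intro sum.cong refl) (simp add: P(2) B(2))
    also have "\<dots> = (\<Sum>l<r. \<zeta> (\<mu> + l) * meval \<phi> \<zeta> (B (l, i)))"
      using i \<tau> by (intro sum.cong refl) (simp add: ev\<zeta> \<zeta>_def c_def)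
    finally show ?thesis .
  qed
  interpret sq: char_two_field "TYPE('a ratfun)" by unfold_locales
  define J where "J = {1..<\<mu> + r}"
  have finJ: "finite J" by (simp add: J_def)
  \<comment> \<open>The field generated by the squares and the \<open>\<zeta> j\<close> with \<open>j \<noteq> 0\<close>. It contains \<open>\<Omega>\<close>, as \<open>\<Omega>\<close> is
    perfect, then \<open>\<zeta> 0\<close> by the linear relation, then \<open>\<xi>\<close>, and then \<open>\<tau>\<close> as the quotient of \<open>\<zeta>
    j\<^sub>0\<close> and \<open>Z j\<^sub>0\<close> at \<open>\<xi>\<close>.\<close>
  let ?Q = "sq.squarefree_span J \<zeta>"
  have \<phi>'Q: "\<phi>' c \<in> ?Q" for c
  proof -
    obtain e where "e\<^sup>2 = c" using perfect by blast
    then show ?thesis using sq.squarefree_span_square[of "\<phi>' e" J \<zeta>] by (simp flip: \<phi>'.hom_power)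
  qed
  have \<phi>Q: "\<phi> c \<in> ?Q" for c unfolding \<phi>_def by (rule \<phi>'Q)
  have \<zeta>Q: "\<zeta> j \<in> ?Q" if "j < \<mu> + r" for j
  proof (cases "j = 0")
    case False
    then show ?thesis using that by (intro sq.squarefree_span_gen) (simp add: J_def)
  next
    case True
    have \<mu>0: "{..<\<mu>} = insert 0 {1..<\<mu>}" using j\<^sub>0 by auto
    have b0: "\<beta> 0 \<noteq> 0"
    proof
      assume "\<beta> 0 = 0"
      then have "(\<Sum>j<m. emb (if j = 0 then 1 else 0) * \<beta> j) = 0" by (intro sum.neutral) auto
      from \<beta>_independent[OF this, of 0] show False using j\<^sub>0 \<mu> by simp
    qed
    have "(\<Sum>j<\<mu>. \<phi>' (\<beta> j) * \<zeta> j) = \<tau> * (\<Sum>j<\<mu>. \<phi>' (\<beta> j) * x j)"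
      by (simp add: \<zeta>_def sum_distrib_left mult_ac)
    also have "\<dots> = 0" using rel by (simp add: x_def)
    finally have "\<phi>' (\<beta> 0) * \<zeta> 0 + (\<Sum>j\<in>{1..<\<mu>}. \<phi>' (\<beta> j) * \<zeta> j) = 0"
      unfolding \<mu>0 by (subst (asm) sum.insert) auto
    then have "\<phi>' (\<beta> 0) * \<zeta> 0 = - (\<Sum>j\<in>{1..<\<mu>}. \<phi>' (\<beta> j) * \<zeta> j)"
      by (simp only: eq_neg_iff_add_eq_0)
    then have eq: "\<phi>' (\<beta> 0) * \<zeta> 0 = (\<Sum>j\<in>{1..<\<mu>}. \<phi>' (\<beta> j) * \<zeta> j)"
      by (simp only: c2r.uminus_eq)
    have "\<zeta> 0 = inverse (\<phi>' (\<beta> 0)) * (\<phi>' (\<beta> 0) * \<zeta> 0)"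
      using b0 by simp
    then have "\<zeta> 0 = inverse (\<phi>' (\<beta> 0)) * (\<Sum>j\<in>{1..<\<mu>}. \<phi>' (\<beta> j) * \<zeta> j)"
      unfolding eq .
    moreover have "(\<Sum>j\<in>{1..<\<mu>}. \<phi>' (\<beta> j) * \<zeta> j) \<in> ?Q"
      by (intro sq.squarefree_span_sum sq.squarefree_span_mult finJ \<phi>'Q sq.squarefree_span_gen) (simp add: J_def)
    ultimately show ?thesis using True
      by (simp add: sq.squarefree_span_mult finJ \<phi>'Q sq.squarefree_span_inverse)
  qed
  have \<xi>Q: "\<xi> i \<in> ?Q" if "i < N" for i
    unfolding \<xi>eq[OF that]
  proof (intro sq.squarefree_span_sum sq.squarefree_span_mult finJ)
    fix l assume l: "l \<in> {..<r}"
    show "\<zeta> (\<mu> + l) \<in> ?Q" using l by (intro \<zeta>Q) simp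
    show "meval \<phi> \<zeta> (B (l, i)) \<in> ?Q"
      using hom_poly_mvars[OF B(1), of l i] l that
      by (intro sq.squarefree_span_meval finJ \<phi>Q \<zeta>Q) auto
  qed
  have \<tau>Q: "\<tau> \<in> ?Q"
  proof -
    have xQ: "x j\<^sub>0 \<in> ?Q" unfolding x_def
      using hom_poly_mvars[OF Z[OF j\<^sub>0(1)]] by (intro sq.squarefree_span_meval finJ \<phi>Q \<xi>Q) auto
    have eq: "\<tau> = \<zeta> j\<^sub>0 * inverse (x j\<^sub>0)" using j\<^sub>0 by (simp add: \<zeta>_def x_def)
    show ?thesis unfolding eq
      using j\<^sub>0(1) by (intro sq.squarefree_span_mult finJ \<zeta>Q sq.squarefree_span_inverse xQ) simp
  qed
  have mvarQ: "Fract (mvar i) 1 \<in> ?Q" if "i \<in> {..<N}" for i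
  proof (cases "i = 0")
    case True
    then show ?thesis using \<tau>Q by (simp add: \<tau>_def)
  next
    case False
    then show ?thesis using \<xi>Q[of i] that by (simp add: \<xi>_def)
  qed
  note exch = sq.square_independent_exchange[OF _ mvars_square_independent[OF c2a.two_eq_0, of "{..<N}"] finJ mvarQ]
  have cardJ: "card J = \<mu> + r - 1" by (simp add: J_def)
  show ?thesis
  proof (rule that[of c dP P dB "\<lambda>l i. B (l, i)" \<zeta>])
    show "N \<le> \<mu> + r - 1" using exch(1) by (simp add: cardJ)
    show "\<zeta> j = \<tau> * ?ev (Z j)" if "j < \<mu>" for j using that by (simp add: \<zeta>_def x_def)
    show "\<zeta> (\<mu> + l) = c * ?ev (P l)" for l by (simp add: \<zeta>_def)
    show "\<xi> i = (\<Sum>l<r. \<zeta> (\<mu> + l) * meval \<phi> \<zeta> (B (l, i)))" if "i < N" for i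
      by (rule \<xi>eq[OF that])
    fix G :: "'a mpoly"
    assume N\<mu>: "N = \<mu> + r - 1" and G: "mvars G \<subseteq> {1..<\<mu> + r}" "meval \<phi>' \<zeta> G = 0"
    from N\<mu> have "sq.square_independent J \<zeta>" using exch(2) by (simp add: cardJ)
    from sq.square_independent_imp_algebraically_independent[OF \<phi>'.coefficient_hom_axioms perfect finJ this]
    show "G = 0" using G by (simp add: J_def)
  qed (fact c P(1) B(1))+
qed

end

section \<open>Subforms of codimension one less than the index\<close>

lemma multihomogeneous_two_blocks:
  fixes p :: "'k::zero mpoly"
  assumes m: "m \<noteq> 0" and keys: "\<And>e. e \<in> Poly_Mapping.keys p \<Longrightarrow> Poly_Mapping.keys e \<subseteq> {..<m + r} \<and>
      (\<Sum>i<m. Poly_Mapping.lookup e i) = d\<^sub>1 \<and> (\<Sum>i\<in>{m..<m + r}. Poly_Mapping.lookup e i) = d\<^sub>2"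
  shows "multihomogeneous {{..<m}, {m..<m + r}} (\<lambda>C. if C = {..<m} then d\<^sub>1 else d\<^sub>2) p"
proof -
  have "0 \<in> {..<m}" "0 \<notin> {m..<m + r}" using m by auto
  then have ne: "{m..<m + r} \<noteq> {..<m}" by blast
  have U: "\<Union>{{..<m}, {m..<m + r}} = {..<m + r}" by auto
  show ?thesis unfolding multihomogeneous_def U using keys ne by simp
qed

lemma hom_poly_two_blocks:
  fixes p :: "'k::zero mpoly"
  assumes m: "m \<noteq> 0" and p: "hom_poly m d p"
  shows "multihomogeneous {{..<m}, {m..<m + r}} (\<lambda>C. if C = {..<m} then d else 0) p"
proof (rule multihomogeneous_two_blocks[OF m])
  fix e assume "e \<in> Poly_Mapping.keys p"
  then have e: "Poly_Mapping.keys e \<subseteq> {..<m}" "(\<Sum>i<m. Poly_Mapping.lookup e i) = d"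
    using p by (auto simp: multihomogeneous_def)
  moreover have "(\<Sum>i\<in>{m..<m + r}. Poly_Mapping.lookup e i) = 0"
    using e(1) by (intro sum.neutral) (auto simp: in_keys_iff subset_iff)
  ultimately show "Poly_Mapping.keys e \<subseteq> {..<m + r} \<and>
      (\<Sum>i<m. Poly_Mapping.lookup e i) = d \<and> (\<Sum>i\<in>{m..<m + r}. Poly_Mapping.lookup e i) = 0"
    by auto
qed

lemma mvar_two_blocks:
  assumes m: "m \<noteq> 0" and l: "l < r"
  shows "multihomogeneous {{..<m}, {m..<m + r}} (\<lambda>C. if C = {..<m} then 0 else 1)
    (mvar (m + l) :: 'k::zero_neq_one mpoly)"
proof (rule multihomogeneous_two_blocks[OF m])
  fix e assume "e \<in> Poly_Mapping.keys (mvar (m + l) :: 'k mpoly)"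
  then have e: "e = Poly_Mapping.single (m + l) 1" by (simp add: mvar_def)
  have "(\<Sum>i\<in>{m..<m + r}. Poly_Mapping.lookup e i) = (\<Sum>i\<in>{m..<m + r}. if i = m + l then 1 else 0)"
    unfolding e by (intro sum.cong refl) (simp add: lookup_single when_def)
  also have "\<dots> = 1" using l by simp
  finally show "Poly_Mapping.keys e \<subseteq> {..<m + r} \<and>
      (\<Sum>i<m. Poly_Mapping.lookup e i) = 0 \<and> (\<Sum>i\<in>{m..<m + r}. Poly_Mapping.lookup e i) = 1"
    using l by (simp add: e lookup_single when_def)
qed

context diagonal_form
begin

lemma dim_zeros_pos: "vec.dim (zeros (K0 N \<xi>)) \<ge> 1"
proof -
  obtain C where C: "finite C" "zeros (K0 N \<xi>) \<subseteq> vec.span C" "card C = vec.dim (zeros (K0 N \<xi>))"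
    using support_functions_basis[OF zeros_support[of "K0 N \<xi>"]] by metis
  have "\<xi>' 1 \<noteq> 0" using N \<xi>_1 by (simp add: \<xi>'_def)
  then have "\<xi>' \<noteq> 0" by auto
  have "C \<noteq> {}"
  proof
    assume "C = {}"
    then have "\<xi>' \<in> {0}" using \<xi>'_zeros C(2) by auto
    then show False using \<open>\<xi>' \<noteq> 0\<close> by simp
  qed
  then have "card C \<noteq> 0" using C(1) by simp
  then show ?thesis using C(3) by simp
qed

end

text \<open>The number \<open>r\<close> is the first Witt index of \<open>q\<close>, and \<open>m + r = N + 1\<close> says that the subform has
  codimension \<open>r - 1\<close>.\<close>

locale complementary_subform = diagonal_subform +
  fixes r :: nat
  assumes r: "r = vec.dim (zeros (K0 N \<xi>))"
    and m_r: "m + r = N + 1"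
begin

lemma r_pos: "r \<ge> 1" using dim_zeros_pos r by simp

text \<open>The dimensions \<open>m\<close> of the subspace and \<open>r\<close> of the space of zeros add up to more than \<open>N\<close>, so the
  two spaces have a nonzero vector in common.\<close>

lemma subform_zero_exists:
  obtains z j where "\<And>j. j < m \<Longrightarrow> z j \<in> K0 N \<xi>" "(\<Sum>j<m. \<phi>' (\<beta> j) * z j) = 0" "j < m" "z j \<noteq> 0"
proof -
  interpret K: closed_subfield "K0 N \<xi>" by (rule closed_subfield_K0)
  obtain C where C: "C \<subseteq> zeros (K0 N \<xi>)" "finite C" "vec.independent C" "card C = r"
    using support_functions_basis[OF zeros_support[of "K0 N \<xi>"]] unfolding r by metis
  define J where "J = Inl ` C \<union> Inr ` {..<m}"
  have fin: "finite J" using C(2) by (simp add: J_def)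
  have "card J = card C + m"
    unfolding J_def using C(2) by (subst card_Un_disjoint) (auto simp: card_image)
  then have card: "card J > N" using C(4) m_r by simp
  define w where "w = case_sum (\<lambda>v. v) (\<lambda>j i. \<phi> (u j i))"
  have wK: "w j i \<in> K0 N \<xi>" if "j \<in> J" "i < N" for j i
    using that C(1) K0_const by (auto simp: J_def w_def zeros_def)
  obtain c where c: "\<forall>j\<in>J. c j \<in> K0 N \<xi>" "\<exists>j\<in>J. c j \<noteq> 0" "\<forall>i<N. (\<Sum>j\<in>J. c j * w j i) = 0"
    using K.underdetermined_system[of J N w, OF fin card wK] by blast
  have split: "(\<Sum>j\<in>J. c j * w j i) = (\<Sum>v\<in>C. c (Inl v) * v i) + (\<Sum>j<m. c (Inr j) * \<phi> (u j i))" for i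
    unfolding J_def using C(2)
    by (subst sum.union_disjoint) (auto simp: sum.reindex w_def)
  define z where "z j = c (Inr j)" for j
  have eq: "(\<Sum>j<m. \<phi> (u j i) * z j) = (\<Sum>v\<in>C. c (Inl v) * v i)" if "i < N" for i
  proof -
    have "(\<Sum>j<m. \<phi> (u j i) * z j) + (\<Sum>v\<in>C. c (Inl v) * v i) = 0"
      using c(3) that split[of i] by (simp add: z_def mult.commute add.commute)
    then have "(\<Sum>j<m. \<phi> (u j i) * z j) = - (\<Sum>v\<in>C. c (Inl v) * v i)"
      by (simp only: eq_neg_iff_add_eq_0)
    then show ?thesis by (simp only: c2r.uminus_eq)
  qed
  have "(\<Sum>j<m. \<phi>' (\<beta> j) * z j) = (\<Sum>i<N. \<phi>' (\<alpha> i) * (\<Sum>j<m. \<phi> (u j i) * z j))"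
    using \<beta>_relation[where \<mu> = m and z = z] by simp
  also have "\<dots> = (\<Sum>i<N. \<phi>' (\<alpha> i) * (\<Sum>v\<in>C. c (Inl v) * v i))" by (simp add: eq)
  also have "\<dots> = (\<Sum>v\<in>C. c (Inl v) * (\<Sum>i<N. \<phi>' (\<alpha> i) * v i))"
    unfolding sum_distrib_left by (subst sum.swap) (simp add: mult_ac)
  also have "\<dots> = 0" using C(1) by (intro sum.neutral) (auto simp: zeros_def)
  finally have rel: "(\<Sum>j<m. \<phi>' (\<beta> j) * z j) = 0" .
  have "\<exists>j<m. z j \<noteq> 0"
  proof (rule ccontr)
    assume "\<not> (\<exists>j<m. z j \<noteq> 0)"
    then have z0: "z j = 0" if "j < m" for j using that by blast
    have "(\<Sum>v\<in>C. (\<lambda>i. c (Inl v) * v i)) = 0"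
    proof
      fix i
      show "(\<Sum>v\<in>C. (\<lambda>i. c (Inl v) * v i)) i = 0 i"
      proof (cases "i < N")
        case True
        then show ?thesis using eq[OF True] by (simp add: sum_fun_apply z0)
      next
        case False
        then show ?thesis using C(1)
          by (simp add: sum_fun_apply) (intro sum.neutral, auto simp: zeros_def)
      qed
    qed
    then have "c (Inl v) = 0" if "v \<in> C" for v
      using vec.independentD[OF C(3) C(2) subset_refl _ that, of "\<lambda>v. c (Inl v)"] by blast
    then have "c j = 0" if "j \<in> J" for j
      using that z0 by (auto simp: J_def z_def)
    then show False using c(2) by blast
  qed
  moreover have "z j \<in> K0 N \<xi>" if "j < m" for j using c(1) that by (simp add: z_def J_def)
  ultimately show ?thesis using that rel by blast
qed

text \<open>A zero whose last coordinate vanishes lies in the span of \<open>m - 1\<close> of the vectors \<open>u j\<close>. If it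
  were nonzero, \<open>parametrization\<close> would generate \<open>N\<close> independent variables by \<open>(m - 1) + r - 1 = N
  - 1\<close> elements.\<close>

lemma subform_zero_eq_0:
  assumes z: "\<And>j. j < m \<Longrightarrow> z j \<in> K0 N \<xi>" "(\<Sum>j<m. \<phi>' (\<beta> j) * z j) = 0"
    and last: "z (m - 1) = 0" and j: "j < m"
  shows "z j = 0"
proof (rule ccontr)
  assume ne: "z j \<noteq> 0"
  define \<mu> where "\<mu> = m - 1"
  have j\<mu>: "j < \<mu>" using ne last j by (cases "j = m - 1") (auto simp: \<mu>_def)
  have m: "m = Suc \<mu>" using j by (simp add: \<mu>_def)
  have zK: "z j \<in> K0 N \<xi>" if "j \<in> {..<\<mu>}" for j using z(1) that by (simp add: m)
  from K0_common_denominator[of "{..<\<mu>}" z N \<xi>, OF finite_lessThan zK] obtain Z g d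
    where g: "meval \<phi> \<xi> g \<noteq> 0" and Z: "\<forall>j\<in>{..<\<mu>}. hom_poly N d (Z j) \<and> z j = meval \<phi> \<xi> (Z j) / meval \<phi> \<xi> g"
    by blast
  have rel: "(\<Sum>j<\<mu>. \<phi>' (\<beta> j) * meval \<phi> \<xi> (Z j)) = 0"
  proof -
    have "(\<Sum>j<\<mu>. \<phi>' (\<beta> j) * meval \<phi> \<xi> (Z j)) = meval \<phi> \<xi> g * (\<Sum>j<\<mu>. \<phi>' (\<beta> j) * z j)"
      unfolding sum_distrib_left using Z g by (intro sum.cong refl) simp
    also have "(\<Sum>j<\<mu>. \<phi>' (\<beta> j) * z j) = 0" using z(2) last by (simp add: m)
    finally show ?thesis by simp
  qed
  have "N \<le> \<mu> + r - 1"
    by (rule parametrization[of \<mu> d Z j]) (use Z rel ne j\<mu> g in \<open>auto simp: m r\<close>)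
  then show False using m_r r_pos m j\<mu> by simp
qed

lemma m_ge_2: "m \<ge> 2"
proof (rule ccontr)
  assume "\<not> m \<ge> 2"
  obtain z j where z: "\<And>j. j < m \<Longrightarrow> z j \<in> K0 N \<xi>" "(\<Sum>j<m. \<phi>' (\<beta> j) * z j) = 0" "j < m" "z j \<noteq> 0"
    by (rule subform_zero_exists) blast
  have m: "m = 1" using z(3) \<open>\<not> m \<ge> 2\<close> by simp
  have "\<beta> 0 \<noteq> 0"
    using \<beta>_independent[of "\<lambda>_. 1" 0] by (auto simp: m)
  then show False using z by (simp add: m)
qed

sublocale sub: diagonal_form emb m b \<beta>
  by unfold_locales (use emb char2 \<beta>_square \<beta>_independent m_ge_2 in auto)

text \<open>Two zeros have a nontrivial combination with vanishing last coordinate, which is zero.\<close>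

lemma subform_zeros_proportional:
  assumes v: "v \<in> sub.zeros (K0 N \<xi>)" "v \<noteq> 0" and w: "w \<in> sub.zeros (K0 N \<xi>)"
  shows "w \<in> vec.span {v}"
proof -
  interpret K: closed_subfield "K0 N \<xi>" by (rule closed_subfield_K0)
  have mm: "m - 1 < m" using m_ge_2 by simp
  have last: "v (m - 1) \<noteq> 0"
  proof
    assume l: "v (m - 1) = 0"
    have "v j = 0" for j
      using subform_zero_eq_0[of v j, OF _ _ l] v(1) by (cases "j < m") (auto simp: sub.zeros_def)
    then show False using v(2) by auto
  qed
  define c where "c = w (m - 1) / v (m - 1)"
  have cK: "c \<in> K0 N \<xi>" using v(1) w mm by (auto simp: c_def sub.zeros_def)
  define z where "z j = w j - c * v j" for j
  have zK: "z j \<in> K0 N \<xi>" if "j < m" for j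
    unfolding z_def using v(1) w cK that by (intro K.diff_mem K.mult_mem) (auto simp: sub.zeros_def)
  have "(\<Sum>j<m. \<phi>' (\<beta> j) * z j) = (\<Sum>j<m. \<phi>' (\<beta> j) * w j) - c * (\<Sum>j<m. \<phi>' (\<beta> j) * v j)"
    unfolding z_def sum_distrib_left sum_subtractf[symmetric]
    by (intro sum.cong refl) (simp add: right_diff_distrib mult.left_commute)
  then have rel: "(\<Sum>j<m. \<phi>' (\<beta> j) * z j) = 0" using v(1) w by (simp add: sub.zeros_def)
  have "z (m - 1) = 0" using last by (simp add: z_def c_def)
  then have z0: "z j = 0" if "j < m" for j using subform_zero_eq_0[OF zK rel] that by blast
  have "w = (\<lambda>i. c * v i)"
  proof
    fix j
    show "w j = c * v j"
      using z0[of j] v(1) w by (cases "j < m") (auto simp: z_def sub.zeros_def)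
  qed
  then show ?thesis using vec.span_scale[OF vec.span_base[of v "{v}"], of c] by simp
qed

text \<open>By the case of equality in \<open>parametrization\<close> the point \<open>\<zeta> = (z, p)\<close> is a generic point of \<open>Y \<times>
  P\<^sup>r\<^sup>-\<^sup>1\<close>. The function field of \<open>Y\<close> becomes a subfield of that of \<open>X\<close>, over which all zeros of
  the subform are proportional, so the index is one. The birational maps are \<open>F = (Z, P)\<close> and \<open>G =
  \<Sum>l p\<^sub>l B\<^sub>l\<close>. They map the generic points \<open>\<xi>\<close> and \<open>\<zeta>\<close> to each other up to scaling in each factor,
  and a divisibility by \<open>q\<close> or by the equation of \<open>Y\<close> is an identity at the generic point.\<close>

theorem index_and_birational:
  shows "first_witt_index m sub.q = 1 \<and> birational {{..<N}} q {{..<m}, {m..<m + r}} sub.q"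
proof -
  let ?ev = "meval \<phi> \<xi>"
  obtain z j\<^sub>0 where z: "\<And>j. j < m \<Longrightarrow> z j \<in> K0 N \<xi>" "(\<Sum>j<m. \<phi>' (\<beta> j) * z j) = 0" "j\<^sub>0 < m" "z j\<^sub>0 \<noteq> 0"
    by (rule subform_zero_exists) blast
  have zK: "z j \<in> K0 N \<xi>" if "j \<in> {..<m}" for j using z(1) that by simp
  from K0_common_denominator[of "{..<m}" z N \<xi>, OF finite_lessThan zK] obtain Z g d
    where g: "?ev g \<noteq> 0" and Z': "\<forall>j\<in>{..<m}. hom_poly N d (Z j) \<and> z j = ?ev (Z j) / ?ev g"
    by blast
  then have Z: "hom_poly N d (Z j)" "z j = ?ev (Z j) / ?ev g" if "j < m" for j
    using that by auto
  have Zne: "?ev (Z j\<^sub>0) \<noteq> 0" using z(3,4) Z(2) by auto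
  have Zrel: "(\<Sum>j<m. \<phi>' (\<beta> j) * ?ev (Z j)) = 0"
  proof -
    have "(\<Sum>j<m. \<phi>' (\<beta> j) * ?ev (Z j)) = ?ev g * (\<Sum>j<m. \<phi>' (\<beta> j) * z j)"
      unfolding sum_distrib_left using Z(2) g by (intro sum.cong refl) simp
    then show ?thesis using z(2) by simp
  qed
  obtain P B c dP dB \<zeta> where c: "c \<noteq> 0" and P: "\<And>l. l < r \<Longrightarrow> hom_poly N dP (P l)"
    and B: "\<And>l i. l < r \<Longrightarrow> i < N \<Longrightarrow> hom_poly m dB (B l i)"
    and \<zeta>: "\<And>j. j < m \<Longrightarrow> \<zeta> j = \<tau> * ?ev (Z j)" "\<And>l. l < r \<Longrightarrow> \<zeta> (m + l) = c * ?ev (P l)"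
    and \<xi>eq: "\<And>i. i < N \<Longrightarrow> \<xi> i = (\<Sum>l<r. \<zeta> (m + l) * meval \<phi> \<zeta> (B l i))"
    and ind: "\<And>F. N = m + r - 1 \<Longrightarrow> mvars F \<subseteq> {1..<m + r} \<Longrightarrow> meval \<phi>' \<zeta> F = 0 \<Longrightarrow> F = 0"
    by (rule parametrization[OF order_refl Z(1) z(3) Zne Zrel, folded r]) (assumption | rule that)+
  have \<tau>: "\<tau> \<noteq> 0" by (simp add: \<tau>_def Fract_mvar_ne_0)
  have gen': "sub.generic' {..<m + r} \<zeta>"
  proof (rule sub.generic'_if_algebraically_independent)
    have "(\<Sum>j<m. \<phi>' (\<beta> j) * \<zeta> j) = \<tau> * (\<Sum>j<m. \<phi>' (\<beta> j) * ?ev (Z j))"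
      by (simp add: \<zeta>(1) sum_distrib_left mult_ac)
    then show "(\<Sum>j<m. \<phi>' (\<beta> j) * \<zeta> j) = 0" using Zrel by simp
    fix F :: "'b mpoly" assume F: "mvars F \<subseteq> {..<m + r} - {0}" "meval \<phi>' \<zeta> F = 0"
    have "{..<m + r} - {0} = {1..<m + r}" by auto
    then show "F = 0" using ind F m_r by simp
  qed simp
  have gen: "sub.generic {..<m + r} \<zeta>" by (rule sub.generic'_imp_generic[OF gen'])
  have dvd_iff: "sub.q dvd f \<longleftrightarrow> meval \<phi> \<zeta> f = 0" if "mvars f \<subseteq> {..<m + r}" for f
    using gen that by (auto simp: sub.generic_def)
  have q_dvd_iff: "q dvd f \<longleftrightarrow> ?ev f = 0" for f
    using generic_\<xi>[of UNIV] by (auto simp: generic_def)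

  have "first_witt_index m sub.q = vec.dim (sub.zeros (K0 m \<zeta>))"
  proof (rule sub.first_witt_index_eq_dim_zeros)
    have "sub.q dvd f \<longleftrightarrow> meval \<phi> \<zeta> f = 0" if "mvars f \<subseteq> {..<m}" for f
      using that by (intro dvd_iff) auto
    then show "sub.generic {..<m} \<zeta>" by (simp add: sub.generic_def)
  qed
  also have "\<dots> = 1"
  proof -
    have K0eq: "K0 m \<zeta> = K0 m (\<lambda>j. ?ev (Z j))"
      using K0_cong[of m \<zeta> "\<lambda>j. \<tau> * ?ev (Z j)"] K0_scale[OF \<tau>, of m "\<lambda>j. ?ev (Z j)"] \<zeta>(1) by simp
    have "K0 m \<zeta> \<subseteq> K0 N \<xi>" unfolding K0eq by (rule K0_subset[OF Z(1)])
    then have sub: "sub.zeros (K0 m \<zeta>) \<subseteq> sub.zeros (K0 N \<xi>)" by (auto simp: sub.zeros_def)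
    define v where "v j = (if j < m then ?ev (Z j) / ?ev (Z j\<^sub>0) else 0)" for j
    have "v j \<in> K0 m \<zeta>" if "j < m" for j
      unfolding K0eq v_def
      using K0_I[OF hom_poly_mvar[OF that] hom_poly_mvar[OF z(3)], of "\<lambda>j. ?ev (Z j)"] that Zne by simp
    moreover have "(\<Sum>j<m. \<phi>' (\<beta> j) * v j) = (\<Sum>j<m. \<phi>' (\<beta> j) * ?ev (Z j)) / ?ev (Z j\<^sub>0)"
      by (simp add: v_def sum_divide_distrib)
    ultimately have v: "v \<in> sub.zeros (K0 m \<zeta>)" using Zrel by (simp add: sub.zeros_def v_def)
    have "v j\<^sub>0 \<noteq> 0" using Zne z(3) by (simp add: v_def)
    then have v0: "v \<noteq> 0" by auto
    have "sub.zeros (K0 m \<zeta>) \<subseteq> vec.span {v}"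
      using subform_zeros_proportional[of v] v v0 sub by blast
    then have "card {v} = vec.dim (sub.zeros (K0 m \<zeta>))"
      using v v0 by (intro vec.basis_card_eq_dim) auto
    then show ?thesis by simp
  qed
  finally have index: "first_witt_index m sub.q = 1" .

  let ?Bs = "{{..<N}}" and ?Cs = "{{..<m}, {m..<m + r}}"
  have m0: "m \<noteq> 0" using m_ge_2 by simp
  define F where "F j = (if j < m then Z j else P (j - m))" for j
  define G where "G i = (\<Sum>l<r. mvar (m + l) * B l i)" for i
  have F_Z: "F j = Z j" if "j < m" for j using that by (simp add: F_def)
  have F_P: "F (m + l) = P l" for l by (simp add: F_def)
  have homF: "\<exists>e. hom_poly N e (F j)" if "j < m + r" for j
  proof (cases "j < m")
    case True
    then show ?thesis using Z(1) by (auto simp: F_def)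
  next
    case False
    then have "j - m < r" using that by arith
    then show ?thesis using False P[of "j - m"] by (auto simp: F_def)
  qed
  have varsF: "mvars (F j) \<subseteq> {..<N}" if "j < m + r" for j
    using homF[OF that] hom_poly_mvars by blast
  have varsB: "mvars (B l i) \<subseteq> {..<m}" if "l < r" "i < N" for l i
    by (rule hom_poly_mvars[OF B[OF that]])
  have varsG: "mvars (G i) \<subseteq> {..<m + r}" if i: "i < N" for i
  proof -
    have "mvars (mvar (m + l) * B l i) \<subseteq> {..<m + r}" if "l < r" for l
    proof -
      have "mvars (mvar (m + l) * B l i) \<subseteq> insert (m + l) {..<m}"
        using mvars_mult[of "mvar (m + l)" "B l i"] varsB[OF that i] unfolding mvars_mvar by blast
      also have "\<dots> \<subseteq> {..<m + r}" using that by auto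
      finally show ?thesis .
    qed
    then show ?thesis unfolding G_def by (intro order_trans[OF mvars_sum] UN_least) auto
  qed
  have evG: "meval \<phi> \<zeta> (G i) = \<xi> i" if "i < N" for i
    using \<xi>eq[OF that] by (simp add: G_def \<phi>.meval_sum \<phi>.meval_mult)
  \<comment> \<open>At \<open>\<xi>\<close> the map \<open>F\<close> gives \<open>\<zeta>\<close> without the scales \<open>\<tau>\<close> and \<open>c\<close>; the form \<open>G\<close> has degree \<open>dB\<close>
    in the former and is linear in the latter.\<close>
  define \<kappa> where "\<kappa> = 1 / (c * \<tau> ^ dB)"
  have \<kappa>: "\<kappa> \<noteq> 0" using c \<tau> by (simp add: \<kappa>_def)
  have evFG: "?ev (msubst F (G i)) = \<kappa> * \<xi> i" if i: "i < N" for i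
  proof -
    have "?ev (msubst F (G i)) = meval \<phi> (\<lambda>j. ?ev (F j)) (G i)"
      by (rule \<phi>.meval_msubst[OF \<phi>.coefficient_hom_axioms])
    also have "\<dots> = (\<Sum>l<r. ?ev (P l) * meval \<phi> (\<lambda>j. ?ev (F j)) (B l i))"
      by (simp add: G_def \<phi>.meval_sum \<phi>.meval_mult F_P)
    also have "\<dots> = (\<Sum>l<r. \<kappa> * (\<zeta> (m + l) * meval \<phi> \<zeta> (B l i)))"
    proof (intro sum.cong refl)
      fix l assume "l \<in> {..<r}"
      then have l: "l < r" by simp
      have "meval \<phi> \<zeta> (B l i) = meval \<phi> (\<lambda>j. \<tau> * ?ev (F j)) (B l i)"
        using varsB[OF l i] by (intro meval_cong) (auto simp: \<zeta>(1) F_Z)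
      also have "\<dots> = \<tau> ^ dB * meval \<phi> (\<lambda>j. ?ev (F j)) (B l i)"
        by (rule meval_hom_poly_scale[OF B[OF l i]])
      finally show "?ev (P l) * meval \<phi> (\<lambda>j. ?ev (F j)) (B l i) = \<kappa> * (\<zeta> (m + l) * meval \<phi> \<zeta> (B l i))"
        unfolding \<zeta>(2)[OF l] \<kappa>_def using c \<tau> by (simp add: field_simps)
    qed
    also have "\<dots> = \<kappa> * \<xi> i" by (simp add: \<xi>eq[OF i] sum_distrib_left)
    finally show ?thesis .
  qed
  have evGF: "meval \<phi> \<zeta> (msubst G (F j)) = ?ev (F j)" if j: "j < m + r" for j
  proof -
    have "meval \<phi> \<zeta> (msubst G (F j)) = meval \<phi> (\<lambda>i. meval \<phi> \<zeta> (G i)) (F j)"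
      by (rule \<phi>.meval_msubst[OF \<phi>.coefficient_hom_axioms])
    also have "\<dots> = ?ev (F j)" using varsF[OF j] by (intro meval_cong) (auto simp: evG)
    finally show ?thesis .
  qed
  have N1: "1 < N" using N by simp
  have P_ne: "\<exists>l<r. ?ev (P l) \<noteq> 0"
  proof (rule ccontr)
    assume "\<not> (\<exists>l<r. ?ev (P l) \<noteq> 0)"
    then have "\<xi> 1 = 0" unfolding \<xi>eq[OF N1] by (intro sum.neutral) (auto simp: \<zeta>(2))
    then show False using \<xi>_1 by simp
  qed
  have evq: "meval \<phi> x (msubst H q) = (\<Sum>i<N. \<phi>' (\<alpha> i) * meval \<phi> x (H i))\<^sup>2" for x H
    using \<phi>.meval_msubst[OF \<phi>.coefficient_hom_axioms, of x H q] by (simp add: meval_q)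
  have evq': "meval \<phi> x (msubst H sub.q) = (\<Sum>j<m. \<phi>' (\<beta> j) * meval \<phi> x (H j))\<^sup>2" for x H
    using \<phi>.meval_msubst[OF \<phi>.coefficient_hom_axioms, of x H sub.q] by (simp add: sub.meval_q)

  have F_ne: "\<exists>j\<in>{..<m}. \<not> q dvd F j" "\<exists>j\<in>{m..<m + r}. \<not> q dvd F j"
  proof -
    show "\<exists>j\<in>{..<m}. \<not> q dvd F j"
      using z(3) Zne by (intro bexI[of _ j\<^sub>0]) (simp_all add: q_dvd_iff F_Z)
    obtain l where "l < r" "?ev (P l) \<noteq> 0" using P_ne by blast
    then show "\<exists>j\<in>{m..<m + r}. \<not> q dvd F j"
      by (intro bexI[of _ "m + l"]) (simp_all add: q_dvd_iff F_P)
  qed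
  have rmF: "rational_map ?Bs q ?Cs sub.q F"
  proof -
    have "\<forall>j\<in>{..<m}. hom_poly N d (F j)" using Z(1) by (simp add: F_Z)
    moreover have "\<forall>j\<in>{m..<m + r}. hom_poly N dP (F j)"
    proof
      fix j assume "j \<in> {m..<m + r}"
      then show "hom_poly N dP (F j)" using P[of "j - m"] by (auto simp: F_def)
    qed
    moreover have "q dvd msubst F sub.q"
      unfolding q_dvd_iff evq' using Zrel by (simp add: F_Z)
    ultimately show ?thesis unfolding rational_map_def using F_ne by blast
  qed
  have rmG: "rational_map ?Cs sub.q ?Bs q G"
  proof -
    have "multihomogeneous ?Cs (\<lambda>D. if D = {..<m} then dB else 1) (G i)" if i: "i < N" for i
      unfolding G_def
    proof (rule multihomogeneous_sum)
      fix l assume "l \<in> {..<r}"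
      then have l: "l < r" by simp
      from multihomogeneous_mult[OF mvar_two_blocks[OF m0 l, where 'k = 'a] hom_poly_two_blocks[OF m0 B[OF l i]]]
      show "multihomogeneous ?Cs (\<lambda>D. if D = {..<m} then dB else 1) (mvar (m + l) * B l i)"
        by (rule multihomogeneous_cong[THEN iffD1, rotated]) simp
    qed
    then have "\<exists>d. \<forall>i\<in>{..<N}. multihomogeneous ?Cs d (G i)" by blast
    moreover have "\<exists>i\<in>{..<N}. \<not> sub.q dvd G i"
      using N1 \<xi>_1 by (intro bexI[of _ 1]) (simp_all add: dvd_iff varsG evG)
    moreover have "sub.q dvd msubst G q"
    proof -
      have "mvars (msubst G q) \<subseteq> {..<m + r}"
        using mvars_q varsG by (intro order_trans[OF mvars_msubst] UN_least) auto
      moreover have "meval \<phi> \<zeta> (msubst G q) = 0"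
        unfolding evq using \<xi>_relation by (simp add: evG)
      ultimately show ?thesis by (simp add: dvd_iff)
    qed
    ultimately show ?thesis unfolding rational_map_def by blast
  qed
  have idX: "represents_identity ?Bs q (\<lambda>i. msubst F (G i))"
  proof -
    have "\<exists>i\<in>{..<N}. \<not> q dvd msubst F (G i)"
      using N1 \<xi>_1 \<kappa> by (intro bexI[of _ 1]) (simp_all add: q_dvd_iff evFG)
    moreover have "\<forall>i\<in>{..<N}. \<forall>j\<in>{..<N}. q dvd msubst F (G i) * mvar j - msubst F (G j) * mvar i"
      by (simp add: q_dvd_iff \<phi>.meval_diff \<phi>.meval_mult evFG)
    ultimately show ?thesis unfolding represents_identity_def by blast
  qed
  have idY: "represents_identity ?Cs sub.q (\<lambda>j. msubst G (F j))"
  proof -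
    have vars: "mvars (msubst G (F j)) \<subseteq> {..<m + r}" if "j < m + r" for j
      using varsF[OF that] varsG by (intro order_trans[OF mvars_msubst] UN_least) auto
    have varsd: "mvars (msubst G (F i) * mvar j - msubst G (F j) * mvar i) \<subseteq> {..<m + r}"
      if "i < m + r" "j < m + r" for i j
    proof -
      interpret k2: char_two "TYPE('a mpoly)" by (rule char_two_mpoly[OF char2])
      have "mvars (msubst G (F i) * mvar j + msubst G (F j) * mvar i) \<subseteq> {..<m + r}"
        using vars that by (intro order_trans[OF mvars_add] Un_least order_trans[OF mvars_mult]) auto
      then show ?thesis unfolding k2.minus_eq .
    qed
    have ne: "\<not> sub.q dvd msubst G (F j)" if "j < m + r" "\<not> q dvd F j" for j
      using that vars[OF that(1)] by (simp add: dvd_iff evGF q_dvd_iff)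
    have proportional: "sub.q dvd msubst G (F i) * mvar j - msubst G (F j) * mvar i"
      if "i < m + r" "j < m + r" "\<zeta> i = t * ?ev (F i)" "\<zeta> j = t * ?ev (F j)" for i j t
    proof -
      have "meval \<phi> \<zeta> (msubst G (F i) * mvar j - msubst G (F j) * mvar i) = 0"
        using that by (simp add: \<phi>.meval_diff \<phi>.meval_mult evGF)
      then show ?thesis using dvd_iff[OF varsd[OF that(1,2)]] by simp
    qed
    have "\<zeta> j = \<tau> * ?ev (F j)" if "j \<in> {..<m}" for j using that by (simp add: \<zeta>(1) F_Z)
    then have "\<forall>i\<in>{..<m}. \<forall>j\<in>{..<m}. sub.q dvd msubst G (F i) * mvar j - msubst G (F j) * mvar i"
      by (intro ballI proportional[where t = \<tau>]) auto
    moreover have "\<zeta> j = c * ?ev (F j)" if "j \<in> {m..<m + r}" for j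
      using that \<zeta>(2)[of "j - m"] by (auto simp: F_def)
    then have "\<forall>i\<in>{m..<m + r}. \<forall>j\<in>{m..<m + r}. sub.q dvd msubst G (F i) * mvar j - msubst G (F j) * mvar i"
      by (intro ballI proportional[where t = c]) auto
    moreover have "\<exists>j\<in>{..<m}. \<not> sub.q dvd msubst G (F j)"
    proof -
      obtain j where "j \<in> {..<m}" "\<not> q dvd F j" using F_ne(1) by blast
      then show ?thesis by (intro bexI[of _ j] ne) auto
    qed
    moreover have "\<exists>j\<in>{m..<m + r}. \<not> sub.q dvd msubst G (F j)"
    proof -
      obtain j where "j \<in> {m..<m + r}" "\<not> q dvd F j" using F_ne(2) by blast
      then show ?thesis by (intro bexI[of _ j] ne) auto
    qed
    ultimately show ?thesis unfolding represents_identity_def by blast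
  qed
  show ?thesis
    unfolding birational_def using index rmF rmG idX idY by blast
qed

end

section \<open>Anisotropic quasilinear forms in coordinates\<close>

text \<open>A mixed coefficient is seen on a sum of two coordinate vectors: there \<open>q\<close> takes the sum of its
  values at the two vectors and the mixed coefficient.\<close>

lemma quasilinear_form_diagonal:
  fixes q :: "'k::field mpoly"
  assumes q: "quadratic_form n q" "quasilinear q"
  shows "q = (\<Sum>i<n. mconst (Poly_Mapping.lookup q (Poly_Mapping.single i 2)) * (mvar i)\<^sup>2)"
proof (rule poly_mapping_eqI)
  let ?c = "Poly_Mapping.lookup q"
  interpret id: coefficient_hom "id :: 'k \<Rightarrow> 'k" by unfold_locales auto
  \<comment> \<open>At the indicator function of \<open>A\<close> exactly the monomials in the variables of \<open>A\<close> have the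
    value one.\<close>
  define ind where "ind A i = (if i \<in> A then 1 else 0 :: 'k)" for A :: "nat set" and i
  have ev: "meval id (ind A) q = (\<Sum>e | e \<in> Poly_Mapping.keys q \<and> Poly_Mapping.keys e \<subseteq> A. ?c e)" for A
  proof -
    have "monom_eval (ind A) e = (if Poly_Mapping.keys e \<subseteq> A then 1 else 0)" for e
      unfolding monom_eval_def ind_def by (auto simp: in_keys_iff intro!: prod.neutral prod_zero)
    then have "meval id (ind A) q = (\<Sum>e\<in>Poly_Mapping.keys q. if Poly_Mapping.keys e \<subseteq> A then ?c e else 0)"
      unfolding meval_monom_eval by (intro sum.cong refl) simp
    then show ?thesis by (simp add: sum.inter_filter)
  qed
  have deg: "Poly_Mapping.keys e \<subseteq> {..<n}" "(\<Sum>i<n. Poly_Mapping.lookup e i) = 2"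
    if "e \<in> Poly_Mapping.keys q" for e
    using q(1) that by (auto simp: quadratic_form_def multihomogeneous_def)
  have deg': "(\<Sum>i\<in>Poly_Mapping.keys e. Poly_Mapping.lookup e i) = 2" if "e \<in> Poly_Mapping.keys q" for e
    using deg[OF that] by (subst sum.mono_neutral_left[of "{..<n}"]) (auto simp: in_keys_iff)
  have mixed: "?c e = 0" if e: "Poly_Mapping.keys e = {i, j}" "i \<noteq> j" for e i j
  proof (rule ccontr)
    assume "?c e \<noteq> 0"
    then have ek: "e \<in> Poly_Mapping.keys q" by (simp add: in_keys_iff)
    let ?K = "\<lambda>A. {e. e \<in> Poly_Mapping.keys q \<and> Poly_Mapping.keys e \<subseteq> A}"
    have fin: "finite (?K A)" for A by simp
    have uniq: "e' = e" if "e' \<in> Poly_Mapping.keys q" "Poly_Mapping.keys e' = {i, j}" for e'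
    proof -
      have one: "Poly_Mapping.lookup f l = (if l = i \<or> l = j then 1 else 0)"
        if f: "f \<in> Poly_Mapping.keys q" "Poly_Mapping.keys f = {i, j}" for f l
      proof -
        have "Poly_Mapping.lookup f i + Poly_Mapping.lookup f j = 2"
          using deg'[OF f(1)] f(2) e(2) by simp
        moreover have "i \<in> Poly_Mapping.keys f" "j \<in> Poly_Mapping.keys f"
          using f(2) by auto
        then have "Poly_Mapping.lookup f i \<noteq> 0" "Poly_Mapping.lookup f j \<noteq> 0"
          by (simp_all only: in_keys_iff not_False_eq_True)
        moreover have "Poly_Mapping.lookup f l = 0" if "l \<noteq> i" "l \<noteq> j"
          using f(2) that by (metis empty_iff in_keys_iff insert_iff)
        ultimately show ?thesis by auto
      qed
      show ?thesis using one[OF that] one[OF ek e(1)] by (intro poly_mapping_eqI) simp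
    qed
    have split: "?K {i, j} = insert e (?K {i} \<union> ?K {j})"
    proof
      show "insert e (?K {i} \<union> ?K {j}) \<subseteq> ?K {i, j}" using ek e(1) by auto
      show "?K {i, j} \<subseteq> insert e (?K {i} \<union> ?K {j})"
      proof
        fix f assume f: "f \<in> ?K {i, j}"
        then consider "Poly_Mapping.keys f = {i, j}" | "Poly_Mapping.keys f \<subseteq> {i}" | "Poly_Mapping.keys f \<subseteq> {j}"
          by blast
        then show "f \<in> insert e (?K {i} \<union> ?K {j})" using f uniq by cases auto
      qed
    qed
    have disj: "?K {i} \<inter> ?K {j} = {}"
    proof -
      have "False" if f: "f \<in> ?K {i}" "f \<in> ?K {j}" for f
      proof -
        have "Poly_Mapping.keys f = {}" using f e(2) by blast
        then show False using deg'[of f] f(1) by simp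
      qed
      then show ?thesis by blast
    qed
    have "e \<notin> ?K {i} \<union> ?K {j}" using e by auto
    then have "meval id (ind {i, j}) q = ?c e + (meval id (ind {i}) q + meval id (ind {j}) q)"
      unfolding ev split using fin disj by (simp add: sum.union_disjoint)
    moreover have "ind {i, j} = (\<lambda>l. ind {i} l + ind {j} l)" using e(2) by (auto simp: ind_def)
    ultimately have "?c e = 0" using q(2) unfolding quasilinear_def
      by (metis add_diff_cancel_right' diff_diff_add)
    then show False using \<open>?c e \<noteq> 0\<close> by simp
  qed
  fix e
  have "?c e = (\<Sum>i<n. if e = Poly_Mapping.single i 2 then ?c (Poly_Mapping.single i 2) else 0)"
  proof (cases "\<exists>i<n. e = Poly_Mapping.single i 2")
    case True
    then obtain i where i: "i < n" "e = Poly_Mapping.single i 2" by blast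
    have "Poly_Mapping.single i (2::nat) = Poly_Mapping.single j 2 \<longleftrightarrow> j = i" for j
    proof
      assume "Poly_Mapping.single i (2::nat) = Poly_Mapping.single j 2"
      from arg_cong[OF this, of Poly_Mapping.keys] show "j = i" by simp
    qed simp
    then show ?thesis using i by simp
  next
    case False
    have "?c e = 0"
    proof (rule ccontr)
      assume "?c e \<noteq> 0"
      then have ek: "e \<in> Poly_Mapping.keys q" by (simp add: in_keys_iff)
      obtain i where i: "i \<in> Poly_Mapping.keys e" using deg'[OF ek] by fastforce
      show False
      proof (cases "Poly_Mapping.keys e = {i}")
        case True
        then have "Poly_Mapping.lookup e i = 2" using deg'[OF ek] by simp
        then have "e = Poly_Mapping.single i 2"
          using True by (intro poly_mapping_eqI) (auto simp: lookup_single when_def in_keys_iff)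
        then show False using False deg(1)[OF ek] i by auto
      next
        case F: False
        then obtain j where j: "j \<in> Poly_Mapping.keys e" "j \<noteq> i" using i by blast
        have "Poly_Mapping.keys e \<subseteq> {i, j}"
        proof
          fix l assume l: "l \<in> Poly_Mapping.keys e"
          show "l \<in> {i, j}"
          proof (rule ccontr)
            assume "l \<notin> {i, j}"
            then have "(\<Sum>x\<in>{i, j, l}. Poly_Mapping.lookup e x) \<ge> 3"
              using i j l by (simp add: in_keys_iff)
            moreover have "(\<Sum>x\<in>{i, j, l}. Poly_Mapping.lookup e x) \<le> 2"
              unfolding deg'[OF ek, symmetric] using i j l by (intro sum_mono2) auto
            ultimately show False by simp
          qed
        qed
        then have "Poly_Mapping.keys e = {i, j}" using i j by blast
        then show False using mixed[of e i j] j \<open>?c e \<noteq> 0\<close> by simp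
      qed
    qed
    moreover have "(\<Sum>i<n. if e = Poly_Mapping.single i 2 then ?c (Poly_Mapping.single i 2) else 0) = 0"
      using False by (intro sum.neutral) auto
    ultimately show ?thesis by simp
  qed
  then show "?c e = Poly_Mapping.lookup (\<Sum>i<n. mconst (?c (Poly_Mapping.single i 2)) * (mvar i)\<^sup>2) e"
    by (simp add: lookup_sum mvar_power mconst_def mult_single lookup_single when_def eq_commute cong: if_cong)
qed

theorem theorem6p4:
  fixes q q' :: "'k::field mpoly" and n m r :: nat
  assumes "CHAR('k) = 2"
    and "n \<ge> 2"
    and "quadratic_form n q"
    and "anisotropic n q"
    and "quasilinear q"
    and "r = first_witt_index n q"
    and "subform m q' n q"
    and "m + (r - 1) = n"
  shows "first_witt_index m q' = 1 \<and>
         birational {{..<n}} q {{..<m}, {m..<m + r}} q'"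
proof -
  define a where "a i = Poly_Mapping.lookup q (Poly_Mapping.single i 2)" for i
  have q: "q = (\<Sum>i<n. mconst (a i) * (mvar i)\<^sup>2)"
    unfolding a_def by (rule quasilinear_form_diagonal) fact+
  have char2: "(1::'k) + 1 = 0"
    using assms(1) of_nat_CHAR[where 'a = 'k] by simp
  have emb: "coefficient_hom (to_ac :: 'k \<Rightarrow> _)" by unfold_locales simp_all
  interpret emb: coefficient_hom "to_ac :: 'k \<Rightarrow> _" by (rule emb)
  have perfect: "\<exists>d. d\<^sup>2 = c" for c :: "'k alg_closure"
    using nth_root_exists[of 2 c] by auto
  then have "\<forall>i. \<exists>x. x\<^sup>2 = to_ac (a i)" by blast
  from choice[OF this] obtain \<alpha> where \<alpha>: "\<And>i. (\<alpha> i)\<^sup>2 = to_ac (a i)" by blast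
  interpret c2: char_two "TYPE('k alg_closure)"
    using char2 by unfold_locales (metis to_ac_0 to_ac_1 to_ac_add)
  interpret id: coefficient_hom "id :: 'k \<Rightarrow> 'k" by unfold_locales auto
  \<comment> \<open>A linear relation between the square roots is, by squaring, a zero of \<open>q\<close>.\<close>
  have \<alpha>_independent: "c i = 0" if rel: "(\<Sum>i<n. to_ac (c i) * \<alpha> i) = 0" and i: "i < n" for c i
  proof (rule ccontr)
    assume ne: "c i \<noteq> 0"
    have "to_ac (\<Sum>i<n. a i * (c i)\<^sup>2) = (\<Sum>i<n. to_ac (c i) * \<alpha> i)\<^sup>2"
      by (simp add: c2.sum_square power_mult_distrib \<alpha> to_ac_sum mult.commute)
    then have "(\<Sum>i<n. a i * (c i)\<^sup>2) = 0" using rel by simp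
    then have "meval id c q = 0"
      by (simp add: q id.meval_sum id.meval_mult id.meval_power)
    then show False using assms(4) ne i unfolding anisotropic_def by blast
  qed
  interpret D: diagonal_form to_ac n a \<alpha>
    using emb char2 \<alpha> \<alpha>_independent assms(2) by unfold_locales auto
  have Dq: "D.q = q" by (simp add: D.q_def q)
  obtain u where u: "\<And>c. (\<forall>i<n. (\<Sum>j<m. c j * u j i) = 0) \<Longrightarrow> (\<forall>j<m. c j = 0)"
    and q': "q' = msubst (\<lambda>i. \<Sum>j<m. mconst (u j i) * mvar j) q"
    using assms(7) unfolding subform_def by blast
  interpret S: diagonal_subform to_ac n a \<alpha> m u
    using u perfect by unfold_locales blast+
  have r: "r = vec.dim (D.zeros (D.K0 n D.\<xi>))"
    using D.first_witt_index_eq_dim_zeros[OF D.generic_\<xi>] assms(6) by (simp add: Dq)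
  have "r \<ge> 1" using D.dim_zeros_pos r by simp
  then have m_r: "m + r = n + 1" using assms(8) by simp
  interpret C: complementary_subform to_ac n a \<alpha> m u r
    using r m_r by unfold_locales
  interpret k2: char_two "TYPE('k mpoly)" by (rule char_two_mpoly[OF char2])
  have "q' = (\<Sum>i<n. mconst (a i) * (\<Sum>j<m. mconst (u j i) * mvar j)\<^sup>2)"
    unfolding q' q by (simp add: msubst.meval_sum msubst.meval_mult msubst.meval_power)
  also have "\<dots> = (\<Sum>i<n. \<Sum>j<m. mconst (a i * (u j i)\<^sup>2) * (mvar j)\<^sup>2)"
  proof (intro sum.cong refl)
    fix i
    have "(\<Sum>j<m. mconst (u j i) * mvar j)\<^sup>2 = (\<Sum>j<m. mconst ((u j i)\<^sup>2) * (mvar j)\<^sup>2)"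
      by (simp add: k2.sum_square power_mult_distrib msubst.hom_power)
    then show "mconst (a i) * (\<Sum>j<m. mconst (u j i) * mvar j)\<^sup>2 =
        (\<Sum>j<m. mconst (a i * (u j i)\<^sup>2) * (mvar j)\<^sup>2)"
      by (simp add: sum_distrib_left mconst_mult mult.assoc)
  qed
  also have "\<dots> = (\<Sum>j<m. mconst (S.b j) * (mvar j)\<^sup>2)"
    unfolding S.b_def msubst.hom_sum sum_distrib_right by (rule sum.swap)
  also have "\<dots> = C.sub.q" by (simp add: C.sub.q_def)
  finally show ?thesis using C.index_and_birational by (simp add: Dq)
qed

end
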